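(* (1) For every L-tiling $T$ of the plane, its (colored) decomposition $\sigma T$ is again an L-tiling. (2) Every colored supertile is an L-tiling. (3) Conversely, every legal star occurs in a colored supertile (i.e. for each legal star there is a colored supertile and a vertex of one of its tiles such that the star within that supertile centered at that vertex is the given legal star).
   Context: Tiles. Let $\phi=\sqrt{(\sqrt5-1)/2}$, so $\phi^2+\phi^4=1$. The large proto-tile $L$ is the right triangle with hypotenuse $1$, large leg $\phi$, small leg $\phi^2$; the small proto-tile $S$ is the right triangle with hypotenuse $\phi$, large leg $\phi^2$, small leg $\phi^3$. Large (small) tiles are isometric images (reflections allowed) of $L$ (of $S$). A tiling is a family of tiles with pairwise disjoint interiors; $[T]$ is the union of the tiles of $T$; $T$ is a tiling of the plane if $[T]$ is the plane. A colored (decorated) tile is a tile each of whose three sides carries an orientation and a label in $\{0,1,2,3\}=\mathbb Z/4$, such that the hypotenuse and the small leg of a large tile and the large leg of a small tile have even labels and all the other sides have odd labels. A colored tiling consists of colored tiles. Decomposition. Fix a homothety $H$ with coefficient $1/\phi$. To decompose a colored tiling: increase all labels by 1 mod 4, keeping all orientations; cut each large tile by its altitude to the hypotenuse into a copy of $\phi L$ and a copy of $\phi S$, where the two parts of the hypotenuse keep its (increased) label and its orientation, and the altitude (as a side of both parts) gets label $0$ and is oriented from its foot to the vertex of the right angle; each small tile is left uncut (it is a copy of $\phi L$); finally apply $H$. The result is denoted $\sigma T$. A colored supertile of order $n\ge 0$ is $\sigma^n\{A\}$, where $A$ is a colored large tile. Stars. Let $A$ be a vertex of a tile of a colored tiling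 $T$. The star within $T$ centered at $A$ consists of all tiles of $T$ that contain the point $A$ (not necessarily as a vertex), considered without colors, together with the labels and orientations of precisely those sides of these tiles that contain $A$. The star is complete if the union of its tiles contains a neighborhood of $A$. Stars are considered up to isometry. Legal stars. A complete star is legal if, up to an isometry (reflections allowed), it is one of the stars $C_1,\dots,C_7$ described now. Place the center $A$ at the origin; the axis is a horizontal line through $A$. Write $h,b,a$ for the hypotenuse, large leg and small leg. $X^{xy}$ (with $X\in\{L,S\}$) is a tile of type $X$ with vertex at $A$, the two sides meeting at $A$ being $x$ and $y$. In the upper half-plane the tiles are listed clockwise from the left ray of the axis to the right ray; in the lower half-plane counterclockwise from the left ray to the right ray; in each $X^{xy}$ side $x$ comes first in this order, and consecutive tiles have adjacent sides along a common ray from $A$. $C_1$: upper $L^{ba},S^{ba}$; lower: one large tile whose large leg lies on the axis and contains $A$ in its interior, the right-angle vertex being at distance $\phi^5$ to the left of $A$ and the other end at distance $\phi^3$ to the right of $A$. $C_2$: upper $L^{ha},S^{bh},L^{ba}$; lower: one large tile whose hypotenuse lies on the axis, $A$ being the foot of its altitude, with the endpoint of the hypotenuse at the larger acute angle at distance $\phi^4$ to the left of $A$ and the other endpoint at distance $\phi^2$ to the right of $A$. $C_3$: upper $S^{ah},L^{bh},L^{ha},S^{bh}$; lower $S^{ab},L^{ab}$. $C_4$: upper $L^{ah},L^{hb},S^{ah},L^{bh}$; lower $L^{ab},S^{hb},L^{ah}$. $C_5$: upper $S^{ha},L^{bh},L^{ah},L^{hb}$; lower $S^{hb},L^{ah},L^{hb},S^{ha}$.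 $C_6$: upper $L^{ha},L^{hb},S^{ha},L^{bh}$; lower $L^{hb},S^{ha},L^{bh},L^{ha}$. $C_7$: upper $S^{ah},L^{bh},L^{ha},L^{hb}$; lower $L^{bh},L^{ha},L^{hb},S^{ah}$. Decoration of $C_n$: all sides containing $A$ and lying on the axis have one and the same orientation (either of the two) and one and the same label (either of the two labels congruent to $n$ mod 2). Every other side containing $A$ is either perpendicular to the axis, and then it is oriented away from $A$, or it forms with the axis the smaller acute angle $\arcsin((\sqrt5-1)/2)$ or the larger acute angle $\arccos((\sqrt5-1)/2)$, and then it is oriented towards $A$. In the upper half-plane the labels (mod 4) are: $n+1$ for sides at the smaller acute angle, $n+2$ for sides at the larger acute angle, $n+3$ for perpendicular sides. In the lower half-plane they are $n-1$, $n$, $n+1$, respectively. L-tilings. A colored tiling (of the plane or of a part of it) is an L-tiling if (i) any two sides of its tiles that share a common interval have matching (equal) orientations and labels, and (ii) every complete star within it is legal (for a tiling of the plane every star is complete). *)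

theory Defs
  imports "HOL-Analysis.Analysis" "HOL-Number_Theory.Cong"
begin

text \<open>The plane is the type \<^typ>\<open>complex\<close>.\<close>

definition phi :: real where
  "phi = sqrt ((sqrt 5 - 1) / 2)"

definition isometry :: "(complex \<Rightarrow> complex) \<Rightarrow> bool" where
  "isometry f \<longleftrightarrow> (\<forall>x y. dist (f x) (f y) = dist x y)"


section \<open>Tiles\<close>

datatype tile_size = Large | Small

datatype side = Hyp | BigLeg | SmallLeg

text \<open>
  A right triangle is stored with its vertices in the order: right angle, smaller acute angle
  (the common end of hypotenuse and large leg), larger acute angle (the common end of hypotenuse
  and small leg). The actual shape is imposed by \<open>is_tile\<close> below, so that scaled copies, which
  occur as intermediate results of the decomposition, have the same type.
\<close>

datatype tile = Tile (kind: tile_size) (vR: complex) (vS: complex) (vL: complex)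

fun ends :: "tile \<Rightarrow> side \<Rightarrow> complex \<times> complex" where
  "ends (Tile k r p q) Hyp = (p, q)"
| "ends (Tile k r p q) BigLeg = (r, p)"
| "ends (Tile k r p q) SmallLeg = (r, q)"

definition side_set :: "tile \<Rightarrow> side \<Rightarrow> complex set" where
  "side_set t s = closed_segment (fst (ends t s)) (snd (ends t s))"

definition vertices :: "tile \<Rightarrow> complex set" where
  "vertices t = {vR t, vS t, vL t}"

definition region :: "tile \<Rightarrow> complex set" where
  "region t = convex hull (vertices t)"

fun map_tile :: "(complex \<Rightarrow> complex) \<Rightarrow> tile \<Rightarrow> tile" where
  "map_tile f (Tile k r p q) = Tile k (f r) (f p) (f q)"

definition proto_L :: tile where
  "proto_L = Tile Large 0 (complex_of_real phi) (\<i> * complex_of_real (phi ^ 2))"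

definition proto_S :: tile where
  "proto_S = Tile Small 0 (complex_of_real (phi ^ 2)) (\<i> * complex_of_real (phi ^ 3))"

definition is_tile :: "tile \<Rightarrow> bool" where
  "is_tile t \<longleftrightarrow> (\<exists>f. isometry f \<and> (t = map_tile f proto_L \<or> t = map_tile f proto_S))"


section \<open>Colors\<close>

text \<open>
  A decoration of a side is its label, a residue mod 4 represented in \<open>{0..<4}\<close>, together with
  its orientation, represented by the unit vector that points along the side in the chosen
  direction. Thus equality of orientations of collinear sides of different lengths is equality of
  unit vectors.
\<close>

type_synonym decor = "nat \<times> complex"

type_synonym colored_tile = "tile \<times> (side \<Rightarrow> decor)"

fun even_side :: "tile_size \<Rightarrow> side \<Rightarrow> bool" where
  "even_side Large s \<longleftrightarrow> s = Hyp \<or> s = SmallLeg"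
| "even_side Small s \<longleftrightarrow> s = BigLeg"

definition is_colored_tile :: "colored_tile \<Rightarrow> bool" where
  "is_colored_tile = (\<lambda>(t, d). is_tile t \<and>
     (\<forall>s. fst (d s) < 4 \<and> (even (fst (d s)) \<longleftrightarrow> even_side (kind t) s) \<and>
          (case ends t s of (p, q) \<Rightarrow> snd (d s) \<in> {sgn (q - p), sgn (p - q)})))"

definition covered :: "colored_tile set \<Rightarrow> complex set" where
  "covered T = (\<Union>x\<in>T. region (fst x))"

definition colored_tiling :: "colored_tile set \<Rightarrow> bool" where
  "colored_tiling T \<longleftrightarrow> (\<forall>x\<in>T. is_colored_tile x) \<and>
     pairwise (\<lambda>x y. interior (region (fst x)) \<inter> interior (region (fst y)) = {}) T"

definition covers_plane :: "colored_tile set \<Rightarrow> bool" where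
  "covers_plane T \<longleftrightarrow> covered T = UNIV"


section \<open>Decomposition\<close>

definition altitude_foot :: "complex \<Rightarrow> complex \<Rightarrow> complex \<Rightarrow> complex" where
  "altitude_foot r p q = p + (((r - p) \<bullet> (q - p)) / ((q - p) \<bullet> (q - p))) *\<^sub>R (q - p)"

definition relabel :: "decor \<Rightarrow> decor" where
  "relabel = (\<lambda>(l, u). ((l + 1) mod 4, u))"

text \<open>
  The pieces before the homothety is applied: the sizes recorded in them are those the
  pieces have afterwards. For a large tile, the piece at the smaller acute angle \<open>p\<close> has the old
  large leg \<open>r p\<close> as its hypotenuse, and the piece at the larger acute angle \<open>q\<close> has the old small
  leg \<open>r q\<close> as its hypotenuse; the altitude is the small leg of the former and the large
  leg of the latter.
\<close>

fun cut :: "colored_tile \<Rightarrow> colored_tile set" where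
  "cut (Tile Large r p q, d) =
     (let f = altitude_foot r p q; alt = (0, sgn (r - f)) in
      {(Tile Large f p r,
        (\<lambda>s. case s of Hyp \<Rightarrow> relabel (d BigLeg) | BigLeg \<Rightarrow> relabel (d Hyp) | SmallLeg \<Rightarrow> alt)),
       (Tile Small f r q,
        (\<lambda>s. case s of Hyp \<Rightarrow> relabel (d SmallLeg) | BigLeg \<Rightarrow> alt | SmallLeg \<Rightarrow> relabel (d Hyp)))})"
| "cut (Tile Small r p q, d) = {(Tile Large r p q, (\<lambda>s. relabel (d s)))}"

text \<open>\<open>c\<close> is the center of the homothety \<open>H\<close>. Its coefficient is positive, so it does not
  change the unit vectors that encode orientations.\<close>

definition homothety :: "complex \<Rightarrow> complex \<Rightarrow> complex" where
  "homothety c z = c + (1 / phi) *\<^sub>R (z - c)"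

definition decomposition :: "complex \<Rightarrow> colored_tile set \<Rightarrow> colored_tile set" where
  "decomposition c T = (\<lambda>(t, d). (map_tile (homothety c) t, d)) ` (\<Union>x\<in>T. cut x)"

definition supertile :: "complex \<Rightarrow> colored_tile set \<Rightarrow> bool" where
  "supertile c T \<longleftrightarrow> (\<exists>n t d. is_colored_tile (t, d) \<and> kind t = Large \<and>
     T = (decomposition c ^^ n) {(t, d)})"


section \<open>Stars\<close>

text \<open>A star is its center together with tiles on which only some of the sides
  are decorated.\<close>

type_synonym star = "complex \<times> (tile \<times> (side \<Rightarrow> decor option)) set"

definition star_at :: "colored_tile set \<Rightarrow> complex \<Rightarrow> star" where
  "star_at T A = (A, {(t, \<lambda>s. if A \<in> side_set t s then Some (d s) else None) | t d.
                       (t, d) \<in> T \<and> A \<in> region t})"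

definition complete_star :: "star \<Rightarrow> bool" where
  "complete_star S \<longleftrightarrow> fst S \<in> interior (\<Union>x\<in>snd S. region (fst x))"

text \<open>An isometry acts on orientations by its linear part \<open>\<lambda>u. f u - f 0\<close>.\<close>

definition map_decor :: "(complex \<Rightarrow> complex) \<Rightarrow> decor \<Rightarrow> decor" where
  "map_decor f = (\<lambda>(l, u). (l, f u - f 0))"

definition map_star :: "(complex \<Rightarrow> complex) \<Rightarrow> star \<Rightarrow> star" where
  "map_star f S =
     (f (fst S), (\<lambda>(t, e). (map_tile f t, (\<lambda>s. map_option (map_decor f) (e s)))) ` snd S)"

definition congruent_stars :: "star \<Rightarrow> star \<Rightarrow> bool" where
  "congruent_stars S S' \<longleftrightarrow> (\<exists>f. isometry f \<and> S' = map_star f S)"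

definition star_vertex :: "colored_tile set \<Rightarrow> complex \<Rightarrow> bool" where
  "star_vertex T A \<longleftrightarrow> (\<exists>(t, d)\<in>T. A \<in> vertices t)"


section \<open>Legal stars\<close>

definition small_angle :: real where
  "small_angle = arcsin ((sqrt 5 - 1) / 2)"

definition large_angle :: real where
  "large_angle = arccos ((sqrt 5 - 1) / 2)"

fun side_length :: "tile_size \<Rightarrow> side \<Rightarrow> real" where
  "side_length Large Hyp = 1"
| "side_length Large BigLeg = phi"
| "side_length Large SmallLeg = phi ^ 2"
| "side_length Small Hyp = phi"
| "side_length Small BigLeg = phi ^ 2"
| "side_length Small SmallLeg = phi ^ 3"

text \<open>
  The corners of a tile, named by the two sides meeting there, in the order in which a
  listing of a star meets them.
\<close>

datatype corner = BA | AB | HB | BH | HA | AH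

fun corner_sides :: "corner \<Rightarrow> side \<times> side" where
  "corner_sides BA = (BigLeg, SmallLeg)"
| "corner_sides AB = (SmallLeg, BigLeg)"
| "corner_sides HB = (Hyp, BigLeg)"
| "corner_sides BH = (BigLeg, Hyp)"
| "corner_sides HA = (Hyp, SmallLeg)"
| "corner_sides AH = (SmallLeg, Hyp)"

fun corner_angle :: "corner \<Rightarrow> real" where
  "corner_angle BA = pi / 2"
| "corner_angle AB = pi / 2"
| "corner_angle HB = small_angle"
| "corner_angle BH = small_angle"
| "corner_angle HA = large_angle"
| "corner_angle AH = large_angle"

text \<open>The tile of size \<open>k\<close> with the given corner at the origin, where \<open>x\<close> and \<open>y\<close> are the
  other ends of the first and the second side of that corner.\<close>

fun corner_tile :: "tile_size \<Rightarrow> corner \<Rightarrow> complex \<Rightarrow> complex \<Rightarrow> tile" where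
  "corner_tile k BA x y = Tile k 0 x y"
| "corner_tile k AB x y = Tile k 0 y x"
| "corner_tile k HB x y = Tile k y 0 x"
| "corner_tile k BH x y = Tile k x 0 y"
| "corner_tile k HA x y = Tile k y x 0"
| "corner_tile k AH x y = Tile k x y 0"

text \<open>The tiles of a listing, placed clockwise around the origin starting from the ray with
  unit direction vector \<open>u\<close>.\<close>

fun fan :: "complex \<Rightarrow> (tile_size \<times> corner) list \<Rightarrow> tile set" where
  "fan u [] = {}"
| "fan u ((k, x) # ts) =
     (let v = u * cis (- corner_angle x) in
      insert (corner_tile k x (side_length k (fst (corner_sides x)) *\<^sub>R u)
                              (side_length k (snd (corner_sides x)) *\<^sub>R v))
             (fan v ts))"

definition upper_fan :: "(tile_size \<times> corner) list \<Rightarrow> tile set" where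
  "upper_fan ts = fan (- 1) ts"

text \<open>Counterclockwise listings in the lower half-plane are mirror images of clockwise
  listings in the upper one.\<close>

definition lower_fan :: "(tile_size \<times> corner) list \<Rightarrow> tile set" where
  "lower_fan ts = map_tile cnj ` fan (- 1) ts"

text \<open>The seven legal stars: their upper and lower tiles for center \<open>0\<close> and the real axis
  as the axis (the functions are only used for \<open>n\<close> from \<open>1\<close> to \<open>7\<close>).\<close>

definition upper_tiles :: "nat \<Rightarrow> tile set" where
  "upper_tiles n = upper_fan
     (if n = 1 then [(Large, BA), (Small, BA)]
      else if n = 2 then [(Large, HA), (Small, BH), (Large, BA)]
      else if n = 3 then [(Small, AH), (Large, BH), (Large, HA), (Small, BH)]
      else if n = 4 then [(Large, AH), (Large, HB), (Small, AH), (Large, BH)]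
      else if n = 5 then [(Small, HA), (Large, BH), (Large, AH), (Large, HB)]
      else if n = 6 then [(Large, HA), (Large, HB), (Small, HA), (Large, BH)]
      else [(Small, AH), (Large, BH), (Large, HA), (Large, HB)])"

text \<open>In the first case the large leg lies on the axis; in the second one the hypotenuse does,
  and the altitude has length \<open>phi ^ 3\<close>.\<close>

definition lower_tiles :: "nat \<Rightarrow> tile set" where
  "lower_tiles n =
     (if n = 1 then {Tile Large (complex_of_real (- (phi ^ 5))) (complex_of_real (phi ^ 3))
                       (Complex (- (phi ^ 5)) (- (phi ^ 2)))}
      else if n = 2 then {Tile Large (Complex 0 (- (phi ^ 3))) (complex_of_real (phi ^ 2))
                            (complex_of_real (- (phi ^ 4)))}
      else lower_fan
        (if n = 3 then [(Small, AB), (Large, AB)]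
         else if n = 4 then [(Large, AB), (Small, HB), (Large, AH)]
         else if n = 5 then [(Small, HB), (Large, AH), (Large, HB), (Small, HA)]
         else if n = 6 then [(Large, HB), (Small, HA), (Large, BH), (Large, HA)]
         else [(Large, BH), (Large, HA), (Large, HB), (Small, AH)]))"

text \<open>The angle between the real axis and the line spanned by \<open>z\<close>.\<close>

definition axis_angle :: "complex \<Rightarrow> real" where
  "axis_angle z = arcsin (\<bar>Im z\<bar> / cmod z)"

text \<open>
  The decoration of a side of a tile in a legal star: \<open>l\<close> and \<open>w\<close> are the label and the orientation
  of the axis sides, and \<open>i\<close>, \<open>j\<close>, \<open>k\<close> are the labels at the smaller acute angle, at the larger acute
  angle and at the right angle with the axis. A side that contains the center \<open>0\<close> and is not on
  the axis has \<open>0\<close> as one end; \<open>z\<close> is its other end.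
\<close>

definition legal_decor ::
    "nat \<times> nat \<times> nat \<Rightarrow> nat \<Rightarrow> complex \<Rightarrow> tile \<Rightarrow> side \<Rightarrow> decor option" where
  "legal_decor = (\<lambda>(i, j, k) l w t s.
     if 0 \<notin> side_set t s then None
     else if side_set t s \<subseteq> \<real> then Some (l, w)
     else
       (let z = (if fst (ends t s) = 0 then snd (ends t s) else fst (ends t s)) in
        if axis_angle z = small_angle then Some (i, - sgn z)
        else if axis_angle z = large_angle then Some (j, - sgn z)
        else Some (k, sgn z)))"

text \<open>In the lower half-plane, \<open>n - 1\<close> is written as \<open>n + 3\<close>, because labels are residues mod 4.\<close>

definition legal_star :: "nat \<Rightarrow> nat \<Rightarrow> complex \<Rightarrow> star" where
  "legal_star n l w =
     (0, (\<lambda>t. (t, legal_decor ((n + 1) mod 4, (n + 2) mod 4, (n + 3) mod 4) l w t)) ` upper_tiles n \<union>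
         (\<lambda>t. (t, legal_decor ((n + 3) mod 4, n mod 4, (n + 1) mod 4) l w t)) ` lower_tiles n)"

definition legal :: "star \<Rightarrow> bool" where
  "legal S \<longleftrightarrow> complete_star S \<and>
     (\<exists>n l w. n \<in> {1..7} \<and> l < 4 \<and> [l = n] (mod 2) \<and> w \<in> {1, - 1} \<and>
        congruent_stars (legal_star n l w) S)"


section \<open>L-tilings\<close>

definition matching :: "colored_tile set \<Rightarrow> bool" where
  "matching T \<longleftrightarrow>
     (\<forall>(t, d)\<in>T. \<forall>(t', d')\<in>T. \<forall>s s'.
        (\<exists>x y. x \<noteq> y \<and> closed_segment x y \<subseteq> side_set t s \<inter> side_set t' s') \<longrightarrow> d s = d' s')"

definition L_tiling :: "colored_tile set \<Rightarrow> bool" where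
  "L_tiling T \<longleftrightarrow> colored_tiling T \<and> matching T \<and>
     (\<forall>A. star_vertex T A \<and> complete_star (star_at T A) \<longrightarrow> legal (star_at T A))"

end

theory Submission
  imports Defs
begin

text \<open>
  The decomposition acts locally, and there are only seven legal stars, so the legality of stars can
  be followed from a tiling to its decomposition vertex by vertex. A vertex of the decomposition is
  either an old vertex or the foot of an altitude that has just been drawn.
  
  At an old vertex the new star is computed from the old one. The sides through the center determine
  the decorations of the pieces through the center (\<open>star_decomposition\<close>), the construction commutes
  with isometries (\<open>cut_star_isometry\<close>), and hence only the seven legal stars themselves have to be
  decomposed. Their tiles are fans around the center, and cutting a fan replaces each corner by the
  one or two corners of \<open>corner_pieces\<close>. The result is that the star \<open>C_n\<close> becomes \<open>C_(n+1)\<close> for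
  \<open>n < 7\<close>, with the label of the axis increased by 1, while \<open>C_7\<close> becomes \<open>C_6\<close> turned by a half-turn
  (\<open>evolve_legal_Suc\<close>, \<open>evolve_7\<close>). The only new sides are altitudes of large tiles; their
  label 0 is the one prescribed by the next star.
  
  At a new vertex \<open>F\<close>, the altitude foot of a large tile \<open>t\<close>, the star depends on the tiles that touch
  \<open>t\<close> from the other side of its hypotenuse near \<open>F\<close>. Among the legal stars only \<open>C_2\<close> has its center
  inside a hypotenuse, and there the center is the altitude foot. So if \<open>F\<close> is not an old vertex, then
  no vertex lies inside the hypotenuse of \<open>t\<close>, and a tile \<open>t'\<close> on the other side has a side that covers
  this hypotenuse, hence equals it. The legal stars show that \<open>t'\<close> is not the mirror image of \<open>t\<close>, so
  the two tiles form a rectangle cut along its diagonal (\<open>tile_across_foot\<close>), and the star at \<open>F\<close>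
  becomes \<open>C_1\<close> (\<open>evolve_rectangle\<close>).
  
  For supertiles this has to work near the boundary as well, where stars are not complete. Therefore
  two properties are propagated (\<open>locally_legal\<close>): at every vertex the tiles, without their colors,
  are among the tiles of a copy of a legal star; and complete stars are legal with their colors. The
  first suffices for the argument about new vertices, it holds for a single tile whatever its colors
  are, and its preservation is the uncolored part of the same computation. In a tiling of the plane
  all stars are complete because tilings are locally finite (\<open>complete_star_plane\<close>).
  
  Conversely, \<open>C_1\<close> occurs in supertiles wherever two large tiles form a rectangle, and
  \<open>C_2\<close>, ..., \<open>C_7\<close> occur at the same vertex in the next six decompositions; so only the label and the
  orientation of the axis of \<open>C_1\<close> matter. The two sides of a freshly drawn altitude turn into two coinciding
  hypotenuses with label 2 after two further steps, and six steps later there is a pair of coinciding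
  hypotenuses on the same line with label 0 (\<open>rectangles_occur\<close>). This yields both labels, 3 and 1, of
  \<open>C_1\<close>; the two altitude feet on the diagonal of the rectangle see opposite orientations
  (\<open>occurs_first\<close>).
\<close>

section \<open>The number \<open>phi\<close> and the two acute angles\<close>

lemma phi_sq: "phi\<^sup>2 = (sqrt 5 - 1) / 2"
  unfolding phi_def by simp

lemma phi_pos: "0 < phi"
  unfolding phi_def by simp

lemma phi_four: "phi ^ 4 = 1 - phi\<^sup>2"
proof -
  have "phi ^ 4 = (phi\<^sup>2)\<^sup>2" by simp
  also have "\<dots> = 1 - phi\<^sup>2" unfolding phi_sq by (simp add: power2_eq_square[of "sqrt 5 - 1"] field_simps)
  finally show ?thesis .
qed

lemma phi_sq_lt_one: "phi\<^sup>2 < 1"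
proof -
  have "sqrt 5 < 3" by (rule real_less_lsqrt) simp_all
  then show ?thesis by (simp add: phi_sq)
qed

lemma phi_lt_one: "phi < 1"
  using phi_sq_lt_one phi_pos by (simp add: power_less_one_iff)

lemma phi_sq_lt_phi: "phi\<^sup>2 < phi"
  using phi_lt_one phi_pos by (simp add: power2_eq_square)

lemma phi_ne_zero [simp]: "phi \<noteq> 0"
  using phi_pos by simp

text \<open>Rewriting with these equations, after powers have been multiplied out, decides the equations
  between polynomials in \<open>phi\<close> that occur in computations with coordinates.\<close>

lemma phi_reduce: "phi * (phi * (phi * phi)) = 1 - phi * phi"
  "phi * (phi * (phi * (phi * x))) = x - phi * (phi * x)"
proof -
  show 1: "phi * (phi * (phi * phi)) = 1 - phi * phi"
    using phi_four by (simp add: power_numeral_reduce)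
  have "phi * (phi * (phi * (phi * x))) = (phi * (phi * (phi * phi))) * x" by simp
  then show "phi * (phi * (phi * (phi * x))) = x - phi * (phi * x)"
    unfolding 1 by (simp add: algebra_simps)
qed

lemma phi_powers: "phi ^ 5 = phi - phi ^ 3" "phi ^ 6 = 2 * phi\<^sup>2 - 1"
  by (simp_all add: power_numeral_reduce phi_reduce algebra_simps)

lemma angles_sum: "small_angle + large_angle = pi / 2"
proof -
  have "0 \<le> (sqrt 5 - 1) / 2" "(sqrt 5 - 1) / 2 \<le> 1"
    using phi_sq phi_sq_lt_one zero_le_power2[of phi] by linarith+
  then show ?thesis
    unfolding small_angle_def large_angle_def by (subst arccos_arcsin_eq) auto
qed

lemma cis_small_angle: "cis small_angle = Complex phi (phi\<^sup>2)"
  and cis_large_angle: "cis large_angle = Complex (phi\<^sup>2) phi"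
proof -
  have b: "-1 \<le> phi\<^sup>2" "phi\<^sup>2 \<le> 1" using phi_sq_lt_one zero_le_power2[of phi] by linarith+
  have "1 - (phi\<^sup>2)\<^sup>2 = phi\<^sup>2" using phi_four by simp
  then have s: "sqrt (1 - (phi\<^sup>2)\<^sup>2) = phi" using phi_pos by (simp add: real_sqrt_unique)
  show "cis small_angle = Complex phi (phi\<^sup>2)"
    using b s by (simp add: complex_eq_iff small_angle_def phi_sq[symmetric] cos_arcsin)
  show "cis large_angle = Complex (phi\<^sup>2) phi"
    using b s by (simp add: complex_eq_iff large_angle_def phi_sq[symmetric] sin_arccos)
qed

lemma small_angle_arcsin: "small_angle = arcsin (phi\<^sup>2)"
  by (simp add: small_angle_def phi_sq)

lemma large_angle_arcsin: "large_angle = arcsin phi"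
proof -
  have b: "0 \<le> phi\<^sup>2" "phi\<^sup>2 \<le> 1" using phi_sq_lt_one by auto
  have "1 - (phi\<^sup>2)\<^sup>2 = phi\<^sup>2" using phi_four by simp
  then have "sqrt (1 - (phi\<^sup>2)\<^sup>2) = phi" using phi_pos by (simp add: real_sqrt_unique)
  then show ?thesis using b
    by (simp add: large_angle_def phi_sq[symmetric] arccos_arcsin_sqrt_pos)
qed

lemma small_angle_ne_large_angle: "large_angle \<noteq> small_angle"
proof
  assume "large_angle = small_angle"
  then have "Complex (phi\<^sup>2) phi = Complex phi (phi\<^sup>2)"
    using cis_small_angle cis_large_angle by simp
  then show False using phi_sq_lt_phi by simp
qed


section \<open>Affine maps and isometries\<close>

text \<open>Convex hulls, segments, interiors and altitude feet are affine notions, so isometries, homotheties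
  and changes of coordinates are treated together.\<close>

definition affine_inj :: "(complex \<Rightarrow> complex) \<Rightarrow> bool" where
  "affine_inj f \<longleftrightarrow> (\<exists>a L. linear L \<and> inj L \<and> f = (\<lambda>z. a + L z))"

lemma affine_injE:
  assumes "affine_inj f"
  obtains a L where "linear L" "inj L" "f = (\<lambda>z. a + L z)"
  using assms unfolding affine_inj_def by blast

lemma affine_inj_inj: "affine_inj f \<Longrightarrow> inj f"
  by (erule affine_injE) (auto simp: inj_def)

lemma affine_inj_eq_iff: "affine_inj f \<Longrightarrow> f x = f y \<longleftrightarrow> x = y"
  using affine_inj_inj inj_eq by metis

lemma affine_inj_surj: "affine_inj f \<Longrightarrow> surj f"
proof (erule affine_injE)
  fix a L assume "linear L" "inj L" and f: "f = (\<lambda>z. a + L z)"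
  then have "surj L" using linear_injective_imp_surjective by blast
  then have "\<exists>x. y = f x" for y unfolding f by (metis add_diff_cancel_left' diff_add_cancel add.commute surjD)
  then show "surj f" by (auto simp: surj_def)
qed

lemma affine_inj_comb:
  assumes "affine_inj f" "x + y = 1"
  shows "f (x *\<^sub>R p + y *\<^sub>R q) = x *\<^sub>R f p + y *\<^sub>R f q"
  using assms(1)
proof (rule affine_injE)
  fix a L assume L: "linear L" and f: "f = (\<lambda>z. a + L z)"
  have "a = (x + y) *\<^sub>R a" using assms(2) by simp
  then have "a = x *\<^sub>R a + y *\<^sub>R a" by (simp only: scaleR_add_left)
  then show ?thesis unfolding f
    by (simp add: linear_add[OF L] linear_scale[OF L] scaleR_add_right)
qed

lemma affine_inj_convex_hull: "affine_inj f \<Longrightarrow> convex hull (f ` S) = f ` (convex hull S)"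
proof (erule affine_injE)
  fix a L assume L: "linear L" and f: "f = (\<lambda>z. a + L z)"
  have "f ` A = (\<lambda>x. a + x) ` L ` A" for A unfolding f by auto
  then show ?thesis using convex_hull_linear_image[OF L, of S] convex_hull_translation[of a "L ` S"]
    by simp
qed

lemma affine_inj_interior: "affine_inj f \<Longrightarrow> interior (f ` S) = f ` interior S"
proof (erule affine_injE)
  fix a L assume L: "linear L" "inj L" and f: "f = (\<lambda>z. a + L z)"
  have "f ` A = (\<lambda>x. a + x) ` L ` A" for A unfolding f by auto
  then show ?thesis using interior_injective_linear_image[OF L, of S] interior_translation[of a "L ` S"]
    by simp
qed

lemma isometry_orthogonal:
  assumes "isometry f"
  shows "orthogonal_transformation (\<lambda>z. f z - f 0)"
  using assms unfolding orthogonal_transformation_isometry isometry_def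
  by (simp add: dist_norm)

lemma isometry_affine_inj: "isometry f \<Longrightarrow> affine_inj f"
  unfolding affine_inj_def
  using isometry_orthogonal[of f] orthogonal_transformation_linear orthogonal_transformation_inj
  by (intro exI[of _ "f 0"] exI[of _ "\<lambda>z. f z - f 0"]) auto

text \<open>The map \<open>\<lambda>u. f u - f 0\<close> is the one by which an isometry acts on orientations.\<close>

lemma isometry_linear_part:
  assumes "isometry f"
  shows "f x - f y = f (x - y) - f 0"
  using linear_diff[OF orthogonal_transformation_linear[OF isometry_orthogonal[OF assms]], of x y]
  by simp

lemma isometry_scale:
  assumes "isometry f"
  shows "f (k *\<^sub>R z) - f 0 = k *\<^sub>R (f z - f 0)"
  using linear_scale[OF orthogonal_transformation_linear[OF isometry_orthogonal[OF assms]]] by simp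

lemma isometry_comp: "isometry f \<Longrightarrow> isometry g \<Longrightarrow> isometry (\<lambda>z. f (g z))"
  by (simp add: isometry_def)

lemma isometry_id: "isometry (\<lambda>z. z)"
  by (simp add: isometry_def)

lemma isometry_inverse:
  assumes "isometry f"
  obtains g where "isometry g" "\<And>z. g (f z) = z" "\<And>z. f (g z) = z"
proof
  have a: "inj f" "surj f" using assms isometry_affine_inj affine_inj_inj affine_inj_surj by blast+
  show 1: "\<And>z. inv f (f z) = z" "\<And>z. f (inv f z) = z"
    using a by (simp_all add: surj_f_inv_f)
  show "isometry (inv f)"
    using assms 1(2) unfolding isometry_def by metis
qed

lemma sgn_isometry:
  assumes "isometry f"
  shows "f (sgn z) - f 0 = sgn (f z - f 0)"
proof -
  let ?L = "\<lambda>z. f z - f 0"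
  have o: "orthogonal_transformation ?L" by (rule isometry_orthogonal[OF assms])
  then have "norm (?L z) = norm z" by (rule orthogonal_transformation_norm)
  moreover have "?L (inverse (norm z) *\<^sub>R z) = inverse (norm z) *\<^sub>R ?L z"
    using linear_scale[OF orthogonal_transformation_linear[OF o]] .
  ultimately show ?thesis by (simp add: sgn_div_norm)
qed

lemma kind_map_tile [simp]: "kind (map_tile f t) = kind t"
  and vR_map_tile [simp]: "vR (map_tile f t) = f (vR t)"
  and vS_map_tile [simp]: "vS (map_tile f t) = f (vS t)"
  and vL_map_tile [simp]: "vL (map_tile f t) = f (vL t)"
  by (cases t; simp)+

lemma map_tile_comp: "map_tile f (map_tile g t) = map_tile (\<lambda>z. f (g z)) t"
  by (cases t) simp

lemma map_tile_id [simp]: "map_tile (\<lambda>z. z) t = t"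
  by (cases t) simp

lemma map_tile_eqI:
  "kind t = kind t' \<Longrightarrow> f (vR t) = vR t' \<Longrightarrow> f (vS t) = vS t' \<Longrightarrow> f (vL t) = vL t' \<Longrightarrow> map_tile f t = t'"
  by (cases t; cases t') simp

lemma vertices_map_tile: "vertices (map_tile f t) = f ` vertices t"
  by (simp add: vertices_def)

lemma ends_map_tile: "ends (map_tile f t) s = (f (fst (ends t s)), f (snd (ends t s)))"
  by (cases t; cases s) simp_all

lemma region_map_tile: "affine_inj f \<Longrightarrow> region (map_tile f t) = f ` region t"
  by (simp add: region_def vertices_map_tile affine_inj_convex_hull)

lemma interior_region_map_tile:
  "affine_inj f \<Longrightarrow> interior (region (map_tile f t)) = f ` interior (region t)"
  by (simp add: region_map_tile affine_inj_interior)

lemma affine_inj_closed_segment: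
  "affine_inj f \<Longrightarrow> closed_segment (f a) (f b) = f ` closed_segment a b"
  using affine_inj_convex_hull[of f "{a, b}"] by (simp add: segment_convex_hull)

lemma affine_inj_open_segment:
  "affine_inj f \<Longrightarrow> open_segment (f a) (f b) = f ` open_segment a b"
  using affine_inj_closed_segment[of f a b] affine_inj_inj[of f]
  by (auto simp: open_segment_def affine_inj_eq_iff)

lemma side_set_map_tile: "affine_inj f \<Longrightarrow> side_set (map_tile f t) s = f ` side_set t s"
  by (simp add: side_set_def ends_map_tile affine_inj_closed_segment)

section \<open>Tiles as affine images of one triangle\<close>

definition nondeg :: "tile \<Rightarrow> bool" where
  "nondeg t \<longleftrightarrow> Im (cnj (vS t - vR t) * (vL t - vR t)) \<noteq> 0"

text \<open>The coordinates in which the vertices of the triangle are \<open>0\<close>, \<open>1\<close> and \<open>\<i>\<close>.\<close>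

definition frame :: "tile \<Rightarrow> complex \<Rightarrow> complex" where
  "frame t z = vR t + Re z *\<^sub>R (vS t - vR t) + Im z *\<^sub>R (vL t - vR t)"

text \<open>The barycentric form of the altitude foot: the altitude of a tile divides its hypotenuse in the
  ratio \<open>phi\<^sup>2 : phi ^ 4\<close>. In this form it commutes with affine maps.\<close>

definition foot :: "tile \<Rightarrow> complex" where
  "foot t = phi ^ 4 *\<^sub>R vS t + phi\<^sup>2 *\<^sub>R vL t"

definition pieces :: "tile \<Rightarrow> tile set" where
  "pieces t = (if kind t = Large
     then {Tile Large (foot t) (vS t) (vR t), Tile Small (foot t) (vR t) (vL t)}
     else {Tile Large (vR t) (vS t) (vL t)})"

lemma frame_vertices: "frame t 0 = vR t" "frame t 1 = vS t" "frame t \<i> = vL t"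
  by (simp_all add: frame_def)

lemma map_tile_frame: "map_tile (frame t) (Tile (kind t) 0 1 \<i>) = t"
  by (cases t) (simp add: frame_vertices)

lemma frame_affine_inj:
  assumes "nondeg t"
  shows "affine_inj (frame t)"
proof -
  let ?d = "vS t - vR t" and ?e = "vL t - vR t"
  let ?L = "\<lambda>z. Re z *\<^sub>R ?d + Im z *\<^sub>R ?e"
  have lin: "linear ?L"
    by (rule linearI) (simp_all add: algebra_simps)
  have "z = 0" if "?L z = 0" for z
  proof -
    have 1: "Re z * Re ?d + Im z * Re ?e = 0" "Re z * Im ?d + Im z * Im ?e = 0"
      using that by (simp_all add: complex_eq_iff)
    have 2: "Re ?d * Im ?e - Im ?d * Re ?e \<noteq> 0"
      using assms by (simp add: nondeg_def algebra_simps)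
    have "Re z * (Re ?d * Im ?e - Im ?d * Re ?e) = 0" "Im z * (Re ?d * Im ?e - Im ?d * Re ?e) = 0"
      using 1 by algebra+
    then show "z = 0" using 2 by (simp add: complex_eq_iff)
  qed
  then have "inj ?L" using linear_injective_0[OF lin] by blast
  moreover have "frame t = (\<lambda>z. vR t + ?L z)" by (auto simp: frame_def)
  ultimately show ?thesis using lin unfolding affine_inj_def by blast
qed

definition std_region :: "complex set" where
  "std_region = {z. 0 \<le> Re z \<and> 0 \<le> Im z \<and> Re z + Im z \<le> 1}"

lemma convex_hull_std: "convex hull {0, 1, \<i>} = std_region"
proof (intro equalityI subsetI)
  fix z assume "z \<in> convex hull {0, 1, \<i>}"
  then show "z \<in> std_region" by (auto simp: convex_hull_3 std_region_def)
next
  fix z assume "z \<in> std_region"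
  then have "z = (1 - Re z - Im z) *\<^sub>R 0 + Re z *\<^sub>R 1 + Im z *\<^sub>R \<i>" "0 \<le> 1 - Re z - Im z" "0 \<le> Re z" "0 \<le> Im z"
    by (auto simp: std_region_def complex_eq_iff)
  then show "z \<in> convex hull {0, 1, \<i>}" unfolding convex_hull_3
    by (intro CollectI exI[of _ "1 - Re z - Im z"] exI[of _ "Re z"] exI[of _ "Im z"]) auto
qed

lemma interior_std_region: "interior std_region = {z. 0 < Re z \<and> 0 < Im z \<and> Re z + Im z < 1}"
proof -
  have 1: "std_region = {z. (1::complex) \<bullet> z \<ge> 0} \<inter> {z. \<i> \<bullet> z \<ge> 0} \<inter> {z. (1 + \<i>) \<bullet> z \<le> 1}"
    by (auto simp: std_region_def inner_complex_def)
  have 2: "interior {z. (1::complex) \<bullet> z \<ge> 0} = {z. 1 \<bullet> z > 0}"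
    by (rule interior_halfspace_ge) simp
  have 3: "interior {z. \<i> \<bullet> z \<ge> 0} = {z. \<i> \<bullet> z > 0}"
    by (rule interior_halfspace_ge) simp
  have 4: "interior {z. (1 + \<i>) \<bullet> z \<le> 1} = {z. (1 + \<i>) \<bullet> z < 1}"
    by (rule interior_halfspace_le) (simp add: complex_eq_iff)
  have "interior std_region = {z. 1 \<bullet> z > 0} \<inter> {z. \<i> \<bullet> z > 0} \<inter> {z. (1 + \<i>) \<bullet> z < 1}"
    unfolding 1 interior_Int 2 3 4 ..
  then show ?thesis by (auto simp: inner_complex_def)
qed

lemma region_std: "region (Tile k 0 1 \<i>) = std_region"
  by (simp add: region_def vertices_def convex_hull_std)

lemma region_frame: "nondeg t \<Longrightarrow> region t = frame t ` std_region"
  using region_map_tile[OF frame_affine_inj, of t "Tile (kind t) 0 1 \<i>", unfolded map_tile_frame]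
  by (simp add: region_std)

lemma interior_region_frame:
  "nondeg t \<Longrightarrow> interior (region t) = frame t ` {z. 0 < Re z \<and> 0 < Im z \<and> Re z + Im z < 1}"
  by (simp add: region_frame affine_inj_interior[OF frame_affine_inj] interior_std_region)

lemma side_set_frame: "nondeg t \<Longrightarrow> side_set t s = frame t ` side_set (Tile (kind t) 0 1 \<i>) s"
  using side_set_map_tile[OF frame_affine_inj, of t "Tile (kind t) 0 1 \<i>", unfolded map_tile_frame]
  by simp

lemma mem_frame_image: "nondeg t \<Longrightarrow> frame t z \<in> frame t ` X \<longleftrightarrow> z \<in> X"
  using affine_inj_inj[OF frame_affine_inj] by (simp add: inj_image_mem_iff)

lemma convex_region: "convex (region t)"
  by (simp add: region_def)

lemma compact_region: "compact (region t)"
  unfolding region_def by (intro compact_convex_hull finite_imp_compact) (simp add: vertices_def)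

lemma closed_region: "closed (region t)"
  using compact_region compact_imp_closed by blast

lemma vertices_subset_region: "vertices t \<subseteq> region t"
  by (simp add: region_def hull_subset)

lemma vertex_in_region [simp]: "vR t \<in> region t" "vS t \<in> region t" "vL t \<in> region t"
  using vertices_subset_region[of t] by (auto simp: vertices_def)

lemma ends_in_vertices: "fst (ends t s) \<in> vertices t" "snd (ends t s) \<in> vertices t"
  by (cases t; cases s; simp add: vertices_def)+

lemma side_set_subset_region: "side_set t s \<subseteq> region t"
  unfolding side_set_def
  using ends_in_vertices vertices_subset_region convex_region
  by (intro closed_segment_subset) blast+

lemma interior_region_nonempty: "nondeg t \<Longrightarrow> interior (region t) \<noteq> {}"
proof -
  assume "nondeg t"
  moreover have "Complex (1/4) (1/4) \<in> {z. 0 < Re z \<and> 0 < Im z \<and> Re z + Im z < 1}" by simp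
  ultimately show ?thesis by (metis (no_types, lifting) empty_iff image_eqI interior_region_frame)
qed

text \<open>A nondegenerate triangle is the closure of its interior, and an open set that meets the closure
  of a set meets the set.\<close>

lemma interior_disjoint_region:
  assumes "interior X \<inter> interior (region t) = {}" "nondeg t"
  shows "interior X \<inter> region t = {}"
proof -
  have "closure (interior (region t)) = region t"
    using convex_closure_interior[OF convex_region interior_region_nonempty[OF assms(2)]]
    by (simp add: closed_region)
  then show ?thesis using open_Int_closure_eq_empty[of "interior X" "interior (region t)"] assms(1)
    by simp
qed

lemma side_std:
  "side_set (Tile k 0 1 \<i>) BigLeg = {z. 0 \<le> Re z \<and> Re z \<le> 1 \<and> Im z = 0}"
  "side_set (Tile k 0 1 \<i>) SmallLeg = {z. 0 \<le> Im z \<and> Im z \<le> 1 \<and> Re z = 0}"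
  "side_set (Tile k 0 1 \<i>) Hyp = {z. 0 \<le> Re z \<and> 0 \<le> Im z \<and> Re z + Im z = 1}"
proof -
  show "side_set (Tile k 0 1 \<i>) BigLeg = {z. 0 \<le> Re z \<and> Re z \<le> 1 \<and> Im z = 0}"
    by (auto simp: side_set_def closed_segment_def complex_eq_iff)
  show "side_set (Tile k 0 1 \<i>) SmallLeg = {z. 0 \<le> Im z \<and> Im z \<le> 1 \<and> Re z = 0}"
    by (auto simp: side_set_def closed_segment_def complex_eq_iff)
  show "side_set (Tile k 0 1 \<i>) Hyp = {z. 0 \<le> Re z \<and> 0 \<le> Im z \<and> Re z + Im z = 1}"
    by (auto simp: side_set_def closed_segment_def complex_eq_iff intro!: exI)
qed

lemma side_disjoint_interior: "nondeg t \<Longrightarrow> side_set t s \<inter> interior (region t) = {}"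
  by (cases s) (auto simp: side_set_frame interior_region_frame side_std
      affine_inj_eq_iff[OF frame_affine_inj])

lemma vertex_in_side:
  assumes "nondeg t"
  shows "vR t \<in> side_set t s \<longleftrightarrow> s \<noteq> Hyp" "vS t \<in> side_set t s \<longleftrightarrow> s \<noteq> SmallLeg"
    "vL t \<in> side_set t s \<longleftrightarrow> s \<noteq> BigLeg"
  unfolding side_set_frame[OF assms] frame_vertices[of t, symmetric] mem_frame_image[OF assms]
  by (cases s; simp add: side_std)+

lemma distinct_vertices: "nondeg t \<Longrightarrow> vR t \<noteq> vS t \<and> vR t \<noteq> vL t \<and> vS t \<noteq> vL t"
  by (auto simp: nondeg_def algebra_simps)

lemma same_side_of_interval:
  assumes "nondeg t" "x \<noteq> y" "x \<in> side_set t s" "y \<in> side_set t s" "x \<in> side_set t s'" "y \<in> side_set t s'"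
  shows "s = s'"
proof -
  obtain z w where zw: "x = frame t z" "y = frame t w" "z \<in> side_set (Tile (kind t) 0 1 \<i>) s"
    "w \<in> side_set (Tile (kind t) 0 1 \<i>) s" using assms side_set_frame by (metis imageE)
  then have "z \<in> side_set (Tile (kind t) 0 1 \<i>) s'" "w \<in> side_set (Tile (kind t) 0 1 \<i>) s'"
    using assms by (simp_all add: side_set_frame mem_frame_image)
  moreover have "z \<noteq> w" using zw assms by auto
  ultimately show ?thesis using zw(3,4)
    by (cases s; cases s'; auto simp: side_std complex_eq_iff)
qed


section \<open>The shape of a tile\<close>

text \<open>In the plane, a vector orthogonal to \<open>d\<close> is a real multiple of \<open>\<i> * d\<close>.\<close>

lemma orthogonal_multiple:
  fixes d e :: complex
  assumes "d \<bullet> e = 0" "cmod e = k * cmod d" "d \<noteq> 0" "0 < k"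
  shows "\<exists>s\<in>{1, -1}. e = of_real (s * k) * \<i> * d"
proof -
  define w where "w = e / d"
  have e: "e = w * d" using assms(3) by (simp add: w_def)
  have "d \<bullet> e = Re w * (cmod d)\<^sup>2" unfolding e
    unfolding cmod_power2 by (simp add: inner_complex_def algebra_simps power2_eq_square)
  then have "Re w = 0" using assms(1,3) by simp
  moreover have "cmod w = k" using assms(2,3) by (simp add: e norm_mult)
  ultimately have "\<bar>Im w\<bar> = k" by (simp add: cmod_def)
  then have "w = of_real k * \<i> \<or> w = of_real (- k) * \<i>"
    using \<open>Re w = 0\<close> by (auto simp: complex_eq_iff)
  then show ?thesis by (auto simp: e)
qed

text \<open>Both proto-tiles have legs in the ratio \<open>1 : phi\<close>, so a tile is determined by its large leg and by
  the side \<open>s\<close> of it on which the small leg lies.\<close>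

lemma is_tile_iff:
  "is_tile t \<longleftrightarrow> cmod (vS t - vR t) = side_length (kind t) BigLeg \<and>
     (\<exists>s\<in>{1, -1}. vL t - vR t = of_real (s * phi) * \<i> * (vS t - vR t))" (is "_ \<longleftrightarrow> ?R")
proof
  assume "is_tile t"
  then obtain f where f: "isometry f" "t = map_tile f proto_L \<or> t = map_tile f proto_S"
    unfolding is_tile_def by blast
  obtain k and x :: real where k: "x = side_length k BigLeg" "0 < x"
      "t = map_tile f (Tile k 0 (of_real x) (\<i> * of_real (phi * x)))"
  proof (cases "t = map_tile f proto_L")
    case True
    then show ?thesis using that[of phi Large] phi_pos
      by (simp add: proto_L_def power2_eq_square)
  next
    case False
    then show ?thesis using that[of "phi\<^sup>2" Small] phi_pos f(2)
      by (simp add: proto_S_def power2_eq_square power3_eq_cube mult.assoc)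
  qed
  let ?L = "\<lambda>z. f z - f 0"
  have o: "orthogonal_transformation ?L" by (rule isometry_orthogonal[OF f(1)])
  have n: "cmod (?L z) = cmod z" for z by (rule orthogonal_transformation_norm[OF o])
  have "?L (of_real x) \<bullet> ?L (\<i> * of_real (phi * x)) = of_real x \<bullet> (\<i> * of_real (phi * x))"
    using o unfolding orthogonal_transformation_def by blast
  then have "?L (of_real x) \<bullet> ?L (\<i> * of_real (phi * x)) = 0"
    by (simp add: inner_complex_def)
  moreover have "cmod (?L (of_real x)) = x"
    using n[of "of_real x"] k(2) by simp
  moreover have "cmod (?L (\<i> * of_real (phi * x))) = phi * x"
    unfolding n using k(2) phi_pos by (simp add: norm_mult)
  ultimately have "\<exists>s\<in>{1, -1}. ?L (\<i> * of_real (phi * x)) = of_real (s * phi) * \<i> * ?L (of_real x)"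
    using k(2) phi_pos by (intro orthogonal_multiple) auto
  then show ?R using k(1,3) \<open>cmod (?L (of_real x)) = x\<close> by simp
next
  assume r: ?R
  let ?d = "vS t - vR t" and ?x = "side_length (kind t) BigLeg"
  obtain s where s: "s = 1 \<or> s = (-1::real)" "vL t - vR t = of_real (s * phi) * \<i> * ?d"
    using r by blast
  have x: "0 < ?x" using phi_pos by (cases "kind t") auto
  define u where "u = ?d / of_real ?x"
  have u: "cmod u = 1" "?d = of_real ?x * u" using r x by (simp_all add: u_def norm_divide)
  define f where "f = (\<lambda>z. vR t + u * (if s = 1 then z else cnj z))"
  have "isometry f"
    unfolding isometry_def f_def
    by (simp add: dist_norm norm_mult u(1) flip: right_diff_distrib complex_cnj_diff)
  moreover have "map_tile f (if kind t = Large then proto_L else proto_S) = t"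
  proof -
    have "vS t = vR t + of_real ?x * u" "vL t = vR t + of_real (s * phi) * \<i> * (of_real ?x * u)"
      using s(2) u(2) by (simp_all add: algebra_simps)
    then show ?thesis using s(1)
      by (intro map_tile_eqI; cases "kind t")
        (auto simp: f_def proto_L_def proto_S_def power2_eq_square power3_eq_cube mult_ac)
  qed
  ultimately show "is_tile t" unfolding is_tile_def
    by (intro exI[of _ f]) (auto split: if_splits)
qed

lemma is_tile_frameE:
  assumes "is_tile t"
  obtains s d where "s = 1 \<or> s = (-1::real)" "d \<noteq> 0" "cmod d = side_length (kind t) BigLeg"
    "vS t = vR t + d" "vL t = vR t + of_real (s * phi) * \<i> * d"
proof -
  let ?d = "vS t - vR t"
  \<comment> \<open>\<open>s\<close> is the chirality of the tile.\<close>
  obtain s where s: "s \<in> {1, -1::real}" "vL t - vR t = of_real (s * phi) * \<i> * ?d"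
    using assms unfolding is_tile_iff by blast
  moreover have "cmod ?d = side_length (kind t) BigLeg" using assms by (simp add: is_tile_iff)
  moreover have "0 < side_length (kind t) BigLeg" using phi_pos by (cases "kind t") auto
  moreover have "vL t = vR t + of_real (s * phi) * \<i> * ?d"
    using s(2) by (simp only: diff_eq_eq add.commute)
  ultimately show ?thesis by (intro that[of s ?d]) auto
qed

lemma is_tile_nondeg: "is_tile t \<Longrightarrow> nondeg t"
proof (erule is_tile_frameE)
  fix s d assume s: "s = 1 \<or> s = (-1::real)" "d \<noteq> 0"
    "vS t = vR t + d" "vL t = vR t + of_real (s * phi) * \<i> * d"
  have "Im (cnj d * (of_real (s * phi) * \<i> * d)) = s * phi * (cmod d)\<^sup>2"
    unfolding cmod_power2 by (simp add: algebra_simps power2_eq_square)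
  then show "nondeg t" using s by (auto simp: nondeg_def)
qed

lemma phi_sq_identity: "phi\<^sup>2 * (1 + phi\<^sup>2) = 1"
  using phi_four by (simp add: algebra_simps)

text \<open>With \<open>d\<close> the large leg, the projection coefficient is \<open>|d|\<^sup>2 / ((1 + phi\<^sup>2) |d|\<^sup>2)\<close>, which
  is \<open>phi\<^sup>2\<close> because \<open>phi\<^sup>2 (1 + phi\<^sup>2) = 1\<close>.\<close>

lemma altitude_foot_eq:
  assumes "is_tile t"
  shows "altitude_foot (vR t) (vS t) (vL t) = foot t"
  using assms
proof (rule is_tile_frameE)
  fix s d assume s: "s = 1 \<or> s = (-1::real)" "d \<noteq> 0"
    "vS t = vR t + d" "vL t = vR t + of_real (s * phi) * \<i> * d"
  let ?e = "of_real (s * phi) * \<i> * d"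
  have s2: "s * s = 1" using s(1) by auto
  have 1: "(vR t - vS t) \<bullet> (vL t - vS t) = (cmod d)\<^sup>2"
    using s unfolding cmod_power2 by (simp add: inner_complex_def algebra_simps power2_eq_square)
  have "(vL t - vS t) \<bullet> (vL t - vS t) = (cmod d)\<^sup>2 + (s * s) * phi\<^sup>2 * (cmod d)\<^sup>2"
    using s unfolding cmod_power2 by (simp add: inner_complex_def algebra_simps power2_eq_square)
  then have 2: "(vL t - vS t) \<bullet> (vL t - vS t) = (1 + phi\<^sup>2) * (cmod d)\<^sup>2"
    unfolding s2 by (simp add: algebra_simps)
  have "1 + phi\<^sup>2 \<noteq> 0" using phi_sq_identity by auto
  then have "1 / (1 + phi\<^sup>2) = phi\<^sup>2"
    using phi_sq_identity by (metis nonzero_eq_divide_eq)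
  then have "((vR t - vS t) \<bullet> (vL t - vS t)) / ((vL t - vS t) \<bullet> (vL t - vS t)) = phi\<^sup>2"
    unfolding 1 2 using s(2) by simp
  then show ?thesis
    by (simp add: altitude_foot_def foot_def phi_four algebra_simps)
qed

lemma phi_weights: "phi ^ 4 + phi\<^sup>2 = 1"
  by (simp add: phi_four)

lemma foot_map_tile: "affine_inj f \<Longrightarrow> foot (map_tile f t) = f (foot t)"
  by (simp add: foot_def affine_inj_comb[OF _ phi_weights])

lemma pieces_map_tile: "affine_inj f \<Longrightarrow> pieces (map_tile f t) = map_tile f ` pieces t"
  by (simp add: pieces_def foot_map_tile)

lemma homothety_affine_inj: "affine_inj (homothety c)"
  unfolding affine_inj_def
proof (intro exI conjI)
  show "linear (\<lambda>z::complex. (1 / phi) *\<^sub>R z)" by (intro linear_compose_scale_right linear_id[unfolded id_def])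
  show "inj (\<lambda>z::complex. (1 / phi) *\<^sub>R z)" by (auto simp: inj_def)
  show "homothety c = (\<lambda>z. (c - (1 / phi) *\<^sub>R c) + (1 / phi) *\<^sub>R z)"
    by (auto simp: homothety_def algebra_simps)
qed

lemma homothety_diff: "homothety c x - homothety c y = (1 / phi) *\<^sub>R (x - y)"
  by (simp add: homothety_def algebra_simps)

lemma nondeg_homothety: "nondeg (map_tile (homothety c) t) \<longleftrightarrow> nondeg t"
proof -
  have "cnj ((1 / phi) *\<^sub>R x) * ((1 / phi) *\<^sub>R y) = (1 / phi\<^sup>2) *\<^sub>R (cnj x * y)" for x y :: complex
    by (simp add: power2_eq_square scaleR_conv_of_real)
  then show ?thesis by (simp add: nondeg_def homothety_diff)
qed

text \<open>The homothety of the decomposition with its center at the center of a star.\<close>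

definition enlarge :: "complex \<Rightarrow> complex" where
  "enlarge z = (1 / phi) *\<^sub>R z"

text \<open>Up to a translation, enlarging after an isometry is the linear part of the isometry after
  enlarging; so the enlarged copy of a star is an isometric copy of the enlarged star.\<close>

lemma homothety_isometry:
  assumes "isometry f"
  shows "homothety c (f z) = homothety c (f 0) + (f (enlarge z) - f 0)"
proof -
  have "homothety c (f z) - homothety c (f 0) = f (enlarge z) - f 0"
    unfolding enlarge_def isometry_scale[OF assms] by (rule homothety_diff)
  then show ?thesis by (metis add.commute diff_add_cancel)
qed

lemma isometry_translated_linear_part: "isometry f \<Longrightarrow> isometry (\<lambda>z. a + (f z - f 0))"
  by (simp add: isometry_def dist_norm)

lemma is_tile_map_tile:
  assumes "isometry f" "is_tile t"
  shows "is_tile (map_tile f t)"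
proof -
  obtain g where g: "isometry g" "t = map_tile g proto_L \<or> t = map_tile g proto_S"
    using assms(2) is_tile_def by blast
  then show ?thesis unfolding is_tile_def
    using isometry_comp[OF assms(1) g(1)]
    by (intro exI[of _ "\<lambda>z. f (g z)"]) (auto simp: map_tile_comp)
qed

lemma is_tile_protoE:
  assumes "is_tile t"
  obtains f where "isometry f" "t = map_tile f (if kind t = Large then proto_L else proto_S)"
  using assms unfolding is_tile_def by (auto simp: proto_L_def proto_S_def)

text \<open>All tiles of a size are congruent, so only the proto-tiles need to be cut. The altitude of a right
  triangle cuts it into two triangles similar to it, and \<open>phi\<^sup>2 + phi ^ 4 = 1\<close> makes their sizes
  those of the two proto-tiles after the enlargement.\<close>

lemma is_tile_piece:
  assumes "is_tile t" "y \<in> pieces t"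
  shows "is_tile (map_tile (homothety c) y)"
proof -
  have L: "is_tile (Tile Large (Complex (phi ^ 4) (phi ^ 3)) 1 0)"
    and S: "is_tile (Tile Small (Complex (phi ^ 4) (phi ^ 3)) 0 (Complex 0 phi))"
  proof -
    have "(cmod (1 - Complex (phi ^ 4) (phi ^ 3)))\<^sup>2 = phi\<^sup>2"
      "(cmod (Complex (phi ^ 4) (phi ^ 3)))\<^sup>2 = (phi\<^sup>2)\<^sup>2"
      unfolding cmod_power2 by (simp_all add: power_numeral_reduce phi_reduce algebra_simps)
    then have "cmod (1 - Complex (phi ^ 4) (phi ^ 3)) = phi" "cmod (Complex (phi ^ 4) (phi ^ 3)) = phi\<^sup>2"
      using phi_pos by (simp_all only: power2_eq_iff_nonneg norm_ge_zero zero_le_power less_imp_le)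
    then show "is_tile (Tile Large (Complex (phi ^ 4) (phi ^ 3)) 1 0)"
      "is_tile (Tile Small (Complex (phi ^ 4) (phi ^ 3)) 0 (Complex 0 phi))"
      unfolding is_tile_iff
      by (intro conjI bexI[of _ "- 1"];
          simp add: complex_eq_iff power_numeral_reduce phi_reduce algebra_simps)+
  qed
  obtain f where f: "isometry f" "t = map_tile f (if kind t = Large then proto_L else proto_S)"
    using is_tile_protoE[OF assms(1)] .
  then obtain z where z: "z \<in> pieces (if kind t = Large then proto_L else proto_S)" "y = map_tile f z"
    using assms(2) pieces_map_tile[OF isometry_affine_inj[OF f(1)]] by (metis imageE)
  have "is_tile (map_tile enlarge z)"
  proof (cases "kind t")
    case Small
    then have "map_tile enlarge z = proto_L"
      using z(1) by (simp add: pieces_def proto_S_def proto_L_def enlarge_def power_numeral_reduce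
          scaleR_conv_of_real)
    then show ?thesis using is_tile_def isometry_id by (metis map_tile_id)
  next
    case Large
    have "enlarge (foot proto_L) = Complex (phi ^ 4) (phi ^ 3)"
      by (simp add: enlarge_def foot_def proto_L_def complex_eq_iff power_numeral_reduce)
    moreover have "enlarge (of_real phi) = 1" "enlarge 0 = 0" "enlarge (\<i> * of_real (phi\<^sup>2)) = Complex 0 phi"
      by (simp_all add: enlarge_def complex_eq_iff power2_eq_square)
    moreover have "pieces proto_L = {Tile Large (foot proto_L) (of_real phi) 0,
        Tile Small (foot proto_L) 0 (\<i> * of_real (phi\<^sup>2))}"
      by (simp add: pieces_def) (simp add: proto_L_def)
    then have "z = Tile Large (foot proto_L) (of_real phi) 0 \<or>
        z = Tile Small (foot proto_L) 0 (\<i> * of_real (phi\<^sup>2))"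
      using z(1) Large by simp
    ultimately show ?thesis using L S by (elim disjE) (simp_all only: map_tile.simps)
  qed
  then have "is_tile (map_tile (\<lambda>v. homothety c (f 0) + (f v - f 0)) (map_tile enlarge z))"
    by (rule is_tile_map_tile[OF isometry_translated_linear_part[OF f(1)]])
  moreover have "(\<lambda>v. homothety c (f v)) = (\<lambda>v. homothety c (f 0) + (f (enlarge v) - f 0))"
    by (rule ext) (rule homothety_isometry[OF f(1)])
  then have "map_tile (homothety c) y = map_tile (\<lambda>v. homothety c (f 0) + (f v - f 0)) (map_tile enlarge z)"
    unfolding z(2) map_tile_comp by (simp only:)
  ultimately show ?thesis by (simp only:)
qed

lemma piece_nondeg: "is_tile t \<Longrightarrow> y \<in> pieces t \<Longrightarrow> nondeg y"
  using is_tile_piece[of t y 0] is_tile_nondeg nondeg_homothety by blast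

lemma side_length_dist:
  assumes "is_tile t"
  shows "dist (fst (ends t s)) (snd (ends t s)) = side_length (kind t) s"
proof -
  obtain f where f: "isometry f" "t = map_tile f (if kind t = Large then proto_L else proto_S)"
    using is_tile_protoE[OF assms] .
  define u where "u = (if kind t = Large then proto_L else proto_S)"
  have k: "kind u = kind t" by (cases "kind t") (simp_all add: u_def proto_L_def proto_S_def)
  have "(dist (fst (ends u s)) (snd (ends u s)))\<^sup>2 = (side_length (kind u) s)\<^sup>2"
    unfolding dist_norm cmod_power2
    by (cases "kind t"; cases s)
      (simp_all add: u_def proto_L_def proto_S_def power_numeral_reduce phi_reduce algebra_simps)
  moreover have "0 \<le> side_length (kind u) s" using phi_pos by (cases "kind u"; cases s) simp_all
  ultimately have "dist (fst (ends u s)) (snd (ends u s)) = side_length (kind u) s"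
    by (rule power2_eq_imp_eq[OF _ zero_le_dist])
  moreover have "ends t s = (f (fst (ends u s)), f (snd (ends u s)))"
    using f(2) ends_map_tile[of f u s] by (simp add: u_def)
  then have "dist (fst (ends t s)) (snd (ends t s)) = dist (fst (ends u s)) (snd (ends u s))"
    using f(1) by (simp add: isometry_def)
  ultimately show ?thesis by (simp add: k)
qed

text \<open>The two parts into which the standard triangle is cut by the segment from \<open>0\<close> to a point of the
  opposite side are the parts on either side of the line of this segment.\<close>

lemma std_cut:
  assumes "0 < a" "0 < b" "a + b = 1"
  shows "convex hull {Complex a b, 1, 0} = {z \<in> std_region. a * Im z \<le> b * Re z}"
    and "convex hull {Complex a b, 0, \<i>} = {z \<in> std_region. b * Re z \<le> a * Im z}"
proof -
  have eq: "z \<in> convex hull {Complex a b, 1, 0}" if z: "z \<in> std_region" "a * Im z \<le> b * Re z" for z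
  proof -
    let ?x = "Re z" and ?y = "Im z"
    have "a = 1 - b" using assms by simp
    then have "a * ?y / b = ?y / b - ?y" using assms(2) by (simp add: diff_divide_distrib left_diff_distrib)
    then have 1: "1 - ?y / b - (?x - a * ?y / b) = 1 - ?x - ?y" by simp
    have "z = (?y / b) *\<^sub>R Complex a b + (?x - a * ?y / b) *\<^sub>R 1 + (1 - ?x - ?y) *\<^sub>R 0"
      using assms by (simp add: complex_eq_iff)
    moreover have "0 \<le> ?y / b" "0 \<le> 1 - ?x - ?y" using z assms by (auto simp: std_region_def)
    moreover have "0 \<le> ?x - a * ?y / b" using z assms by (simp add: field_simps)
    ultimately show ?thesis unfolding convex_hull_3 using 1
      by (intro CollectI exI[of _ "?y / b"] exI[of _ "?x - a * ?y / b"] exI[of _ "1 - ?x - ?y"]) auto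
  qed
  have eq': "z \<in> convex hull {Complex a b, 0, \<i>}" if z: "z \<in> std_region" "b * Re z \<le> a * Im z" for z
  proof -
    let ?x = "Re z" and ?y = "Im z"
    have "b = 1 - a" using assms by simp
    then have "b * ?x / a = ?x / a - ?x" using assms(1) by (simp add: diff_divide_distrib left_diff_distrib)
    then have 1: "1 - ?x / a - (?y - b * ?x / a) = 1 - ?x - ?y" by simp
    have "z = (?x / a) *\<^sub>R Complex a b + (1 - ?x - ?y) *\<^sub>R 0 + (?y - b * ?x / a) *\<^sub>R \<i>"
      using assms by (simp add: complex_eq_iff)
    moreover have "0 \<le> ?x / a" "0 \<le> 1 - ?x - ?y" using z assms by (auto simp: std_region_def)
    moreover have "0 \<le> ?y - b * ?x / a" using z assms by (simp add: field_simps)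
    ultimately show ?thesis unfolding convex_hull_3 using 1
      by (intro CollectI exI[of _ "?x / a"] exI[of _ "1 - ?x - ?y"] exI[of _ "?y - b * ?x / a"]) auto
  qed
  have "convex std_region" unfolding convex_hull_std[symmetric] by (rule convex_convex_hull)
  then have sub: "convex hull {Complex a b, 1, 0} \<subseteq> std_region" "convex hull {Complex a b, 0, \<i>} \<subseteq> std_region"
    using assms by (intro hull_minimal; simp add: std_region_def)+
  have half: "convex {z. v \<bullet> z \<le> 0}" for v :: complex by (rule convex_halfspace_le)
  have "convex hull {Complex a b, 1, 0} \<subseteq> {z. Complex (- b) a \<bullet> z \<le> 0}"
    "convex hull {Complex a b, 0, \<i>} \<subseteq> {z. Complex b (- a) \<bullet> z \<le> 0}"
    using assms by (intro hull_minimal half; simp add: inner_complex_def mult.commute)+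
  then have half': "convex hull {Complex a b, 1, 0} \<subseteq> {z. a * Im z \<le> b * Re z}"
    "convex hull {Complex a b, 0, \<i>} \<subseteq> {z. b * Re z \<le> a * Im z}"
    by (simp_all add: inner_complex_def)
  show "convex hull {Complex a b, 1, 0} = {z \<in> std_region. a * Im z \<le> b * Re z}"
    using sub(1) half'(1) eq by blast
  show "convex hull {Complex a b, 0, \<i>} = {z \<in> std_region. b * Re z \<le> a * Im z}"
    using sub(2) half'(2) eq' by blast
qed

text \<open>The coordinates of the altitude foot of any tile in its own frame.\<close>

definition std_foot :: complex where
  "std_foot = Complex (phi ^ 4) (phi\<^sup>2)"

lemma frame_std_foot: "frame t std_foot = foot t"
  by (simp add: frame_def std_foot_def foot_def phi_four algebra_simps)

lemma regions_of_cut: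
  assumes "nondeg t"
  shows "region (Tile k (foot t) (vS t) (vR t)) = frame t ` {z \<in> std_region. phi ^ 4 * Im z \<le> phi\<^sup>2 * Re z}"
    and "region (Tile k (foot t) (vR t) (vL t)) = frame t ` {z \<in> std_region. phi\<^sup>2 * Re z \<le> phi ^ 4 * Im z}"
proof -
  note h = affine_inj_convex_hull[OF frame_affine_inj[OF assms], symmetric]
  show "region (Tile k (foot t) (vS t) (vR t)) = frame t ` {z \<in> std_region. phi ^ 4 * Im z \<le> phi\<^sup>2 * Re z}"
    using h[of "{std_foot, 1, 0}"] std_cut(1)[OF _ _ phi_weights] phi_pos
    by (simp add: region_def vertices_def frame_vertices frame_std_foot) (simp add: std_foot_def)
  show "region (Tile k (foot t) (vR t) (vL t)) = frame t ` {z \<in> std_region. phi\<^sup>2 * Re z \<le> phi ^ 4 * Im z}"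
    using h[of "{std_foot, 0, \<i>}"] std_cut(2)[OF _ _ phi_weights] phi_pos
    by (simp add: region_def vertices_def frame_vertices frame_std_foot) (simp add: std_foot_def)
qed

lemma pieces_union: "nondeg t \<Longrightarrow> (\<Union>y\<in>pieces t. region y) = region t"
proof (cases "kind t")
  case Small
  then show ?thesis by (simp add: pieces_def region_def vertices_def)
next
  case Large
  assume "nondeg t"
  then have "(\<Union>y\<in>pieces t. region y) = frame t ` ({z \<in> std_region. phi ^ 4 * Im z \<le> phi\<^sup>2 * Re z}
       \<union> {z \<in> std_region. phi\<^sup>2 * Re z \<le> phi ^ 4 * Im z})"
    using Large by (simp add: pieces_def regions_of_cut image_Un)
  also have "{z \<in> std_region. phi ^ 4 * Im z \<le> phi\<^sup>2 * Re z}
       \<union> {z \<in> std_region. phi\<^sup>2 * Re z \<le> phi ^ 4 * Im z} = std_region" by auto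
  finally show ?thesis using region_frame[OF \<open>nondeg t\<close>] by simp
qed

lemma piece_region_subset: "nondeg t \<Longrightarrow> y \<in> pieces t \<Longrightarrow> region y \<subseteq> region t"
  using pieces_union by blast

lemma pieces_disjoint:
  assumes "nondeg t" "y \<in> pieces t" "y' \<in> pieces t" "y \<noteq> y'"
  shows "interior (region y) \<inter> interior (region y') = {}"
proof -
  let ?A = "{z \<in> std_region. phi ^ 4 * Im z \<le> phi\<^sup>2 * Re z}"
  let ?B = "{z \<in> std_region. phi\<^sup>2 * Re z \<le> phi ^ 4 * Im z}"
  have v: "Complex (phi\<^sup>2) (- (phi ^ 4)) \<noteq> 0" by (simp add: complex_eq_iff)
  have "interior ?A \<subseteq> interior {z. Complex (phi\<^sup>2) (- (phi ^ 4)) \<bullet> z \<ge> 0}"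
    by (intro interior_mono) (auto simp: inner_complex_def)
  moreover have "interior ?B \<subseteq> interior {z. Complex (phi\<^sup>2) (- (phi ^ 4)) \<bullet> z \<le> 0}"
    by (intro interior_mono) (auto simp: inner_complex_def)
  ultimately have "interior ?A \<inter> interior ?B = {}"
    unfolding interior_halfspace_ge[OF v] interior_halfspace_le[OF v] by force
  then have d: "interior (frame t ` ?A) \<inter> interior (frame t ` ?B) = {}"
    unfolding affine_inj_interior[OF frame_affine_inj[OF assms(1)]]
    using affine_inj_inj[OF frame_affine_inj[OF assms(1)]] by (simp add: image_Int[symmetric])
  have "kind t = Large" using assms(2-4) by (auto simp: pieces_def split: if_splits)
  then have "y = Tile Large (foot t) (vS t) (vR t) \<and> y' = Tile Small (foot t) (vR t) (vL t) \<or>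
     y' = Tile Large (foot t) (vS t) (vR t) \<and> y = Tile Small (foot t) (vR t) (vL t)"
    using assms(2-4) by (auto simp: pieces_def)
  then show ?thesis using d by (auto simp: regions_of_cut[OF assms(1)])
qed

lemma vertices_of_other_piece:
  assumes "nondeg t"
  shows "vL t \<notin> region (Tile k (foot t) (vS t) (vR t))" "vS t \<notin> region (Tile k (foot t) (vR t) (vL t))"
  unfolding regions_of_cut[OF assms]
  using mem_frame_image[OF assms, of \<i>] mem_frame_image[OF assms, of 1] phi_pos
  by (auto simp: frame_vertices)

text \<open>In barycentric coordinates all weights of a point between the foot and the vertex of the right
  angle are positive.\<close>

lemma altitude_in_interior:
  assumes "nondeg t"
  shows "open_segment (foot t) (vR t) \<subseteq> interior (region t)"
proof -
  have "open_segment std_foot 0 \<subseteq> {z. 0 < Re z \<and> 0 < Im z \<and> Re z + Im z < 1}"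
  proof
    fix z assume "z \<in> open_segment std_foot 0"
    then obtain u where u: "0 < u" "u < 1" "z = (1 - u) *\<^sub>R std_foot" by (auto simp: in_segment)
    have "(1 - u) * phi ^ 4 + (1 - u) * phi\<^sup>2 = 1 - u"
      using phi_weights by (metis distrib_left mult.right_neutral)
    then show "z \<in> {z. 0 < Re z \<and> 0 < Im z \<and> Re z + Im z < 1}"
      using u phi_pos by (simp add: std_foot_def)
  qed
  then show ?thesis
    using affine_inj_open_segment[OF frame_affine_inj[OF assms], of std_foot 0]
    by (simp add: interior_region_frame[OF assms] frame_std_foot frame_vertices image_mono)
qed

lemma foot_in_hyp: "foot t \<in> open_segment (vS t) (vL t)" if "nondeg t"
proof -
  have "foot t = (1 - phi\<^sup>2) *\<^sub>R vS t + phi\<^sup>2 *\<^sub>R vL t" by (simp add: foot_def phi_four)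
  then show ?thesis unfolding in_segment(2)
    using distinct_vertices[OF that] phi_pos phi_sq_lt_one
    by (intro conjI exI[of _ "phi\<^sup>2"]) auto
qed

text \<open>There are only two tiles up to isometry.\<close>

lemma tiles_contain_balls: "\<exists>e>0. \<forall>t. is_tile t \<longrightarrow> (\<exists>z. ball z e \<subseteq> interior (region t))"
proof -
  have "\<exists>e z. 0 < e \<and> ball z e \<subseteq> interior (region u)" if "u \<in> {proto_L, proto_S}" for u
  proof -
    have "is_tile u" unfolding is_tile_def using that isometry_id by (intro exI[of _ "\<lambda>z. z"]) auto
    then obtain z where "z \<in> interior (region u)"
      using interior_region_nonempty is_tile_nondeg by blast
    then show ?thesis using open_interior open_contains_ball by meson
  qed
  then obtain e e' z z' where e: "0 < e" "ball z e \<subseteq> interior (region proto_L)"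
    "0 < e'" "ball z' e' \<subseteq> interior (region proto_S)" by (metis insertI1 insertI2)
  have "\<exists>y. ball y (min e e') \<subseteq> interior (region t)" if t: "is_tile t" for t
  proof -
    obtain f where f: "isometry f" "t = map_tile f (if kind t = Large then proto_L else proto_S)"
      using is_tile_protoE[OF t] .
    note a = isometry_affine_inj[OF f(1)]
    define u x where "u = (if kind t = Large then proto_L else proto_S)"
      and "x = (if kind t = Large then z else z')"
    have "ball x (min e e') \<subseteq> interior (region u)"
      using e subset_ball[of "min e e'"] by (auto simp: x_def u_def)
    moreover have "ball (f x) (min e e') \<subseteq> f ` ball x (min e e')"
    proof
      fix w assume w: "w \<in> ball (f x) (min e e')"
      obtain v where "w = f v" using surjD[OF affine_inj_surj[OF a]] by blast
      then show "w \<in> f ` ball x (min e e')" using w f(1) by (simp add: isometry_def)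
    qed
    moreover have "interior (region t) = f ` interior (region u)"
      using interior_region_map_tile[OF a, of u] f(2) by (simp add: u_def)
    ultimately have "ball (f x) (min e e') \<subseteq> interior (region t)" by blast
    then show ?thesis by blast
  qed
  then show ?thesis using e by (intro exI[of _ "min e e'"]) simp
qed

lemma region_subset_cball: "is_tile t \<Longrightarrow> region t \<subseteq> cball (vR t) 1"
proof -
  assume t: "is_tile t"
  have "dist (vR t) (vS t) \<le> 1" "dist (vR t) (vL t) \<le> 1"
    using side_length_dist[OF t, of BigLeg] side_length_dist[OF t, of SmallLeg] phi_pos phi_lt_one
    by (cases t; cases "kind t"; auto simp: power_le_one)+
  then have "vertices t \<subseteq> cball (vR t) 1" by (simp add: vertices_def)
  then show ?thesis unfolding region_def by (intro hull_minimal) auto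
qed

section \<open>The decomposition of a colored tiling\<close>

text \<open>The side of a tile in which a side of its piece lies; the arguments are the sizes of the tile and
  of the piece. No side is assigned to the altitude.\<close>

fun parent_side :: "tile_size \<Rightarrow> tile_size \<Rightarrow> side \<Rightarrow> side option" where
  "parent_side Small k s = Some s"
| "parent_side Large Large Hyp = Some BigLeg"
| "parent_side Large Large BigLeg = Some Hyp"
| "parent_side Large Large SmallLeg = None"
| "parent_side Large Small Hyp = Some SmallLeg"
| "parent_side Large Small BigLeg = None"
| "parent_side Large Small SmallLeg = Some Hyp"

definition altitude_decor :: "tile \<Rightarrow> decor" where
  "altitude_decor t = (0, sgn (vR t - foot t))"

text \<open>The function \<open>cut\<close> in terms of \<open>parent_side\<close>: the decoration of a piece is inherited except on the
  altitude.\<close>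

definition piece_decor :: "tile \<Rightarrow> (side \<Rightarrow> decor) \<Rightarrow> tile \<Rightarrow> side \<Rightarrow> decor" where
  "piece_decor t d y s = (case parent_side (kind t) (kind y) s of
     None \<Rightarrow> altitude_decor t | Some s' \<Rightarrow> relabel (d s'))"

lemma cut_eq:
  assumes "is_tile t"
  shows "cut (t, d) = (\<lambda>y. (y, piece_decor t d y)) ` pieces t"
proof (cases "kind t")
  case Large
  then obtain r p q where t: "t = Tile Large r p q" by (cases t) auto
  show ?thesis
    using altitude_foot_eq[OF assms] unfolding t
    by (auto simp: pieces_def Let_def fun_eq_iff piece_decor_def altitude_decor_def split: side.splits)
next
  case Small
  then obtain r p q where t: "t = Tile Small r p q" by (cases t) auto
  show ?thesis unfolding t by (auto simp: pieces_def piece_decor_def)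
qed

lemma piece_side:
  assumes "nondeg t" "y \<in> pieces t"
  shows "parent_side (kind t) (kind y) s = Some s' \<Longrightarrow> side_set y s \<subseteq> side_set t s'"
    and "parent_side (kind t) (kind y) s = None \<Longrightarrow> side_set y s = closed_segment (foot t) (vR t)"
proof -
  have f: "foot t \<in> closed_segment (vS t) (vL t)"
    using foot_in_hyp[OF assms(1)] by (simp add: open_segment_def)
  then have "closed_segment (foot t) (vS t) \<subseteq> closed_segment (vS t) (vL t)"
    "closed_segment (foot t) (vL t) \<subseteq> closed_segment (vS t) (vL t)"
    by (simp_all add: subset_closed_segment)
  then show "parent_side (kind t) (kind y) s = Some s' \<Longrightarrow> side_set y s \<subseteq> side_set t s'"
    using assms(2)
    by (cases t; cases "kind t"; cases s)
      (auto simp: pieces_def side_set_def closed_segment_commute)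
  show "parent_side (kind t) (kind y) s = None \<Longrightarrow> side_set y s = closed_segment (foot t) (vR t)"
    using assms(2)
    by (cases t; cases "kind t"; cases s) (auto simp: pieces_def side_set_def)
qed

lemma colored_tiling_is_tile: "colored_tiling T \<Longrightarrow> (t, d) \<in> T \<Longrightarrow> is_tile t"
  by (auto simp: colored_tiling_def is_colored_tile_def)

lemma mem_decomposition:
  assumes "colored_tiling T"
  shows "x \<in> decomposition c T \<longleftrightarrow>
    (\<exists>t d y. (t, d) \<in> T \<and> y \<in> pieces t \<and> x = (map_tile (homothety c) y, piece_decor t d y))"
proof -
  have "(\<Union>x\<in>T. cut x) = (\<Union>(t, d)\<in>T. (\<lambda>y. (y, piece_decor t d y)) ` pieces t)"
    using cut_eq colored_tiling_is_tile[OF assms] by fastforce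
  then show ?thesis unfolding decomposition_def by force
qed

lemma sgn_scaleR_pos: "0 < k \<Longrightarrow> sgn (k *\<^sub>R z) = sgn (z :: complex)"
  by (simp add: sgn_scaleR)

text \<open>Each step increases labels by 1, and \<open>parent_side\<close> relates sides of even label to sides of odd
  label; the altitude is a side of even label of both pieces.\<close>

lemma piece_colored:
  assumes "is_colored_tile (t, d)" "y \<in> pieces t"
  shows "is_colored_tile (map_tile (homothety c) y, piece_decor t d y)"
proof -
  let ?d = "piece_decor t d y"
  have t: "is_tile t" and d: "\<And>s. fst (d s) < 4" "\<And>s. even (fst (d s)) \<longleftrightarrow> even_side (kind t) s"
      "\<And>s. snd (d s) \<in> {sgn (snd (ends t s) - fst (ends t s)), sgn (fst (ends t s) - snd (ends t s))}"
    using assms(1) unfolding is_colored_tile_def by (simp_all add: case_prod_beta)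
  have odd4: "even ((n + 1) mod 4) \<longleftrightarrow> odd n" for n :: nat
    by presburger
  have par: "even_side (kind y) s \<longleftrightarrow> \<not> even_side (kind t) s'"
    if "parent_side (kind t) (kind y) s = Some s'" for s s'
    using assms(2) that by (cases "kind t"; cases s) (auto simp: pieces_def)
  have alt: "even_side (kind y) s" if "parent_side (kind t) (kind y) s = None" for s
    using assms(2) that by (cases "kind t"; cases s) (auto simp: pieces_def)
  \<comment> \<open>The two parts of the hypotenuse have the direction of the whole.\<close>
  have hyp: "sgn (foot t - vS t) = sgn (vL t - vS t)" "sgn (vS t - foot t) = sgn (vS t - vL t)"
    "sgn (foot t - vL t) = sgn (vS t - vL t)" "sgn (vL t - foot t) = sgn (vL t - vS t)"
  proof -
    have 1: "foot t - vS t = phi\<^sup>2 *\<^sub>R (vL t - vS t)" "vS t - foot t = phi\<^sup>2 *\<^sub>R (vS t - vL t)"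
      "foot t - vL t = phi ^ 4 *\<^sub>R (vS t - vL t)" "vL t - foot t = phi ^ 4 *\<^sub>R (vL t - vS t)"
      by (simp_all add: foot_def phi_four algebra_simps)
    show "sgn (foot t - vS t) = sgn (vL t - vS t)" "sgn (vS t - foot t) = sgn (vS t - vL t)"
      "sgn (foot t - vL t) = sgn (vS t - vL t)" "sgn (vL t - foot t) = sgn (vL t - vS t)"
      unfolding 1 using phi_pos by (simp_all add: sgn_scaleR_pos)
  qed
  have "snd (?d s) \<in> {sgn (snd (ends y s) - fst (ends y s)), sgn (fst (ends y s) - snd (ends y s))}" for s
  proof (cases "parent_side (kind t) (kind y) s")
    case None
    then show ?thesis using assms(2)
      by (cases t; cases "kind t"; cases s)
        (auto simp: pieces_def piece_decor_def altitude_decor_def)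
  next
    case (Some s')
    then have "snd (?d s) = snd (d s')" by (simp add: piece_decor_def relabel_def case_prod_beta)
    then show ?thesis using d(3)[of s'] Some assms(2) hyp
      by (cases t; cases "kind t"; cases s) (auto simp: pieces_def)
  qed
  moreover have "fst (?d s) < 4 \<and> (even (fst (?d s)) \<longleftrightarrow> even_side (kind y) s)" for s
    using alt[of s] par[of s] d(1,2) odd4
    by (cases "parent_side (kind t) (kind y) s")
      (simp_all add: piece_decor_def altitude_decor_def relabel_def case_prod_beta)
  ultimately show ?thesis
    unfolding is_colored_tile_def using is_tile_piece[OF t assms(2), of c] phi_pos
    by (simp add: ends_map_tile homothety_diff sgn_scaleR_pos case_prod_beta)
qed

text \<open>A point in the interior of a tile is in no other tile, because a tile is the closure of its
  interior.\<close>

lemma tile_unique_at_interior: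
  assumes "colored_tiling T" "x \<in> T" "x' \<in> T" "z \<in> interior (region (fst x))" "z \<in> region (fst x')"
  shows "x = x'"
proof (rule ccontr)
  assume "x \<noteq> x'"
  then have "interior (region (fst x)) \<inter> interior (region (fst x')) = {}"
    using assms(1-3) unfolding colored_tiling_def pairwise_def by blast
  moreover have "nondeg (fst x')"
    using colored_tiling_is_tile[OF assms(1), of "fst x'" "snd x'"] assms(3) is_tile_nondeg by simp
  ultimately show False using interior_disjoint_region assms(4,5) by blast
qed

lemma colored_tiling_decomposition:
  assumes "colored_tiling T"
  shows "colored_tiling (decomposition c T)"
  unfolding colored_tiling_def
proof (intro conjI ballI pairwiseI)
  fix x assume "x \<in> decomposition c T"
  then show "is_colored_tile x"
    using assms piece_colored unfolding mem_decomposition[OF assms] colored_tiling_def by blast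
next
  fix x x' assume "x \<in> decomposition c T" "x' \<in> decomposition c T" and ne: "x \<noteq> x'"
  then obtain t d y t' d' y' where 1: "(t, d) \<in> T" "y \<in> pieces t"
    "x = (map_tile (homothety c) y, piece_decor t d y)" and 2: "(t', d') \<in> T" "y' \<in> pieces t'"
    "x' = (map_tile (homothety c) y', piece_decor t' d' y')"
    unfolding mem_decomposition[OF assms] by blast
  have n: "nondeg t" "nondeg t'"
    using 1 2 colored_tiling_is_tile[OF assms] is_tile_nondeg by blast+
  have "interior (region y) \<inter> interior (region y') = {}"
  proof (cases "(t, d) = (t', d')")
    case True
    then show ?thesis using pieces_disjoint[OF n(1), of y y'] 1 2 ne by auto
  next
    case False
    then have "interior (region t) \<inter> interior (region t') = {}"
      using assms 1 2 unfolding colored_tiling_def pairwise_def by fastforce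
    then show ?thesis
      using piece_region_subset[OF n(1) 1(2)] piece_region_subset[OF n(2) 2(2)] interior_mono by blast
  qed
  then show "interior (region (fst x)) \<inter> interior (region (fst x')) = {}"
    using affine_inj_inj[OF homothety_affine_inj]
    by (simp add: 1 2 interior_region_map_tile homothety_affine_inj image_Int[symmetric])
qed

lemma covered_decomposition:
  assumes "colored_tiling T"
  shows "covered (decomposition c T) = homothety c ` covered T"
proof (rule set_eqI)
  fix z
  have u: "(\<exists>y\<in>pieces t. w \<in> region y) \<longleftrightarrow> w \<in> region t" if "(t, d) \<in> T" for t d w
    using pieces_union[OF is_tile_nondeg[OF colored_tiling_is_tile[OF assms that]]] by blast
  have "z \<in> covered (decomposition c T) \<longleftrightarrow>
      (\<exists>t d y. (t, d) \<in> T \<and> y \<in> pieces t \<and> z \<in> homothety c ` region y)"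
    unfolding covered_def UN_iff Bex_def mem_decomposition[OF assms]
    by (metis fst_conv region_map_tile[OF homothety_affine_inj])
  also have "\<dots> \<longleftrightarrow> (\<exists>t d. (t, d) \<in> T \<and> z \<in> homothety c ` region t)"
    using u unfolding image_iff by meson
  also have "\<dots> \<longleftrightarrow> z \<in> homothety c ` covered T"
    unfolding covered_def by force
  finally show "z \<in> covered (decomposition c T) \<longleftrightarrow> z \<in> homothety c ` covered T" .
qed

lemma covers_plane_decomposition:
  "colored_tiling T \<Longrightarrow> covers_plane T \<Longrightarrow> covers_plane (decomposition c T)"
  using affine_inj_surj[OF homothety_affine_inj, of c]
  by (simp add: covers_plane_def covered_decomposition)

text \<open>An altitude runs inside its tile. So the sides of two pieces that share an interval are both
  inherited or both belong to one altitude.\<close>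

lemma altitude_shares_no_interval:
  assumes T: "colored_tiling T" "(t, d) \<in> T" "(t', d') \<in> T"
    and xy: "x \<noteq> y" "closed_segment x y \<subseteq> closed_segment (foot t) (vR t)"
    and ss: "closed_segment x y \<subseteq> side_set t' s \<or> closed_segment x y \<subseteq> closed_segment (foot t') (vR t')"
  shows "t = t' \<and> d = d' \<and> \<not> closed_segment x y \<subseteq> side_set t' s"
proof -
  have n: "nondeg t" "nondeg t'"
    using T colored_tiling_is_tile is_tile_nondeg by blast+
  define m where "m = midpoint x y"
  have m: "m \<in> open_segment x y" using xy(1) by (simp add: m_def)
  have "open_segment x y \<subseteq> open_segment (foot t) (vR t)"
    using xy by (metis subset_open_segment subset_closed_segment ends_in_segment)
  then have mi: "m \<in> interior (region t)" using m altitude_in_interior[OF n(1)] by blast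
  have mc: "m \<in> closed_segment x y" using m by (simp add: open_segment_def)
  have "foot t' \<in> region t'"
    using foot_in_hyp[OF n(2)] side_set_subset_region[of t' Hyp]
    by (cases t') (auto simp: side_set_def open_segment_def)
  then have "closed_segment (foot t') (vR t') \<subseteq> region t'"
    using convex_region by (intro closed_segment_subset) auto
  then have "m \<in> region t'" using ss mc side_set_subset_region[of t' s] by blast
  then have "(t, d) = (t', d')" using tile_unique_at_interior[OF T(1), of "(t, d)" "(t', d')" m] T mi by simp
  then show ?thesis using mi mc side_disjoint_interior[OF n(2), of s] by auto
qed

lemma matching_decomposition:
  assumes T: "colored_tiling T" "matching T"
  shows "matching (decomposition c T)"
  unfolding matching_def
proof (safe)
  let ?H = "homothety c"
  fix a e a' e' s s' x y
  assume A: "(a, e) \<in> decomposition c T" "(a', e') \<in> decomposition c T"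
    and xy: "x \<noteq> y" "closed_segment x y \<subseteq> side_set a s \<inter> side_set a' s'"
  obtain t d b t' d' b' where 1: "(t, d) \<in> T" "b \<in> pieces t" "a = map_tile ?H b" "e = piece_decor t d b"
    and 2: "(t', d') \<in> T" "b' \<in> pieces t'" "a' = map_tile ?H b'" "e' = piece_decor t' d' b'"
    using A unfolding mem_decomposition[OF T(1)] by auto
  obtain u v where uv: "x = ?H u" "y = ?H v"
    using affine_inj_surj[OF homothety_affine_inj, of c] by (meson surjD)
  have "u \<noteq> v" using xy uv by auto
  have seg: "closed_segment u v \<subseteq> side_set b s" "closed_segment u v \<subseteq> side_set b' s'"
    using xy(2) affine_inj_inj[OF homothety_affine_inj, of c]
    by (simp_all add: uv 1 2 affine_inj_closed_segment side_set_map_tile homothety_affine_inj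
        inj_image_subset_iff)
  have n: "nondeg t" "nondeg t'"
    using 1 2 colored_tiling_is_tile[OF T(1)] is_tile_nondeg by blast+
  note s1 = piece_side[OF n(1) 1(2), of s] and s2 = piece_side[OF n(2) 2(2), of s']
  show "e s = e' s'"
  proof (cases "parent_side (kind t) (kind b) s")
    case None
    then have o: "closed_segment u v \<subseteq> closed_segment (foot t) (vR t)" using s1 seg by simp
    show ?thesis
    proof (cases "parent_side (kind t') (kind b') s'")
      case None': None
      then have "t = t'"
        using altitude_shares_no_interval[OF T(1) 1(1) 2(1) \<open>u \<noteq> v\<close> o] s2 seg by simp
      then show ?thesis using None None' by (simp add: 1 2 piece_decor_def)
    next
      case (Some r)
      then have "closed_segment u v \<subseteq> side_set t' r" using s2 seg by blast
      then show ?thesis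
        using altitude_shares_no_interval[OF T(1) 1(1) 2(1) \<open>u \<noteq> v\<close> o, of r] by simp
    qed
  next
    case S: (Some r)
    then have r: "closed_segment u v \<subseteq> side_set t r" using s1 seg by blast
    show ?thesis
    proof (cases "parent_side (kind t') (kind b') s'")
      case None
      then have "closed_segment u v \<subseteq> closed_segment (foot t') (vR t')" using s2 seg by simp
      then show ?thesis
        using altitude_shares_no_interval[OF T(1) 2(1) 1(1) \<open>u \<noteq> v\<close>, of r] r by simp
    next
      case (Some r')
      then have "closed_segment u v \<subseteq> side_set t' r'" using s2 seg by blast
      then have "d r = d' r'"
        using T(2) 1(1) 2(1) r \<open>u \<noteq> v\<close> unfolding matching_def by blast
      then show ?thesis using S Some by (simp add: 1 2 piece_decor_def)
    qed
  qed
qed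


section \<open>Local finiteness\<close>

text \<open>Disjoint tiles contain disjoint balls of one fixed radius. Infinitely many tiles near \<open>A\<close> would
  have an accumulation point of the centers of these balls.\<close>

lemma finite_tiles_near:
  assumes "colored_tiling T"
  shows "finite {x \<in> T. region (fst x) \<inter> cball A 1 \<noteq> {}}" (is "finite ?N")
proof -
  obtain e where e: "0 < e" "\<And>t. is_tile t \<Longrightarrow> \<exists>z. ball z e \<subseteq> interior (region t)"
    using tiles_contain_balls by blast
  have "\<forall>x\<in>?N. \<exists>z. ball z e \<subseteq> interior (region (fst x))"
    using assms e(2) unfolding colored_tiling_def is_colored_tile_def
    by (metis (no_types, lifting) case_prodE fst_conv mem_Collect_eq)
  from bchoice[OF this] obtain z where
    z: "\<And>x. x \<in> ?N \<Longrightarrow> ball (z x) e \<subseteq> interior (region (fst x))"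
    by blast
  have sep: "e \<le> dist (z x) (z x')" if "x \<in> ?N" "x' \<in> ?N" "x \<noteq> x'" for x x'
  proof (rule ccontr)
    assume "\<not> ?thesis"
    then have "z x' \<in> ball (z x) e" by simp
    moreover have "z x' \<in> ball (z x') e" using e(1) by simp
    ultimately have "z x' \<in> interior (region (fst x)) \<inter> interior (region (fst x'))"
      using z that by blast
    then show False using assms that unfolding colored_tiling_def pairwise_def by blast
  qed
  then have inj: "inj_on z ?N" using e(1) by (force simp: inj_on_def)
  have "z x \<in> cball A 3" if x: "x \<in> ?N" for x
  proof -
    have t: "is_tile (fst x)" using assms x by (auto simp: colored_tiling_def is_colored_tile_def)
    obtain w where w: "w \<in> region (fst x)" "dist A w \<le> 1" using x by auto
    have "z x \<in> interior (region (fst x))" using z[OF x] e(1) by (auto simp: subset_iff)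
    then have "z x \<in> region (fst x)" using interior_subset by blast
    then have "dist (vR (fst x)) (z x) \<le> 1" "dist (vR (fst x)) w \<le> 1"
      using region_subset_cball[OF t] w(1) by auto
    then show ?thesis using w(2) dist_triangle[of A "z x" w] dist_triangle[of w "z x" "vR (fst x)"]
      by (simp add: dist_commute)
  qed
  then have bd: "bounded (z ` ?N)" by (meson bounded_cball bounded_subset image_subsetI)
  have "finite (z ` ?N)"
  proof (rule ccontr)
    assume "infinite (z ` ?N)"
    then obtain l where "l islimpt (z ` ?N)"
      using bd Heine_Borel_imp_Bolzano_Weierstrass[of "closure (z ` ?N)" "z ` ?N"] closure_subset
      by (meson bounded_closure closed_closure compact_eq_bounded_closed)
    then have l: "\<And>r. 0 < r \<Longrightarrow> \<exists>w\<in>z ` ?N. w \<noteq> l \<and> dist w l < r" by (simp add: islimpt_approachable)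
    obtain w where w: "w \<in> z ` ?N" "w \<noteq> l" "dist w l < e / 2"
      by (rule bexE[OF l[of "e / 2"]]) (use e(1) in simp_all)
    obtain w' where w': "w' \<in> z ` ?N" "dist w' l < dist w l"
      by (rule bexE[OF l[of "dist w l"]]) (use w(2) in simp_all)
    have "dist w w' < e" using w w' dist_triangle2[of w w' l] by simp
    moreover have "w \<noteq> w'" using w' by auto
    moreover obtain x x' where "x \<in> ?N" "x' \<in> ?N" "w = z x" "w' = z x'"
      using w(1) w'(1) by (elim imageE)
    ultimately show False using sep[of x x'] by fastforce
  qed
  then show ?thesis using inj finite_image_iff by blast
qed

text \<open>The finitely many nearby tiles that do not contain \<open>A\<close> form a closed set, so a neighborhood of \<open>A\<close>
  is covered by those that do.\<close>

lemma complete_star_plane: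
  assumes "colored_tiling T" "covers_plane T"
  shows "complete_star (star_at T A)"
proof -
  let ?N = "{x \<in> T. region (fst x) \<inter> cball A 1 \<noteq> {}}"
  let ?F = "\<Union>x\<in>{x \<in> ?N. A \<notin> region (fst x)}. region (fst x)"
  have "finite {x \<in> ?N. A \<notin> region (fst x)}" 
    by (rule finite_subset[OF _ finite_tiles_near[OF assms(1), of A]]) blast
  then have "closed ?F" by (intro closed_UN) (auto simp: closed_region)
  then have "open (ball A 1 - ?F)" by auto
  moreover have "A \<in> ball A 1 - ?F" by auto
  moreover have "ball A 1 - ?F \<subseteq> (\<Union>x\<in>snd (star_at T A). region (fst x))"
  proof
    fix z assume z: "z \<in> ball A 1 - ?F"
    have "z \<in> covered T" using assms(2) by (simp add: covers_plane_def)
    then obtain t d where t: "(t, d) \<in> T" "z \<in> region t"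
      unfolding covered_def by (auto simp del: mem_ball)
    have "z \<in> cball A 1" using z by simp
    then have "A \<in> region t" using z t by force
    then show "z \<in> (\<Union>x\<in>snd (star_at T A). region (fst x))"
      using t by (force simp: star_at_def)
  qed
  ultimately show ?thesis unfolding complete_star_def
    by (auto simp: star_at_def intro: interiorI)
qed

section \<open>The decomposition of a star\<close>

text \<open>A tile of a star, where only some of the sides are decorated.\<close>

type_synonym partial_tile = "tile \<times> (side \<Rightarrow> decor option)"

definition map_ptile ::
    "(complex \<Rightarrow> complex) \<Rightarrow> partial_tile \<Rightarrow> partial_tile" where
  "map_ptile f = (\<lambda>(t, e). (map_tile f t, \<lambda>s. map_option (map_decor f) (e s)))"

text \<open>The action of an enlargement, which keeps orientations.\<close>

definition scale_ptile :: "(complex \<Rightarrow> complex) \<Rightarrow> partial_tile \<Rightarrow> partial_tile" where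
  "scale_ptile h = (\<lambda>(t, e). (map_tile h t, e))"

definition restrict_decor :: "complex \<Rightarrow> tile \<Rightarrow> (side \<Rightarrow> decor option) \<Rightarrow> side \<Rightarrow> decor option" where
  "restrict_decor A t e s = (if A \<in> side_set t s then e s else None)"

definition partial_piece_decor :: "tile \<Rightarrow> (side \<Rightarrow> decor option) \<Rightarrow> tile \<Rightarrow> side \<Rightarrow> decor option" where
  "partial_piece_decor t e y s = (case parent_side (kind t) (kind y) s of
     None \<Rightarrow> Some (altitude_decor t) | Some s' \<Rightarrow> map_option relabel (e s'))"

text \<open>The decomposition of the tiles of a star with center \<open>A\<close> before the enlargement: of the pieces only
  those through \<open>A\<close> are kept, and of their decorations only those on sides through \<open>A\<close>.\<close>

definition cut_star :: "complex \<Rightarrow> partial_tile set \<Rightarrow> partial_tile set" where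
  "cut_star A X = {(y, restrict_decor A y (partial_piece_decor t e y)) | t e y.
     (t, e) \<in> X \<and> y \<in> pieces t \<and> A \<in> region y}"

lemma map_star_eq: "map_star f (A, X) = (f A, map_ptile f ` X)"
  by (simp add: map_star_def map_ptile_def)

lemma map_ptile_comp:
  assumes "isometry f"
  shows "map_ptile f (map_ptile g x) = map_ptile (\<lambda>z. f (g z)) x"
proof -
  have "map_decor f (map_decor g u) = map_decor (\<lambda>z. f (g z)) u" for u
    unfolding map_decor_def using isometry_linear_part[OF assms] by (simp add: case_prod_beta)
  then show ?thesis
    by (simp add: map_ptile_def case_prod_beta map_tile_comp option.map_comp comp_def)
qed

lemma map_ptile_id: "map_ptile (\<lambda>z. z) x = x"
  by (simp add: map_ptile_def map_decor_def case_prod_beta option.map_ident option.map_id)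

lemma map_star_comp:
  assumes "isometry f"
  shows "map_star f (map_star g S) = map_star (\<lambda>z. f (g z)) S"
  by (cases S) (simp add: map_star_eq image_image map_ptile_comp[OF assms])

lemma map_star_id: "map_star (\<lambda>z. z) S = S"
  by (cases S) (simp add: map_star_eq map_ptile_id)

lemma congruent_stars_via_copy:
  assumes "isometry f" "S = map_star f X" "congruent_stars X S'"
  shows "congruent_stars S S'"
proof -
  obtain g where g: "isometry g" "S' = map_star g X" using assms(3) congruent_stars_def by blast
  obtain f' where f': "isometry f'" "\<And>z. f' (f z) = z" using isometry_inverse[OF assms(1)] by metis
  have "map_star f' S = X" unfolding assms(2) map_star_comp[OF f'(1)] f'(2) by (rule map_star_id)
  then have "S' = map_star (\<lambda>z. g (f' z)) S" using g map_star_comp[OF g(1), of f' S] by simp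
  then show ?thesis unfolding congruent_stars_def using isometry_comp[OF g(1) f'(1)] by blast
qed

text \<open>A side of a piece through \<open>A\<close> lies in a side of the old tile through \<open>A\<close> or is an altitude, so the
  decorations of sides that avoid \<open>A\<close> do not influence the star.\<close>

lemma star_decomposition:
  assumes "colored_tiling T"
  shows "star_at (decomposition c T) (homothety c A) =
    (homothety c A, scale_ptile (homothety c) ` cut_star A (snd (star_at T A)))"
proof -
  let ?H = "homothety c"
  have mem: "?H A \<in> region (map_tile ?H y) \<longleftrightarrow> A \<in> region y"
    "?H A \<in> side_set (map_tile ?H y) s \<longleftrightarrow> A \<in> side_set y s" for y s
    using affine_inj_inj[OF homothety_affine_inj, of c]
    by (simp_all add: region_map_tile[OF homothety_affine_inj] side_set_map_tile[OF homothety_affine_inj]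
        inj_image_mem_iff)
  let ?e = "\<lambda>t d s. if A \<in> side_set t s then Some (d s) else None"
  have dec: "(\<lambda>s. if ?H A \<in> side_set (map_tile ?H y) s then Some (piece_decor t d y s) else None) =
       restrict_decor A y (partial_piece_decor t (?e t d) y)"
    if t: "(t, d) \<in> T" "y \<in> pieces t" for t d y
  proof
    fix s
    have n: "nondeg t" using t colored_tiling_is_tile[OF assms] is_tile_nondeg by blast
    show "(if ?H A \<in> side_set (map_tile ?H y) s then Some (piece_decor t d y s) else None) =
       restrict_decor A y (partial_piece_decor t (?e t d) y) s"
      using piece_side(1)[OF n t(2), of s]
      by (auto simp: mem restrict_decor_def partial_piece_decor_def piece_decor_def split: option.splits)
  qed
  have sub: "A \<in> region t" if "(t, d) \<in> T" "y \<in> pieces t" "A \<in> region y" for t d y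
    using piece_region_subset is_tile_nondeg colored_tiling_is_tile[OF assms] that by blast
  have "snd (star_at (decomposition c T) (?H A)) = {(map_tile ?H y, (\<lambda>s. if ?H A \<in> side_set (map_tile ?H y) s
      then Some (piece_decor t d y s) else None)) | t d y. (t, d) \<in> T \<and> y \<in> pieces t \<and> A \<in> region y}"
    (is "_ = ?R") unfolding star_at_def mem_decomposition[OF assms] using mem(1) by fastforce
  also have "?R = {(map_tile ?H y, restrict_decor A y (partial_piece_decor t (?e t d) y)) | t d y.
       (t, d) \<in> T \<and> y \<in> pieces t \<and> A \<in> region y}"
    using dec by (intro Collect_cong iff_exI) auto
  also have "\<dots> = scale_ptile ?H ` cut_star A (snd (star_at T A))" (is "?L = _")
  proof (intro equalityI subsetI)
    fix x assume "x \<in> ?L"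
    then obtain t d y where *: "(t, d) \<in> T" "y \<in> pieces t" "A \<in> region y"
      "x = scale_ptile ?H (y, restrict_decor A y (partial_piece_decor t (?e t d) y))"
      by (auto simp: scale_ptile_def)
    moreover have "(t, ?e t d) \<in> snd (star_at T A)"
      using * sub by (auto simp: star_at_def)
    ultimately show "x \<in> scale_ptile ?H ` cut_star A (snd (star_at T A))"
      unfolding cut_star_def by blast
  next
    fix x assume "x \<in> scale_ptile ?H ` cut_star A (snd (star_at T A))"
    then show "x \<in> ?L"
      unfolding cut_star_def star_at_def by (force simp: scale_ptile_def)
  qed
  finally have "snd (star_at (decomposition c T) (?H A)) = scale_ptile ?H ` cut_star A (snd (star_at T A))" .
  then show ?thesis by (simp add: prod_eq_iff) (simp add: star_at_def)
qed

lemma altitude_decor_map_tile: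
  assumes "isometry f"
  shows "altitude_decor (map_tile f t) = map_decor f (altitude_decor t)"
  using isometry_affine_inj[OF assms]
  by (simp add: altitude_decor_def map_decor_def foot_map_tile sgn_isometry[OF assms]
      isometry_linear_part[OF assms, of "vR t" "foot t"])

lemma map_decor_relabel: "map_decor f (relabel u) = relabel (map_decor f u)"
  by (simp add: map_decor_def relabel_def case_prod_beta)

text \<open>Altitude feet, and the orientations of altitudes, are equivariant under isometries.\<close>

lemma cut_star_isometry:
  assumes f: "isometry f"
  shows "cut_star (f A) (map_ptile f ` X) = map_ptile f ` cut_star A X"
proof -
  note a = isometry_affine_inj[OF f]
  have part: "partial_piece_decor (map_tile f t) (\<lambda>s. map_option (map_decor f) (e s)) (map_tile f y) s =
     map_option (map_decor f) (partial_piece_decor t e y s)" for t e y s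
    by (auto simp: partial_piece_decor_def altitude_decor_map_tile[OF f] map_decor_relabel
        option.map_comp comp_def split: option.splits)
  have res: "(map_tile f y, restrict_decor (f A) (map_tile f y)
       (partial_piece_decor (map_tile f t) (\<lambda>s. map_option (map_decor f) (e s)) (map_tile f y))) =
     map_ptile f (y, restrict_decor A y (partial_piece_decor t e y))" for t e y
    using affine_inj_inj[OF a] part
    by (auto simp: map_ptile_def restrict_decor_def fun_eq_iff side_set_map_tile[OF a] inj_image_mem_iff)
  have reg: "f A \<in> region (map_tile f y) \<longleftrightarrow> A \<in> region y" for y
    using affine_inj_inj[OF a] by (simp add: region_map_tile[OF a] inj_image_mem_iff)
  show ?thesis
  proof (intro equalityI subsetI)
    fix x assume "x \<in> cut_star (f A) (map_ptile f ` X)"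
    then obtain t e y where "(t, e) \<in> X" "y \<in> pieces t" "A \<in> region y"
      "x = (map_tile f y, restrict_decor (f A) (map_tile f y)
       (partial_piece_decor (map_tile f t) (\<lambda>s. map_option (map_decor f) (e s)) (map_tile f y)))"
      unfolding cut_star_def map_ptile_def by (auto simp: pieces_map_tile[OF a] reg)
    then show "x \<in> map_ptile f ` cut_star A X"
      unfolding res cut_star_def by blast
  next
    fix x assume "x \<in> map_ptile f ` cut_star A X"
    then obtain t e y where *: "(t, e) \<in> X" "y \<in> pieces t" "A \<in> region y"
      "x = map_ptile f (y, restrict_decor A y (partial_piece_decor t e y))"
      unfolding cut_star_def by blast
    have "(map_tile f t, \<lambda>s. map_option (map_decor f) (e s)) \<in> map_ptile f ` X"
      using *(1) by (force simp: map_ptile_def)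
    moreover have "map_tile f y \<in> pieces (map_tile f t)" using * by (simp add: pieces_map_tile[OF a])
    ultimately show "x \<in> cut_star (f A) (map_ptile f ` X)"
      unfolding cut_star_def *(4) res[symmetric] using reg *(3) by blast
  qed
qed

lemma cut_star_Un: "cut_star A (X \<union> Y) = cut_star A X \<union> cut_star A Y"
  unfolding cut_star_def by blast

text \<open>One step of the decomposition, including the enlargement, at a star with center \<open>0\<close>.\<close>

definition evolve :: "partial_tile set \<Rightarrow> partial_tile set" where
  "evolve X = scale_ptile enlarge ` cut_star 0 X"

lemma evolve_Un: "evolve (X \<union> Y) = evolve X \<union> evolve Y"
  by (simp add: evolve_def cut_star_Un image_Un)

lemma scale_map_ptile:
  assumes "isometry f"
  shows "scale_ptile (homothety c) (map_ptile f x) =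
    map_ptile (\<lambda>z. homothety c (f 0) + (f z - f 0)) (scale_ptile enlarge x)"
proof -
  have eq: "(\<lambda>z. homothety c (f z)) = (\<lambda>z. homothety c (f 0) + (f (enlarge z) - f 0))"
    using homothety_isometry[OF assms] by blast
  have "map_decor (\<lambda>z. homothety c (f 0) + (f z - f 0)) = map_decor f"
    by (simp add: map_decor_def)
  then show ?thesis
    unfolding map_ptile_def scale_ptile_def case_prod_beta fst_conv snd_conv map_tile_comp eq
    by (simp only:)
qed

lemma evolve_isometry:
  assumes "isometry f" "f 0 = 0"
  shows "evolve (map_ptile f ` X) = map_ptile f ` evolve X"
proof -
  have "enlarge = homothety 0" by (auto simp: enlarge_def homothety_def)
  moreover have "homothety 0 0 = 0" by (simp add: homothety_def)
  ultimately have "scale_ptile enlarge (map_ptile f x) = map_ptile f (scale_ptile enlarge x)" for x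
    using scale_map_ptile[OF assms(1), of 0 x] assms(2) by simp
  then show ?thesis
    using cut_star_isometry[OF assms(1), of 0 X] assms(2) by (simp add: evolve_def image_image)
qed

text \<open>If the star at \<open>A\<close> is a copy of a star with center \<open>0\<close>, then the star at the image of \<open>A\<close> is a copy,
  with the same linear part, of the evolved star.\<close>

lemma star_decomposition_evolve:
  assumes "colored_tiling T" "isometry f" "star_at T A = map_star f (0, X)"
  shows "star_at (decomposition c T) (homothety c A) =
    map_star (\<lambda>z. homothety c A + (f z - f 0)) (0, evolve X)"
    and "isometry (\<lambda>z. homothety c A + (f z - f 0))"
proof -
  have "fst (star_at T A) = f 0" unfolding assms(3) map_star_eq by simp
  then have A: "A = f 0" by (simp add: star_at_def)
  have X: "snd (star_at T A) = map_ptile f ` X" unfolding assms(3) map_star_eq by simp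
  show "star_at (decomposition c T) (homothety c A) =
    map_star (\<lambda>z. homothety c A + (f z - f 0)) (0, evolve X)"
    unfolding star_decomposition[OF assms(1)] X
    unfolding A cut_star_isometry[OF assms(2)] evolve_def map_star_eq
    by (simp add: image_image scale_map_ptile[OF assms(2)])
  show "isometry (\<lambda>z. homothety c A + (f z - f 0))"
    by (rule isometry_translated_linear_part[OF assms(2)])
qed

section \<open>Fans of tiles around a vertex\<close>

text \<open>The tile that contributes the corner \<open>x\<close> between the rays \<open>u\<close> and \<open>u * cis (- corner_angle x)\<close>.\<close>

definition fan_tile :: "complex \<Rightarrow> tile_size \<Rightarrow> corner \<Rightarrow> tile" where
  "fan_tile u k x = corner_tile k x (side_length k (fst (corner_sides x)) *\<^sub>R u)
     (side_length k (snd (corner_sides x)) *\<^sub>R (u * cis (- corner_angle x)))"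

lemma fan_Cons: "fan u ((k, x) # ts) = insert (fan_tile u k x) (fan (u * cis (- corner_angle x)) ts)"
  by (simp add: fan_tile_def Let_def)

declare fan.simps(2) [simp del]
declare fan_Cons [simp]

text \<open>What the corner of a tile at the center of a star becomes: a small tile becomes large, an acute
  corner of a large tile is the acute corner of one of its pieces, where the roles of the two sides
  are exchanged, and a right angle is divided by the altitude.\<close>

fun corner_pieces :: "tile_size \<times> corner \<Rightarrow> (tile_size \<times> corner) list" where
  "corner_pieces (Small, x) = [(Large, x)]"
| "corner_pieces (Large, HB) = [(Large, BH)]"
| "corner_pieces (Large, BH) = [(Large, HB)]"
| "corner_pieces (Large, HA) = [(Small, AH)]"
| "corner_pieces (Large, AH) = [(Small, HA)]"
| "corner_pieces (Large, BA) = [(Large, HA), (Small, BH)]"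
| "corner_pieces (Large, AB) = [(Small, HB), (Large, AH)]"

lemma isometry_mult: "cmod u = 1 \<Longrightarrow> isometry (\<lambda>z. u * z)"
  by (simp add: isometry_def dist_norm norm_mult flip: right_diff_distrib)

lemma fan_tile_rotate: "fan_tile (w * u) k x = map_tile (\<lambda>z. w * z) (fan_tile u k x)"
  by (cases x) (simp_all add: fan_tile_def mult_ac)

lemma cis_corner: "cis (- small_angle) = Complex phi (- (phi\<^sup>2))"
  "cis (- large_angle) = Complex (phi\<^sup>2) (- phi)" "cis (- (pi / 2)) = - \<i>"
  using cis_cnj[of small_angle] cis_cnj[of large_angle]
  by (simp_all add: cis_small_angle cis_large_angle complex_eq_iff)

text \<open>Listings run clockwise, so the order of the two sides at the corner determines the chirality of the
  tile.\<close>

lemma is_tile_fan_tile_1: "is_tile (fan_tile 1 k x)"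
proof -
  let ?t = "fan_tile 1 k x" and ?s = "if x \<in> {BA, HB, AH} then -1 else 1 :: real"
  have "vL ?t - vR ?t = of_real (?s * phi) * \<i> * (vS ?t - vR ?t)"
    by (cases k; cases x)
      (simp_all add: fan_tile_def cis_corner complex_eq_iff power_numeral_reduce phi_reduce algebra_simps)
  moreover have sq: "(cmod (vS ?t - vR ?t))\<^sup>2 = (side_length k BigLeg)\<^sup>2"
    unfolding cmod_power2 by (cases k; cases x)
      (simp_all add: fan_tile_def cis_corner power_numeral_reduce phi_reduce algebra_simps)
  have "0 \<le> side_length k BigLeg" using phi_pos by (cases k) simp_all
  then have "cmod (vS ?t - vR ?t) = side_length k BigLeg"
    by (rule power2_eq_imp_eq[OF sq norm_ge_zero])
  moreover have "kind ?t = k" by (cases x) (simp_all add: fan_tile_def)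
  ultimately show ?thesis
    unfolding is_tile_iff by (intro conjI bexI[of _ ?s]) (simp_all only:, simp)
qed

lemma is_tile_fan_tile: "cmod u = 1 \<Longrightarrow> is_tile (fan_tile u k x)"
  using is_tile_map_tile[OF isometry_mult is_tile_fan_tile_1] fan_tile_rotate[of u 1 k x] by simp

lemma is_tile_fan: "cmod u = 1 \<Longrightarrow> t \<in> fan u ts \<Longrightarrow> is_tile t"
proof (induction ts arbitrary: u)
  case (Cons kx ts)
  obtain k x where kx: "kx = (k, x)" by (cases kx)
  have "cmod (u * cis (- corner_angle x)) = 1" using Cons.prems by (simp add: norm_mult)
  from Cons.IH[OF this] show ?case using Cons.prems by (auto simp: kx is_tile_fan_tile)
qed simp

lemma vertex_fan_tile: "0 \<in> vertices (fan_tile u k x)"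
  by (cases x) (simp_all add: fan_tile_def vertices_def)

lemma vertex_fan: "t \<in> fan u ts \<Longrightarrow> 0 \<in> vertices t"
  by (induction ts arbitrary: u) (auto simp: vertex_fan_tile)

text \<open>The enlarged pieces that contain the center of the star.\<close>

definition pieces_at_0 :: "tile \<Rightarrow> tile set" where
  "pieces_at_0 t = map_tile enlarge ` {y \<in> pieces t. 0 \<in> region y}"

lemma pieces_at_vertex:
  assumes "nondeg t" "kind t = Large"
  shows "vR t = 0 \<Longrightarrow> {y \<in> pieces t. 0 \<in> region y} =
      {Tile Large (foot t) (vS t) 0, Tile Small (foot t) 0 (vL t)}"
    and "vS t = 0 \<Longrightarrow> {y \<in> pieces t. 0 \<in> region y} = {Tile Large (foot t) 0 (vR t)}"
    and "vL t = 0 \<Longrightarrow> {y \<in> pieces t. 0 \<in> region y} = {Tile Small (foot t) (vR t) 0}"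
  using vertices_of_other_piece[OF assms(1)] assms(2)
    vertex_in_region(2,3)[of "Tile Large (foot t) (vS t) (vR t)"]
    vertex_in_region(2,3)[of "Tile Small (foot t) (vR t) (vL t)"]
  by (auto simp: pieces_def)

lemma cis_corner_mult: "cis (- small_angle) * cis (- large_angle) = cis (- (pi / 2))"
  unfolding cis_mult angles_sum[symmetric] by simp

lemma foot_right_angle:
  "foot (fan_tile u Large BA) = phi ^ 3 *\<^sub>R (u * cis (- large_angle))"
  "foot (fan_tile u Large AB) = phi ^ 3 *\<^sub>R (u * cis (- small_angle))"
  by (simp_all add: foot_def fan_tile_def cis_corner complex_eq_iff power_numeral_reduce phi_reduce
      algebra_simps)

lemma enlarge_phi:
  "enlarge (phi *\<^sub>R z) = z" "enlarge (phi\<^sup>2 *\<^sub>R z) = phi *\<^sub>R z"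
  "enlarge (phi ^ 3 *\<^sub>R z) = phi\<^sup>2 *\<^sub>R z" "enlarge (phi ^ 4 *\<^sub>R z) = phi ^ 3 *\<^sub>R z"
  "enlarge 0 = 0" "enlarge (- z) = - enlarge z"
  by (simp_all add: enlarge_def power_numeral_reduce)

lemma pieces_at_0_fan_tile:
  assumes u: "cmod u = 1"
  shows "pieces_at_0 (fan_tile u k x) = fan u (corner_pieces (k, x))"
proof (cases k)
  case Small
  let ?t = "fan_tile u k x"
  have "0 \<in> region ?t" using vertex_fan_tile vertices_subset_region by blast
  then have "0 \<in> region (Tile Large (vR ?t) (vS ?t) (vL ?t))"
    by (simp add: region_def vertices_def)
  moreover have k: "kind ?t = Small" using Small by (cases x) (simp_all add: fan_tile_def)
  ultimately have "{y \<in> pieces ?t. 0 \<in> region y} = {Tile Large (vR ?t) (vS ?t) (vL ?t)}"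
    by (auto simp: pieces_def)
  then show ?thesis unfolding pieces_at_0_def using Small
    by (cases x) (simp_all add: fan_tile_def enlarge_phi)
next
  case Large
  let ?t = "fan_tile u k x"
  have n: "nondeg ?t" by (rule is_tile_nondeg[OF is_tile_fan_tile[OF u]])
  have k: "kind ?t = Large" using Large by (cases x) (simp_all add: fan_tile_def)
  have v: "x \<in> {BA, AB} \<Longrightarrow> vR ?t = 0" "x \<in> {HB, BH} \<Longrightarrow> vS ?t = 0" "x \<in> {HA, AH} \<Longrightarrow> vL ?t = 0"
    by (auto simp: fan_tile_def)
  consider "x \<in> {BA, AB}" | "x \<in> {HB, BH}" | "x \<in> {HA, AH}" by (cases x) auto
  then show ?thesis
  proof cases
    case 1
    have c: "u * (cis (- small_angle) * cis (- large_angle)) = u * cis (- (pi / 2))"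
      "u * (cis (- large_angle) * cis (- small_angle)) = u * cis (- (pi / 2))"
      using cis_corner_mult by (simp_all add: mult.commute)
    have f: "enlarge (foot ?t) = phi\<^sup>2 *\<^sub>R (u * cis (- (if x = BA then large_angle else small_angle)))"
      using 1 by (auto simp: Large foot_right_angle enlarge_phi)
    show ?thesis
      unfolding pieces_at_0_def pieces_at_vertex(1)[OF n k v(1)[OF 1]]
      using 1 f c by (auto simp: Large fan_tile_def enlarge_phi mult.assoc insert_commute)
  next
    case 2
    then show ?thesis
      unfolding pieces_at_0_def pieces_at_vertex(2)[OF n k v(2)[OF 2]]
      by (auto simp: Large fan_tile_def foot_def enlarge_phi)
  next
    case 3
    then show ?thesis
      unfolding pieces_at_0_def pieces_at_vertex(3)[OF n k v(3)[OF 3]]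
      by (auto simp: Large fan_tile_def foot_def enlarge_phi)
  qed
qed

lemma corner_angles_pieces: "(\<Prod>(k, x)\<leftarrow>corner_pieces (k, x). cis (- corner_angle x)) = cis (- corner_angle x)"
  using cis_corner_mult by (cases k; cases x) (simp_all add: mult.commute)

lemma fan_append: "fan u (ts @ ts') = fan u ts \<union> fan (u * (\<Prod>(k, x)\<leftarrow>ts. cis (- corner_angle x))) ts'"
  by (induction ts arbitrary: u) (auto simp: mult.assoc)

text \<open>Cutting preserves the total angle of a corner, so the pieces of consecutive corners are again
  consecutive.\<close>

lemma pieces_of_fan:
  assumes "cmod u = 1"
  shows "(\<Union>t\<in>fan u ts. pieces_at_0 t) = fan u (concat (map corner_pieces ts))"
  using assms
proof (induction ts arbitrary: u)
  case (Cons kx ts)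
  obtain k x where kx: "kx = (k, x)" by (cases kx)
  have "pieces_at_0 (fan_tile u k x) = fan u (corner_pieces (k, x))"
    by (rule pieces_at_0_fan_tile[OF Cons.prems])
  moreover have "cmod (u * cis (- corner_angle x)) = 1" using Cons.prems by (simp add: norm_mult)
  note Cons.IH[OF this]
  ultimately show ?case using corner_angles_pieces[of k x]
    by (simp add: kx fan_append)
qed simp

text \<open>The directions of the altitudes drawn inside the right angles of a fan. An altitude encloses the
  angle at the larger acute vertex with the large leg and the angle at the smaller one with the
  small leg.\<close>

fun altitude_rays :: "complex \<Rightarrow> (tile_size \<times> corner) list \<Rightarrow> complex set" where
  "altitude_rays u [] = {}"
| "altitude_rays u ((k, x) # ts) =
     (if (k, x) = (Large, BA) then {u * cis (- large_angle)}
      else if (k, x) = (Large, AB) then {u * cis (- small_angle)} else {}) \<union>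
     altitude_rays (u * cis (- corner_angle x)) ts"

text \<open>For a side with one end at \<open>0\<close>, its other end.\<close>

definition far_end :: "tile \<Rightarrow> side \<Rightarrow> complex" where
  "far_end t s = (if fst (ends t s) = 0 then snd (ends t s) else fst (ends t s))"

text \<open>In a star whose center is a vertex of all its tiles the decoration of a side through the center is
  a function of the direction of the side.\<close>

definition decorate :: "(complex \<Rightarrow> decor) \<Rightarrow> tile \<Rightarrow> partial_tile" where
  "decorate D t = (t, \<lambda>s. if 0 \<in> side_set t s then Some (D (sgn (far_end t s))) else None)"

lemma enlarge_affine_inj: "affine_inj enlarge"
proof -
  have e: "enlarge = homothety 0" by (auto simp: enlarge_def homothety_def)
  show ?thesis unfolding e by (rule homothety_affine_inj)
qed

lemma enlarge_0_iff [simp]: "enlarge z = 0 \<longleftrightarrow> z = 0"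
  by (simp add: enlarge_def)

lemma zero_in_enlarged_side: "0 \<in> side_set (map_tile enlarge t) s \<longleftrightarrow> 0 \<in> side_set t s"
  using affine_inj_inj[OF enlarge_affine_inj] inj_image_mem_iff[of enlarge 0 "side_set t s"]
  by (simp add: side_set_map_tile[OF enlarge_affine_inj] enlarge_def)

lemma sgn_far_end_enlarge: "sgn (far_end (map_tile enlarge t) s) = sgn (far_end t s)"
  using phi_pos by (auto simp: far_end_def ends_map_tile enlarge_def sgn_scaleR_pos)

text \<open>A side of a piece through the center points in the direction of the old side that contains it;
  only at a right angle there is a new side, the altitude.\<close>

lemma inherited_direction:
  assumes t: "is_tile t" "0 \<in> vertices t" and y: "y \<in> pieces t" "0 \<in> side_set y s"
  shows "parent_side (kind t) (kind y) s = Some s' \<Longrightarrow>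
      0 \<in> side_set t s' \<and> sgn (far_end y s) = sgn (far_end t s')"
    and "parent_side (kind t) (kind y) s = None \<Longrightarrow> kind t = Large \<and> vR t = 0 \<and> far_end y s = foot t"
proof -
  have n: "nondeg t" "nondeg y" using is_tile_nondeg[OF t(1)] piece_nondeg[OF t(1) y(1)] by blast+
  note d = distinct_vertices[OF n(1)] distinct_vertices[OF n(2)]
  note v = vertex_in_side[OF n(2), of s] vertices_of_other_piece[OF n(1)]
  have r: "0 \<in> region y" using side_set_subset_region y(2) by blast
  have f: "vS t = 0 \<Longrightarrow> sgn (foot t) = sgn (vL t)" "vL t = 0 \<Longrightarrow> sgn (foot t) = sgn (vS t)"
    using phi_pos by (simp_all add: foot_def sgn_scaleR_pos)
  show "parent_side (kind t) (kind y) s = Some s' \<Longrightarrow>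
      0 \<in> side_set t s' \<and> sgn (far_end y s) = sgn (far_end t s')"
  proof
    assume p: "parent_side (kind t) (kind y) s = Some s'"
    then show "0 \<in> side_set t s'" using piece_side(1)[OF n(1) y(1)] y(2) by blast
    show "sgn (far_end y s) = sgn (far_end t s')"
      using p t(2) y r d v f
      by (cases t; cases "kind t"; cases s) (auto simp: pieces_def vertices_def far_end_def)
  qed
  show "parent_side (kind t) (kind y) s = None \<Longrightarrow> kind t = Large \<and> vR t = 0 \<and> far_end y s = foot t"
    using t(2) y r d v
    by (cases t; cases "kind t"; cases s) (auto simp: pieces_def vertices_def far_end_def)
qed

lemma evolve_decorate:
  assumes t: "is_tile t" "0 \<in> vertices t" and D: "\<And>z. D' z = relabel (D z)"
    and alt: "kind t = Large \<Longrightarrow> vR t = 0 \<Longrightarrow> D' (sgn (foot t)) = (0, - sgn (foot t))"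
  shows "evolve {decorate D t} = decorate D' ` pieces_at_0 t"
proof -
  have "scale_ptile enlarge (y, restrict_decor 0 y (partial_piece_decor t (snd (decorate D t)) y)) =
     decorate D' (map_tile enlarge y)" if y: "y \<in> pieces t" for y
  proof -
    have "restrict_decor 0 y (partial_piece_decor t (snd (decorate D t)) y) s =
      (if 0 \<in> side_set y s then Some (D' (sgn (far_end y s))) else None)" for s
    proof (cases "0 \<in> side_set y s")
      case True
      note i = inherited_direction[OF t y True]
      show ?thesis
      proof (cases "parent_side (kind t) (kind y) s")
        case None
        then show ?thesis using i(2) alt True
          by (simp add: restrict_decor_def partial_piece_decor_def altitude_decor_def sgn_minus)
      next
        case (Some s')
        then show ?thesis using i(1)[OF Some] True D
          by (simp add: restrict_decor_def partial_piece_decor_def decorate_def)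
      qed
    qed (simp add: restrict_decor_def)
    then show ?thesis
      by (auto simp: scale_ptile_def decorate_def zero_in_enlarged_side sgn_far_end_enlarge)
  qed
  moreover have "evolve {decorate D t} =
     (\<lambda>y. scale_ptile enlarge (y, restrict_decor 0 y (partial_piece_decor t (snd (decorate D t)) y)))
       ` {y \<in> pieces t. 0 \<in> region y}"
    unfolding evolve_def cut_star_def decorate_def by auto
  ultimately show ?thesis unfolding pieces_at_0_def by (auto simp: image_image)
qed

lemma sgn_foot_fan_tile:
  assumes "cmod u = 1"
  shows "sgn (foot (fan_tile u Large BA)) = u * cis (- large_angle)"
    and "sgn (foot (fan_tile u Large AB)) = u * cis (- small_angle)"
  using phi_pos assms by (simp_all only: foot_right_angle sgn_scaleR_pos zero_less_power)
    (simp_all add: sgn_div_norm norm_mult)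

text \<open>The decoration of the evolved fan is the relabelled old one, also formally at the directions of the
  altitudes, where the hypothesis says that it gives label 0 and the orientation towards the vertex
  of the right angle.\<close>

lemma evolve_fan:
  assumes "cmod u = 1" and D: "\<And>z. D' z = relabel (D z)"
    and alt: "\<And>z. z \<in> altitude_rays u ts \<Longrightarrow> D' z = (0, - z)"
  shows "evolve (decorate D ` fan u ts) = decorate D' ` fan u (concat (map corner_pieces ts))"
proof -
  have e: "evolve (decorate D ` fan u ts) = (\<Union>t\<in>fan u ts. decorate D' ` pieces_at_0 t)"
    using assms(1) alt
  proof (induction ts arbitrary: u)
    case Nil
    then show ?case by (simp add: evolve_def cut_star_def)
  next
    case (Cons kx ts)
    obtain k x where kx: "kx = (k, x)" by (cases kx)
    let ?t = "fan_tile u k x"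
    have n: "nondeg ?t" using is_tile_nondeg is_tile_fan_tile Cons.prems(1) by blast
    have "D' (sgn (foot ?t)) = (0, - sgn (foot ?t))" if "kind ?t = Large" "vR ?t = 0"
    proof -
      have "k = Large" using that(1) by (cases x) (simp_all add: fan_tile_def)
      moreover have "x \<in> {BA, AB}"
        using that(2) distinct_vertices[OF n] by (cases x) (auto simp: fan_tile_def)
      ultimately show ?thesis
        using Cons.prems(2) by (auto simp: kx sgn_foot_fan_tile[OF Cons.prems(1)])
    qed
    then have 1: "evolve {decorate D ?t} = decorate D' ` pieces_at_0 ?t"
      by (intro evolve_decorate is_tile_fan_tile vertex_fan_tile D Cons.prems(1))
    have 2: "evolve (decorate D ` fan (u * cis (- corner_angle x)) ts) =
       (\<Union>t\<in>fan (u * cis (- corner_angle x)) ts. decorate D' ` pieces_at_0 t)"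
      using Cons.prems by (intro Cons.IH) (auto simp: kx norm_mult)
    show ?case using 1 2 evolve_Un[of "{decorate D ?t}"] by (simp add: kx)
  qed
  show ?thesis unfolding e pieces_of_fan[OF assms(1), symmetric] by blast
qed

fun swap_corner :: "corner \<Rightarrow> corner" where
  "swap_corner BA = AB" | "swap_corner AB = BA" | "swap_corner HB = BH"
| "swap_corner BH = HB" | "swap_corner HA = AH" | "swap_corner AH = HA"

text \<open>Reflection in the imaginary axis turns a clockwise listing into a counterclockwise one; reading it
  backwards makes it clockwise again.\<close>

lemma reflect_fan:
  "map_tile (\<lambda>z. - cnj z) ` fan u ts =
   fan (- cnj (u * (\<Prod>(k, x)\<leftarrow>ts. cis (- corner_angle x)))) (rev (map (\<lambda>(k, x). (k, swap_corner x)) ts))"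
proof (induction ts arbitrary: u)
  case (Cons kx ts)
  obtain k x where kx: "kx = (k, x)" by (cases kx)
  let ?P = "\<Prod>(k, x)\<leftarrow>ts. cis (- corner_angle x)"
  have swap: "corner_angle (swap_corner y) = corner_angle y" for y by (cases y) simp_all
  have P: "(\<Prod>(k, x)\<leftarrow>rev (map (\<lambda>(k, x). (k, swap_corner x)) ts). cis (- corner_angle x)) = ?P"
    by (induction ts) (auto simp: swap mult.commute)
  have c: "cnj ?P * ?P = 1"
    by (induction ts) (auto simp: cis_cnj cis_mult mult_ac)
  have "cnj (cis (- corner_angle x)) * cis (- corner_angle x) = 1"
    by (simp add: cis_cnj cis_mult)
  then have "map_tile (\<lambda>z. - cnj z) (fan_tile u k x) =
      fan_tile (- cnj (u * cis (- corner_angle x))) k (swap_corner x)"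
    by (cases x) (simp_all add: fan_tile_def cis_cnj mult.assoc)
  then show ?case using Cons.IH[of "u * cis (- corner_angle x)"] c
    by (simp add: kx fan_append P mult.assoc)
qed simp

section \<open>The evolution of the legal stars\<close>

text \<open>The decoration \<open>legal_decor\<close> as a function of the direction of the side.\<close>

definition legal_dir :: "nat \<times> nat \<times> nat \<Rightarrow> nat \<Rightarrow> complex \<Rightarrow> complex \<Rightarrow> decor" where
  "legal_dir = (\<lambda>(i, j, k) l w u.
     if u \<in> \<real> then (l, w)
     else if axis_angle u = small_angle then (i, - u)
     else if axis_angle u = large_angle then (j, - u)
     else (k, u))"

lemma vertex_is_end:
  assumes "is_tile t" "0 \<in> vertices t" "0 \<in> side_set t s"
  shows "fst (ends t s) = 0 \<or> snd (ends t s) = 0" "side_set t s = closed_segment 0 (far_end t s)"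
proof -
  have n: "nondeg t" by (rule is_tile_nondeg[OF assms(1)])
  show e: "fst (ends t s) = 0 \<or> snd (ends t s) = 0"
    using vertex_in_side[OF n, of s] assms(2,3)
    by (cases t; cases s) (auto simp: vertices_def)
  then show "side_set t s = closed_segment 0 (far_end t s)"
    by (auto simp: side_set_def far_end_def closed_segment_commute)
qed

text \<open>If the center is a vertex of the tile, a side through it is a segment from the center to its far end.\<close>

lemma legal_decor_decorate:
  assumes t: "is_tile t" "0 \<in> vertices t"
  shows "(t, legal_decor tr l w t) = decorate (legal_dir tr l w) t"
proof -
  obtain i j k where tr: "tr = (i, j, k)" by (cases tr)
  have "legal_decor tr l w t s = Some (legal_dir tr l w (sgn (far_end t s)))" if s: "0 \<in> side_set t s" for s
  proof -
    let ?z = "far_end t s"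
    have z0: "?z \<noteq> 0"
      using distinct_vertices[OF is_tile_nondeg[OF t(1)]]
      by (cases t; cases s) (auto simp: far_end_def)
    have real: "sgn ?z \<in> \<real> \<longleftrightarrow> ?z \<in> \<real>"
      using z0 by (simp add: sgn_div_norm complex_is_Real_iff)
    have ang: "axis_angle (sgn ?z) = axis_angle ?z"
      using z0 by (simp add: axis_angle_def norm_sgn sgn_div_norm abs_mult divide_inverse mult.commute)
    have seg: "side_set t s \<subseteq> \<real> \<longleftrightarrow> ?z \<in> \<real>"
    proof -
      have "closed_segment 0 ?z \<subseteq> \<real> \<longleftrightarrow> ?z \<in> \<real>"
      proof
        assume "closed_segment 0 ?z \<subseteq> \<real>"
        then show "?z \<in> \<real>" using ends_in_segment(2)[of 0 ?z] by blast
      next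
        assume "?z \<in> \<real>"
        then have "Im x = 0" if "x \<in> closed_segment 0 ?z" for x
          using that unfolding closed_segment_def by (auto simp: complex_is_Real_iff)
        then show "closed_segment 0 ?z \<subseteq> \<real>" by (auto simp: complex_is_Real_iff)
      qed
      then show ?thesis using vertex_is_end(2)[OF t s] by simp
    qed
    have "(if fst (ends t s) = 0 then snd (ends t s) else fst (ends t s)) = ?z"
      by (simp add: far_end_def)
    then show ?thesis
      using s real ang seg by (simp add: legal_decor_def legal_dir_def tr Let_def)
  qed
  moreover have "legal_decor tr l w t s = None" if "0 \<notin> side_set t s" for s
    using that by (simp add: legal_decor_def tr)
  ultimately show ?thesis by (auto simp: decorate_def)
qed

lemma legal_dir_relabel:
  "legal_dir ((i + 1) mod 4, (j + 1) mod 4, (k + 1) mod 4) ((l + 1) mod 4) w z =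
   relabel (legal_dir (i, j, k) l w z)"
  by (simp add: legal_dir_def relabel_def)

lemma legal_dir_map:
  assumes "g = cnj \<or> g = uminus \<or> g = (\<lambda>z. - cnj z)"
  shows "legal_dir tr l (g w) (g z) = map_decor g (legal_dir tr l w z)"
proof -
  obtain i j k where tr: "tr = (i, j, k)" by (cases tr)
  have "g z \<in> \<real> \<longleftrightarrow> z \<in> \<real>" "axis_angle (g z) = axis_angle z" "g (- z) = - g z" "g 0 = 0"
    using assms by (auto simp: complex_is_Real_iff axis_angle_def)
  then show ?thesis by (simp add: legal_dir_def map_decor_def tr)
qed

lemma isometry_cnj: "isometry cnj"
  unfolding isometry_def dist_norm by (metis complex_cnj_diff complex_mod_cnj)

lemma isometry_uminus: "isometry (uminus :: complex \<Rightarrow> complex)"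
  by (simp add: isometry_def dist_norm norm_minus_commute)

lemma isometry_reflect: "isometry (\<lambda>z. - cnj z)"
  by (rule isometry_comp[OF isometry_uminus isometry_cnj])

text \<open>Decorations by direction are transported by isometries that fix the center.\<close>

lemma decorate_map:
  assumes g: "isometry g" "g 0 = 0" and D: "\<And>z. D' (g z) = map_decor g (D z)"
  shows "decorate D' (map_tile g t) = map_ptile g (decorate D t)"
proof -
  note a = isometry_affine_inj[OF g(1)]
  have z: "g x = 0 \<longleftrightarrow> x = 0" for x using affine_inj_eq_iff[OF a, of x 0] g(2) by simp
  have "0 \<in> side_set (map_tile g t) s \<longleftrightarrow> 0 \<in> side_set t s" for s
    using affine_inj_inj[OF a] g(2) inj_image_mem_iff[of g 0 "side_set t s"]
    by (simp add: side_set_map_tile[OF a])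
  moreover have "sgn (far_end (map_tile g t) s) = g (sgn (far_end t s))" for s
    using sgn_isometry[OF g(1)] g(2) by (simp add: far_end_def ends_map_tile z)
  ultimately show ?thesis by (auto simp: decorate_def map_ptile_def D)
qed

lemma axis_angle_large: "cmod z = 1 \<Longrightarrow> \<bar>Im z\<bar> = phi \<Longrightarrow> axis_angle z = large_angle"
  by (simp add: axis_angle_def large_angle_arcsin)

lemma axis_angle_small: "cmod z = 1 \<Longrightarrow> \<bar>Im z\<bar> = phi\<^sup>2 \<Longrightarrow> axis_angle z = small_angle"
  by (simp add: axis_angle_def small_angle_arcsin)

lemma angles_lt: "small_angle < pi / 2" "large_angle < pi / 2"
proof -
  have "arcsin (phi\<^sup>2) < pi / 2" "arcsin phi < pi / 2"
    using phi_pos phi_lt_one phi_sq_lt_one arcsin_lt_bounded[of phi] arcsin_lt_bounded[of "phi\<^sup>2"]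
    by (auto simp: less_le_trans[of _ 0])
  then show "small_angle < pi / 2" "large_angle < pi / 2"
    by (simp_all add: small_angle_arcsin large_angle_arcsin)
qed

lemma legal_dir_perpendicular: "legal_dir (i, j, k) l w \<i> = (k, \<i>)" "legal_dir (i, j, k) l w (- \<i>) = (k, - \<i>)"
  using angles_lt by (simp_all add: legal_dir_def axis_angle_def complex_is_Real_iff)

lemma legal_dir_large:
  assumes "cmod z = 1" "\<bar>Im z\<bar> = phi"
  shows "legal_dir (i, j, k) l w z = (j, - z)"
proof -
  have "Im z \<noteq> 0" using assms(2) by auto
  then show ?thesis using axis_angle_large[OF assms] small_angle_ne_large_angle
    by (simp add: legal_dir_def complex_is_Real_iff)
qed

lemma legal_dir_small:
  assumes "cmod z = 1" "\<bar>Im z\<bar> = phi\<^sup>2"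
  shows "legal_dir (i, j, k) l w z = (i, - z)"
proof -
  have "Im z \<noteq> 0" using assms(2) by auto
  then show ?thesis using axis_angle_small[OF assms]
    by (simp add: legal_dir_def complex_is_Real_iff)
qed

definition upper_list :: "nat \<Rightarrow> (tile_size \<times> corner) list" where
  "upper_list n =
     (if n = 1 then [(Large, BA), (Small, BA)]
      else if n = 2 then [(Large, HA), (Small, BH), (Large, BA)]
      else if n = 3 then [(Small, AH), (Large, BH), (Large, HA), (Small, BH)]
      else if n = 4 then [(Large, AH), (Large, HB), (Small, AH), (Large, BH)]
      else if n = 5 then [(Small, HA), (Large, BH), (Large, AH), (Large, HB)]
      else if n = 6 then [(Large, HA), (Large, HB), (Small, HA), (Large, BH)]
      else [(Small, AH), (Large, BH), (Large, HA), (Large, HB)])"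

definition lower_list :: "nat \<Rightarrow> (tile_size \<times> corner) list" where
  "lower_list n =
     (if n = 3 then [(Small, AB), (Large, AB)]
      else if n = 4 then [(Large, AB), (Small, HB), (Large, AH)]
      else if n = 5 then [(Small, HB), (Large, AH), (Large, HB), (Small, HA)]
      else if n = 6 then [(Large, HB), (Small, HA), (Large, BH), (Large, HA)]
      else [(Large, BH), (Large, HA), (Large, HB), (Small, AH)])"

lemma upper_tiles_list: "upper_tiles n = fan (- 1) (upper_list n)"
  by (simp add: upper_tiles_def upper_fan_def upper_list_def)

text \<open>The first two stars have a lower half that consists of one tile without a vertex at the center.\<close>

lemma lower_tiles_list: "n \<noteq> 1 \<Longrightarrow> n \<noteq> 2 \<Longrightarrow> lower_tiles n = map_tile cnj ` fan (- 1) (lower_list n)"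
  by (simp add: lower_tiles_def lower_fan_def lower_list_def)

text \<open>The substitution of corners turns the listings of each star into those of the next one.\<close>

lemma list_step:
  assumes "n \<in> {1..6}"
  shows "concat (map corner_pieces (upper_list n)) = upper_list (Suc n)"
    and "3 \<le> n \<Longrightarrow> concat (map corner_pieces (lower_list n)) = lower_list (Suc n)"
proof -
  have "n = 1 \<or> n = 2 \<or> n = 3 \<or> n = 4 \<or> n = 5 \<or> n = 6" using assms by auto
  then show "concat (map corner_pieces (upper_list n)) = upper_list (Suc n)"
    "3 \<le> n \<Longrightarrow> concat (map corner_pieces (lower_list n)) = lower_list (Suc n)"
    by (auto simp: upper_list_def lower_list_def)
qed

text \<open>The decomposed halves of the seventh star are the reversed opposite halves of the sixth one.\<close>

lemma list_step_7:
  "concat (map corner_pieces (upper_list 7)) = rev (map (\<lambda>(k, x). (k, swap_corner x)) (lower_list 6))"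
  "concat (map corner_pieces (lower_list 7)) = rev (map (\<lambda>(k, x). (k, swap_corner x)) (upper_list 6))"
  by (simp_all add: upper_list_def lower_list_def)

definition upper_dir :: "nat \<Rightarrow> nat \<Rightarrow> complex \<Rightarrow> complex \<Rightarrow> decor" where
  "upper_dir n = legal_dir ((n + 1) mod 4, (n + 2) mod 4, (n + 3) mod 4)"

definition lower_dir :: "nat \<Rightarrow> nat \<Rightarrow> complex \<Rightarrow> complex \<Rightarrow> decor" where
  "lower_dir n = legal_dir ((n + 3) mod 4, n mod 4, (n + 1) mod 4)"

text \<open>All labels of a legal star are its number plus a constant, and the decomposition adds 1 to them.\<close>

lemma upper_dir_Suc: "upper_dir (Suc n) ((l + 1) mod 4) w z = relabel (upper_dir n l w z)"
  unfolding upper_dir_def legal_dir_relabel[symmetric] by (simp add: mod_simps)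

lemma lower_dir_Suc: "lower_dir (Suc n) ((l + 1) mod 4) w z = relabel (lower_dir n l w z)"
  unfolding lower_dir_def legal_dir_relabel[symmetric] by (simp add: mod_simps)

definition upper_part :: "nat \<Rightarrow> nat \<Rightarrow> complex \<Rightarrow> partial_tile set" where
  "upper_part n l w =
     (\<lambda>t. (t, legal_decor ((n + 1) mod 4, (n + 2) mod 4, (n + 3) mod 4) l w t)) ` upper_tiles n"

definition lower_part :: "nat \<Rightarrow> nat \<Rightarrow> complex \<Rightarrow> partial_tile set" where
  "lower_part n l w =
     (\<lambda>t. (t, legal_decor ((n + 3) mod 4, n mod 4, (n + 1) mod 4) l w t)) ` lower_tiles n"

lemma legal_star_parts: "legal_star n l w = (0, upper_part n l w \<union> lower_part n l w)"
  by (simp add: legal_star_def upper_part_def lower_part_def)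

lemma upper_part_fan: "upper_part n l w = decorate (upper_dir n l w) ` fan (- 1) (upper_list n)"
proof -
  have "(t, legal_decor tr l w t) = decorate (legal_dir tr l w) t" if "t \<in> fan (- 1) (upper_list n)" for t tr
    using is_tile_fan[OF _ that] vertex_fan[OF that] by (simp add: legal_decor_decorate)
  then show ?thesis unfolding upper_part_def upper_tiles_list upper_dir_def by (intro image_cong) auto
qed

lemma lower_part_fan:
  assumes "n \<noteq> 1" "n \<noteq> 2" "w \<in> {1, -1}"
  shows "lower_part n l w = map_ptile cnj ` decorate (lower_dir n l w) ` fan (- 1) (lower_list n)"
proof -
  have "(map_tile cnj t, legal_decor tr l w (map_tile cnj t)) = map_ptile cnj (decorate (legal_dir tr l w) t)"
    if t: "t \<in> fan (- 1) (lower_list n)" for t tr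
  proof -
    have "is_tile (map_tile cnj t)" "0 \<in> vertices (map_tile cnj t)"
      using is_tile_map_tile[OF isometry_cnj is_tile_fan[OF _ t]] vertex_fan[OF t]
      by (force simp: vertices_map_tile)+
    moreover have "legal_dir tr l w (cnj z) = map_decor cnj (legal_dir tr l w z)" for z
      using legal_dir_map[of cnj tr l w z] assms(3) by auto
    ultimately show ?thesis
      by (simp add: legal_decor_decorate decorate_map[OF isometry_cnj])
  qed
  then show ?thesis unfolding lower_part_def lower_tiles_list[OF assms(1,2)] lower_dir_def image_image
    by (intro image_cong) auto
qed

lemma unit_vectors: "cmod (cis a) = 1" "cmod (- cis a) = 1" "cmod (\<i> * cis a) = 1"
  by (simp_all add: norm_mult)

text \<open>Only the upper halves of the first two stars contain right angles of large tiles. The altitudes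
  drawn there lie at the larger and at the smaller acute angle with the axis, respectively, and in the
  next star, with number 2 or 3, sides at that angle have label \<open>2 + 2\<close> or \<open>3 + 1\<close>, which is 0 modulo 4.\<close>

lemma evolve_upper_part:
  assumes n: "n \<in> {1..6}"
  shows "evolve (upper_part n l w) = upper_part (Suc n) ((l + 1) mod 4) w"
  unfolding upper_part_fan list_step(1)[OF n, symmetric]
proof (rule evolve_fan)
  fix z assume z: "z \<in> altitude_rays (- 1) (upper_list n)"
  have "n = 1 \<or> n = 2 \<or> n = 3 \<or> n = 4 \<or> n = 5 \<or> n = 6" using n by auto
  \<comment> \<open>The right angles that are divided start at the rays \<open>- 1\<close> and \<open>\<i>\<close>.\<close>
  then have "n = 1 \<and> z = - cis (- large_angle) \<or> n = 2 \<and> z = \<i> * cis (- large_angle)"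
    using z cis_corner_mult by (auto simp: upper_list_def cis_corner(3) mult.commute)
  then show "upper_dir (Suc n) ((l + 1) mod 4) w z = (0, - z)"
  proof
    assume "n = 1 \<and> z = - cis (- large_angle)"
    moreover from this have "\<bar>Im z\<bar> = phi" using phi_pos by (simp add: cis_corner)
    ultimately show ?thesis
      by (simp add: upper_dir_def legal_dir_large unit_vectors)
  next
    assume "n = 2 \<and> z = \<i> * cis (- large_angle)"
    moreover from this have "\<bar>Im z\<bar> = phi\<^sup>2" by (simp add: cis_corner)
    ultimately show ?thesis
      by (simp add: upper_dir_def legal_dir_small unit_vectors)
  qed
qed (simp_all only: upper_dir_Suc, simp)

text \<open>Right angles of large tiles occur in the lower halves of the third and the fourth star. The
  altitudes drawn there lie at the larger and at the smaller acute angle with the axis, where the next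
  star, with number 4 or 5, prescribes the labels \<open>4\<close> and \<open>5 - 1\<close>, which are 0 modulo 4.\<close>

lemma evolve_lower_part:
  assumes n: "n \<in> {3..6}" and w: "w \<in> {1, -1}"
  shows "evolve (lower_part n l w) = lower_part (Suc n) ((l + 1) mod 4) w"
proof -
  have n': "n \<noteq> 1" "n \<noteq> 2" "Suc n \<noteq> 1" "Suc n \<noteq> 2" "n \<in> {1..6}" "3 \<le> n" using n by auto
  have "evolve (decorate (lower_dir n l w) ` fan (- 1) (lower_list n)) =
     decorate (lower_dir (Suc n) ((l + 1) mod 4) w) ` fan (- 1) (concat (map corner_pieces (lower_list n)))"
  proof (rule evolve_fan)
    fix z assume z: "z \<in> altitude_rays (- 1) (lower_list n)"
    have "n = 3 \<or> n = 4 \<or> n = 5 \<or> n = 6" using n by auto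
    then have "n = 3 \<and> z = \<i> * cis (- small_angle) \<or> n = 4 \<and> z = - cis (- small_angle)"
      using z by (auto simp: lower_list_def cis_corner(3))
    then show "lower_dir (Suc n) ((l + 1) mod 4) w z = (0, - z)"
    proof
      assume "n = 3 \<and> z = \<i> * cis (- small_angle)"
      moreover from this have "\<bar>Im z\<bar> = phi" using phi_pos by (simp add: cis_corner)
      ultimately show ?thesis
        by (simp add: lower_dir_def legal_dir_large unit_vectors)
    next
      assume "n = 4 \<and> z = - cis (- small_angle)"
      moreover from this have "\<bar>Im z\<bar> = phi\<^sup>2" by (simp add: cis_corner)
      ultimately show ?thesis
        by (simp add: lower_dir_def legal_dir_small unit_vectors)
    qed
  qed (simp_all only: lower_dir_Suc, simp)
  then show ?thesis
    unfolding lower_part_fan[OF n'(1,2) w] lower_part_fan[OF n'(3,4) w]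
    by (simp add: evolve_isometry[OF isometry_cnj] list_step(2)[OF n'(5,6)])
qed

lemma fan_half_turn:
  assumes "(\<Prod>(k, x)\<leftarrow>ts. cis (- corner_angle x)) = - 1"
    and D: "\<And>z. D' (- cnj z) = map_decor (\<lambda>z. - cnj z) (D z)"
  shows "decorate D' ` fan (- 1) (rev (map (\<lambda>(k, x). (k, swap_corner x)) ts)) =
    map_ptile (\<lambda>z. - cnj z) ` decorate D ` fan (- 1) ts"
  using reflect_fan[of "- 1" ts, symmetric] assms(1)
  by (simp add: image_image decorate_map[where g = "\<lambda>z. - cnj z" and D' = D' and D = D, OF isometry_reflect _ D])

text \<open>The half-turn exchanges the two halves and the direction of the axis. The labels agree because the
  upper labels of a star with number 8 are the lower labels of the sixth star modulo 4, and vice versa.\<close>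

lemma evolve_7:
  assumes w: "w \<in> {1, -1}"
  shows "evolve (upper_part 7 l w \<union> lower_part 7 l w) =
    map_ptile uminus ` (upper_part 6 ((l + 1) mod 4) (- w) \<union> lower_part 6 ((l + 1) mod 4) (- w))"
proof -
  let ?l = "(l + 1) mod 4"
  have w': "- w \<in> {1, -1}" using w by auto
  have prod: "(\<Prod>(k, x)\<leftarrow>lower_list 6. cis (- corner_angle x)) = - 1"
    "(\<Prod>(k, x)\<leftarrow>upper_list 6. cis (- corner_angle x)) = - 1"
  proof -
    have c: "cis (- small_angle) * cis (- large_angle) = - \<i>" "cis (- large_angle) * cis (- small_angle) = - \<i>"
      using cis_corner_mult by (simp_all add: cis_corner(3) mult.commute)
    have "cis (- small_angle) * (cis (- large_angle) * z) = - \<i> * z"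
      "cis (- large_angle) * (cis (- small_angle) * z) = - \<i> * z" for z
      by (simp_all only: mult.assoc[symmetric] c)
    then show "(\<Prod>(k, x)\<leftarrow>lower_list 6. cis (- corner_angle x)) = - 1"
      "(\<Prod>(k, x)\<leftarrow>upper_list 6. cis (- corner_angle x)) = - 1"
      using cis_corner_mult by (simp_all add: upper_list_def lower_list_def cis_corner(3) mult.commute)
  qed
  have wr: "- cnj (- w) = w" using w by auto
  have dir: "upper_dir 8 ?l w (- cnj z) = map_decor (\<lambda>z. - cnj z) (lower_dir 6 ?l (- w) z)"
    "lower_dir 8 ?l w (- cnj z) = map_decor (\<lambda>z. - cnj z) (upper_dir 6 ?l (- w) z)" for z
    using legal_dir_map[of "\<lambda>z. - cnj z" _ ?l "- w" z] wr
    by (simp_all add: upper_dir_def lower_dir_def)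
  have S: "Suc 7 = 8" by simp
  have "evolve (upper_part 7 l w) = decorate (upper_dir 8 ?l w) ` fan (- 1) (concat (map corner_pieces (upper_list 7)))"
    unfolding upper_part_fan
    by (rule evolve_fan) (use upper_dir_Suc[of 7 l w, unfolded S] in \<open>simp_all add: upper_list_def\<close>)
  also have "\<dots> = map_ptile (\<lambda>z. - cnj z) ` decorate (lower_dir 6 ?l (- w)) ` fan (- 1) (lower_list 6)"
    unfolding list_step_7 by (rule fan_half_turn) (rule prod(1), rule dir(1))
  also have "\<dots> = map_ptile uminus ` lower_part 6 ?l (- w)"
    using lower_part_fan[OF _ _ w', of 6 ?l] by (simp add: image_image map_ptile_comp[OF isometry_uminus])
  finally have 1: "evolve (upper_part 7 l w) = map_ptile uminus ` lower_part 6 ?l (- w)" .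
  have "evolve (lower_part 7 l w) = map_ptile cnj ` evolve (decorate (lower_dir 7 l w) ` fan (- 1) (lower_list 7))"
    using lower_part_fan[OF _ _ w, of 7 l] by (simp add: evolve_isometry[OF isometry_cnj])
  also have "evolve (decorate (lower_dir 7 l w) ` fan (- 1) (lower_list 7)) =
      decorate (lower_dir 8 ?l w) ` fan (- 1) (concat (map corner_pieces (lower_list 7)))"
    by (rule evolve_fan) (use lower_dir_Suc[of 7 l w, unfolded S] in \<open>simp_all add: lower_list_def\<close>)
  also have "\<dots> = map_ptile (\<lambda>z. - cnj z) ` decorate (upper_dir 6 ?l (- w)) ` fan (- 1) (upper_list 6)"
    unfolding list_step_7 by (rule fan_half_turn) (rule prod(2), rule dir(2))
  also have "map_ptile cnj ` \<dots> = map_ptile uminus ` upper_part 6 ?l (- w)"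
    unfolding upper_part_fan by (simp add: image_image map_ptile_comp[OF isometry_cnj])
  finally show ?thesis using 1 by (simp add: evolve_Un image_Un Un_commute)
qed

definition only :: "side \<Rightarrow> decor \<Rightarrow> side \<Rightarrow> decor option" where
  "only s u = (\<lambda>s'. if s' = s then Some u else None)"

text \<open>The lower tiles of the first two stars: the center lies inside the large leg of the one and is the
  altitude foot of the other.\<close>

definition leg_tile :: tile where
  "leg_tile = Tile Large (complex_of_real (- (phi ^ 5))) (complex_of_real (phi ^ 3))
     (Complex (- (phi ^ 5)) (- (phi ^ 2)))"

definition hyp_tile :: tile where
  "hyp_tile = Tile Large (Complex 0 (- (phi ^ 3))) (complex_of_real (phi ^ 2))
     (complex_of_real (- (phi ^ 4)))"

text \<open>The two halves of a rectangle whose diagonal lies on the real axis; \<open>0\<close> is the altitude foot of the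
  upper half.\<close>

definition upper_half :: tile where
  "upper_half = Tile Large (Complex 0 (phi ^ 3)) (complex_of_real (- (phi ^ 2)))
     (complex_of_real (phi ^ 4))"

definition lower_half :: tile where
  "lower_half = Tile Large (Complex (- (phi ^ 6)) (- (phi ^ 3))) (complex_of_real (phi ^ 4))
     (complex_of_real (- (phi ^ 2)))"

definition rectangle_set :: "nat \<Rightarrow> complex \<Rightarrow> partial_tile set" where
  "rectangle_set l w = {(upper_half, only Hyp (l, w)), (lower_half, only Hyp (l, w))}"

lemma zero_in_real_segment:
  assumes "a \<le> 0 \<and> 0 \<le> b \<or> b \<le> 0 \<and> 0 \<le> a"
  shows "0 \<in> closed_segment (complex_of_real a) (complex_of_real b)"
proof -
  have "0 \<in> closed_segment a b"
    using assms by (auto simp: closed_segment_eq_real_ivl)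
  then have "complex_of_real 0 \<in> closed_segment (complex_of_real a) (complex_of_real b)"
    unfolding closed_segment_of_real by (rule imageI)
  then show ?thesis by simp
qed

lemma real_segment_subset: "closed_segment (complex_of_real a) (complex_of_real b) \<subseteq> \<real>"
  by (auto simp: closed_segment_of_real)

lemma zero_notin_segment:
  assumes "Im p = 0" "p \<noteq> 0" "Im q \<noteq> 0"
  shows "0 \<notin> closed_segment p q" "0 \<notin> closed_segment q p"
proof -
  have "0 \<notin> closed_segment p q"
  proof
    assume "0 \<in> closed_segment p q"
    then obtain u where "0 = (1 - u) *\<^sub>R p + u *\<^sub>R q" by (auto simp: in_segment)
    moreover from this have "u = 0" using assms(1,3) by (auto simp: complex_eq_iff)
    ultimately show False using assms(2) by simp
  qed
  then show "0 \<notin> closed_segment p q" "0 \<notin> closed_segment q p"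
    by (simp_all add: closed_segment_commute)
qed

text \<open>The half-plane below the line of slope \<open>-1\<close> through \<open>0\<close> separates \<open>0\<close> from the pieces that are
  dropped below.\<close>

lemma zero_notin_region_halfplane:
  assumes "\<forall>v\<in>{vR t, vS t, vL t}. Re v + Im v < 0"
  shows "0 \<notin> region t"
proof -
  have "{z. Re z + Im z < 0} = {z. (1 + \<i>) \<bullet> z < 0}" by (simp add: inner_complex_def)
  then have "convex {z. Re z + Im z < 0}" by (simp only: convex_halfspace_lt)
  then have "region t \<subseteq> {z. Re z + Im z < 0}"
    unfolding region_def vertices_def using assms by (intro hull_minimal) auto
  then show ?thesis by auto
qed

lemma evolve_single:
  "evolve {(t, e)} = (\<lambda>y. scale_ptile enlarge (y, restrict_decor 0 y (partial_piece_decor t e y)))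
     ` {y \<in> pieces t. 0 \<in> region y}"
  unfolding evolve_def cut_star_def by auto

lemma legal_decor_only:
  assumes "side_set t s0 \<subseteq> \<real>" "\<And>s. 0 \<in> side_set t s \<longleftrightarrow> s = s0"
  shows "legal_decor tr l w t = only s0 (l, w)"
  using assms by (cases tr) (auto simp: legal_decor_def only_def fun_eq_iff)

lemma lower_part_1: "lower_part 1 l w = {(leg_tile, only BigLeg (l, w))}"
proof -
  have "0 \<in> side_set leg_tile s \<longleftrightarrow> s = BigLeg" for s
    using phi_pos zero_in_real_segment[of "- (phi ^ 5)" "phi ^ 3"] unfolding side_set_def leg_tile_def
    by (cases s) (simp_all del: of_real_power of_real_minus add: zero_notin_segment)
  moreover have "side_set leg_tile BigLeg \<subseteq> \<real>"
    unfolding side_set_def leg_tile_def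
    by (simp del: of_real_power of_real_minus add: real_segment_subset)
  ultimately have "legal_decor tr l w leg_tile = only BigLeg (l, w)" for tr
    by (intro legal_decor_only)
  then show ?thesis by (simp add: lower_part_def lower_tiles_def leg_tile_def)
qed

lemma lower_part_2: "lower_part 2 l w = {(hyp_tile, only Hyp (l, w))}"
proof -
  have "0 \<in> side_set hyp_tile s \<longleftrightarrow> s = Hyp" for s
    using phi_pos zero_in_real_segment[of "phi\<^sup>2" "- (phi ^ 4)"] unfolding side_set_def hyp_tile_def
    by (cases s) (simp_all del: of_real_power of_real_minus add: zero_notin_segment)
  moreover have "side_set hyp_tile Hyp \<subseteq> \<real>"
    unfolding side_set_def hyp_tile_def
    by (simp del: of_real_power of_real_minus add: real_segment_subset)
  ultimately have "legal_decor tr l w hyp_tile = only Hyp (l, w)" for tr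
    by (intro legal_decor_only)
  then show ?thesis by (simp add: lower_part_def lower_tiles_def hyp_tile_def)
qed

text \<open>If the center lies inside a side of a tile and, after the cut, inside a side of one piece only, the
  decoration of the former side is inherited by the latter.\<close>

lemma evolve_only:
  assumes "pieces t = {A, B}" "0 \<notin> region B" "\<And>s. 0 \<in> side_set A s \<longleftrightarrow> s = s'"
    "parent_side (kind t) (kind A) s' = Some s0"
  shows "evolve {(t, only s0 (l, w))} = {(map_tile enlarge A, only s' ((l + 1) mod 4, w))}"
proof -
  have "0 \<in> region A" using assms(3) side_set_subset_region by blast
  then have "{y \<in> pieces t. 0 \<in> region y} = {A}" using assms(1,2) by auto
  moreover have "restrict_decor 0 A (partial_piece_decor t (only s0 (l, w)) A) = only s' ((l + 1) mod 4, w)"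
    by (auto simp: fun_eq_iff restrict_decor_def partial_piece_decor_def assms(3,4) only_def relabel_def)
  ultimately show ?thesis by (simp add: evolve_single scale_ptile_def)
qed

lemma evolve_leg_tile:
  "evolve {(leg_tile, only BigLeg (l, w))} = {(hyp_tile, only Hyp ((l + 1) mod 4, w))}"
proof -
  define A where "A = Tile Large (Complex 0 (- (phi ^ 4))) (complex_of_real (phi ^ 3)) (complex_of_real (- (phi ^ 5)))"
  define B where "B = Tile Small (Complex 0 (- (phi ^ 4))) (complex_of_real (- (phi ^ 5))) (Complex (- (phi ^ 5)) (- (phi ^ 2)))"
  have f: "foot leg_tile = Complex 0 (- (phi ^ 4))"
    by (simp add: foot_def leg_tile_def complex_eq_iff power_numeral_reduce)
  have "- (phi ^ 5) < phi ^ 2"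
    using zero_less_power[OF phi_pos, of 5] zero_less_power[OF phi_pos, of 2] by linarith
  then have B: "0 \<notin> region B"
    using phi_pos by (intro zero_notin_region_halfplane) (simp add: B_def add_pos_pos)
  have A: "0 \<in> side_set A s \<longleftrightarrow> s = Hyp" for s
    using phi_pos zero_in_real_segment[of "phi ^ 3" "- (phi ^ 5)"] unfolding side_set_def A_def
    by (cases s) (simp_all del: of_real_power of_real_minus add: zero_notin_segment)
  have "map_tile enlarge A = hyp_tile"
    by (simp add: A_def hyp_tile_def enlarge_def complex_eq_iff power_numeral_reduce)
  moreover have "pieces leg_tile = {A, B}" by (simp add: pieces_def f A_def B_def) (simp add: leg_tile_def)
  ultimately show ?thesis using evolve_only[OF _ B A, of leg_tile BigLeg l w] by (simp add: leg_tile_def A_def)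
qed

lemma evolve_lower_half:
  "evolve {(lower_half, only Hyp (l, w))} = {(leg_tile, only BigLeg ((l + 1) mod 4, w))}"
proof -
  define A where "A = Tile Large (complex_of_real (- (phi ^ 6))) (complex_of_real (phi ^ 4)) (Complex (- (phi ^ 6)) (- (phi ^ 3)))"
  define B where "B = Tile Small (complex_of_real (- (phi ^ 6))) (Complex (- (phi ^ 6)) (- (phi ^ 3))) (complex_of_real (- (phi ^ 2)))"
  have f: "foot lower_half = complex_of_real (- (phi ^ 6))"
    by (simp add: foot_def lower_half_def complex_eq_iff power_numeral_reduce phi_reduce algebra_simps)
  have "- (phi ^ 6) < phi ^ 3"
    using zero_less_power[OF phi_pos, of 6] zero_less_power[OF phi_pos, of 3] by linarith
  then have B: "0 \<notin> region B"
    using phi_pos by (intro zero_notin_region_halfplane) (simp add: B_def add_pos_pos)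
  have A: "0 \<in> side_set A s \<longleftrightarrow> s = BigLeg" for s
    using phi_pos zero_in_real_segment[of "- (phi ^ 6)" "phi ^ 4"] unfolding side_set_def A_def
    by (cases s) (simp_all del: of_real_power of_real_minus add: zero_notin_segment)
  have "map_tile enlarge A = leg_tile"
    by (simp add: A_def leg_tile_def enlarge_def complex_eq_iff power_numeral_reduce)
  moreover have "pieces lower_half = {A, B}" by (simp add: pieces_def f A_def B_def) (simp add: lower_half_def)
  ultimately show ?thesis using evolve_only[OF _ B A, of lower_half Hyp l w] by (simp add: lower_half_def A_def)
qed

definition right_angle_decor :: "decor \<Rightarrow> decor \<Rightarrow> side \<Rightarrow> decor option" where
  "right_angle_decor u v = (\<lambda>s. case s of Hyp \<Rightarrow> None | BigLeg \<Rightarrow> Some u | SmallLeg \<Rightarrow> Some v)"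

lemma decorate_right_angle:
  assumes "is_tile (Tile k 0 p q)"
  shows "decorate D (Tile k 0 p q) = (Tile k 0 p q, right_angle_decor (D (sgn p)) (D (sgn q)))"
proof -
  have "0 \<in> side_set (Tile k 0 p q) s \<longleftrightarrow> s \<noteq> Hyp" for s
    using vertex_in_side(1)[OF is_tile_nondeg[OF assms], of s] by simp
  then show ?thesis
    by (auto simp: decorate_def right_angle_decor_def far_end_def fun_eq_iff split: side.splits)
qed

lemma legal_dir_real: "u \<in> \<real> \<Longrightarrow> legal_dir tr l w u = (l, w)"
  by (cases tr) (simp add: legal_dir_def)

text \<open>The two pairs of tiles that arise when an altitude is drawn from the center, with the perpendicular
  ray decorated like an altitude.\<close>

lemma right_angle_tiles:
  "upper_part 1 l w =
    {(Tile Large 0 (- phi *\<^sub>R 1) (phi\<^sup>2 *\<^sub>R \<i>), right_angle_decor (l, w) (0, \<i>)),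
     (Tile Small 0 (phi\<^sup>2 *\<^sub>R \<i>) (phi ^ 3 *\<^sub>R 1), right_angle_decor (0, \<i>) (l, w))}"
  "w \<in> {1, -1} \<Longrightarrow> lower_part 3 l w =
    {(Tile Small 0 (- phi\<^sup>2 *\<^sub>R \<i>) (- (phi ^ 3) *\<^sub>R 1), right_angle_decor (0, - \<i>) (l, w)),
     (Tile Large 0 (phi *\<^sub>R 1) (- phi\<^sup>2 *\<^sub>R \<i>), right_angle_decor (l, w) (0, - \<i>))}"
proof -
  have t: "is_tile (fan_tile (- 1) k x)" "is_tile (fan_tile \<i> k x)" for k x
    by (rule is_tile_fan_tile; simp)+
  have sg: "sgn (phi *\<^sub>R (z::complex)) = sgn z" "sgn (phi\<^sup>2 *\<^sub>R z) = sgn z" "sgn (phi ^ 3 *\<^sub>R z) = sgn z" for z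
    using phi_pos by (simp_all add: sgn_scaleR_pos)
  have si: "sgn \<i> = \<i>" by (simp add: sgn_div_norm)
  have fans: "fan_tile (- 1) Large BA = Tile Large 0 (- phi *\<^sub>R 1) (phi\<^sup>2 *\<^sub>R \<i>)"
    "fan_tile \<i> Small BA = Tile Small 0 (phi\<^sup>2 *\<^sub>R \<i>) (phi ^ 3 *\<^sub>R 1)"
    "fan_tile (- 1) Small AB = Tile Small 0 (phi\<^sup>2 *\<^sub>R \<i>) (- (phi ^ 3) *\<^sub>R 1)"
    "fan_tile \<i> Large AB = Tile Large 0 (phi *\<^sub>R 1) (phi\<^sup>2 *\<^sub>R \<i>)"
    by (simp_all add: fan_tile_def cis_corner(3))
  note d = decorate_right_angle[OF t(1)[of Large BA, unfolded fans]]
    decorate_right_angle[OF t(2)[of Small BA, unfolded fans]]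
    decorate_right_angle[OF t(1)[of Small AB, unfolded fans]]
    decorate_right_angle[OF t(2)[of Large AB, unfolded fans]]
  show "upper_part 1 l w =
    {(Tile Large 0 (- phi *\<^sub>R 1) (phi\<^sup>2 *\<^sub>R \<i>), right_angle_decor (l, w) (0, \<i>)),
     (Tile Small 0 (phi\<^sup>2 *\<^sub>R \<i>) (phi ^ 3 *\<^sub>R 1), right_angle_decor (0, \<i>) (l, w))}"
    unfolding upper_part_fan
    by (simp add: upper_list_def cis_corner(3) fans[simplified] d[simplified] sg sgn_minus si upper_dir_def
        legal_dir_perpendicular legal_dir_real)
  have mp: "map_ptile cnj (t, right_angle_decor (a, u) (b, v)) = (map_tile cnj t, right_angle_decor (a, cnj u) (b, cnj v))"
    for t a u b v
    by (auto simp: map_ptile_def right_angle_decor_def map_decor_def fun_eq_iff split: side.splits)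
  assume w: "w \<in> {1, -1}"
  then have "cnj w = w" by auto
  then show "lower_part 3 l w =
    {(Tile Small 0 (- phi\<^sup>2 *\<^sub>R \<i>) (- (phi ^ 3) *\<^sub>R 1), right_angle_decor (0, - \<i>) (l, w)),
     (Tile Large 0 (phi *\<^sub>R 1) (- phi\<^sup>2 *\<^sub>R \<i>), right_angle_decor (l, w) (0, - \<i>))}"
    using lower_part_fan[OF _ _ w, of 3]
    by (simp add: lower_list_def cis_corner(3) fans[simplified] d[simplified] sg sgn_minus si lower_dir_def
        legal_dir_perpendicular legal_dir_real mp)
qed

lemma evolve_hyp_tile:
  assumes w: "w \<in> {1, -1}"
  shows "evolve {(hyp_tile, only Hyp (l, w))} = lower_part 3 ((l + 1) mod 4) w"
proof -
  define A where "A = Tile Large 0 (complex_of_real (phi\<^sup>2)) (Complex 0 (- (phi ^ 3)))"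
  define B where "B = Tile Small 0 (Complex 0 (- (phi ^ 3))) (complex_of_real (- (phi ^ 4)))"
  have f: "foot hyp_tile = 0"
    by (simp add: foot_def hyp_tile_def complex_eq_iff power_numeral_reduce)
  have p: "pieces hyp_tile = {A, B}" by (simp add: pieces_def f A_def B_def) (simp add: hyp_tile_def)
  have "0 \<in> side_set A BigLeg" "0 \<in> side_set A SmallLeg" "0 \<in> side_set B BigLeg" "0 \<in> side_set B SmallLeg"
    "0 \<notin> side_set A Hyp" "0 \<notin> side_set B Hyp"
    using phi_pos unfolding side_set_def A_def B_def
    by (simp_all del: of_real_power of_real_minus add: zero_notin_segment)
  moreover have "altitude_decor hyp_tile = (0, - \<i>)"
  proof -
    have "Complex 0 (- (phi ^ 3)) = phi ^ 3 *\<^sub>R (- \<i>)" by (simp add: complex_eq_iff)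
    then have "sgn (Complex 0 (- (phi ^ 3))) = sgn (- \<i>)"
      using phi_pos sgn_scaleR_pos[of "phi ^ 3" "- \<i>"] by simp
    then show ?thesis by (simp add: altitude_decor_def f sgn_div_norm) (simp add: hyp_tile_def)
  qed
  moreover have k: "kind hyp_tile = Large" "kind A = Large" "kind B = Small"
    by (simp_all add: hyp_tile_def A_def B_def)
  ultimately have e: "restrict_decor 0 A (partial_piece_decor hyp_tile (only Hyp (l, w)) A) =
      right_angle_decor ((l + 1) mod 4, w) (0, - \<i>)"
    "restrict_decor 0 B (partial_piece_decor hyp_tile (only Hyp (l, w)) B) =
      right_angle_decor (0, - \<i>) ((l + 1) mod 4, w)"
    by (auto simp: restrict_decor_def partial_piece_decor_def only_def relabel_def
        right_angle_decor_def fun_eq_iff split: side.splits)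
  have "{y \<in> pieces hyp_tile. 0 \<in> region y} = {A, B}"
    using vertex_in_region(1)[of A] vertex_in_region(1)[of B] unfolding p A_def B_def by auto
  moreover have "map_tile enlarge A = Tile Large 0 (phi *\<^sub>R 1) (- phi\<^sup>2 *\<^sub>R \<i>)"
    "map_tile enlarge B = Tile Small 0 (- phi\<^sup>2 *\<^sub>R \<i>) (- (phi ^ 3) *\<^sub>R 1)"
    by (simp_all add: A_def B_def enlarge_def complex_eq_iff power_numeral_reduce)
  ultimately show ?thesis
    unfolding evolve_single right_angle_tiles(2)[OF w]
    by (simp add: scale_ptile_def e insert_commute)
qed

text \<open>The half-turn takes the lower tile of the second star to the upper half of the rectangle and the
  lower half of the third star to the upper half of the first one.\<close>

lemma evolve_upper_half:
  assumes w: "w \<in> {1, -1}"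
  shows "evolve {(upper_half, only Hyp (l, w))} = upper_part 1 ((l + 1) mod 4) w"
proof -
  have w': "- w \<in> {1, -1}" using w by auto
  have "map_ptile uminus (hyp_tile, only Hyp (l, - w)) = (upper_half, only Hyp (l, w))"
    by (auto simp: map_ptile_def hyp_tile_def upper_half_def only_def map_decor_def complex_eq_iff fun_eq_iff)
  then have "evolve {(upper_half, only Hyp (l, w))} = map_ptile uminus ` lower_part 3 ((l + 1) mod 4) (- w)"
    using evolve_isometry[OF isometry_uminus, of "{(hyp_tile, only Hyp (l, - w))}"] evolve_hyp_tile[OF w', of l]
    by simp
  moreover have mp: "map_ptile uminus (t, right_angle_decor (a, u) (b, v)) =
      (map_tile uminus t, right_angle_decor (a, - u) (b, - v))" for t a u b v
    by (auto simp: map_ptile_def right_angle_decor_def map_decor_def fun_eq_iff split: side.splits)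
  ultimately show ?thesis
    unfolding right_angle_tiles(1) right_angle_tiles(2)[OF w'] by (simp add: mp insert_commute)
qed

definition legal_set :: "nat \<Rightarrow> nat \<Rightarrow> complex \<Rightarrow> partial_tile set" where
  "legal_set n l w = upper_part n l w \<union> lower_part n l w"

lemma legal_star_set: "legal_star n l w = (0, legal_set n l w)"
  by (simp add: legal_star_parts legal_set_def)

text \<open>The altitude drawn from \<open>0\<close> cuts the upper half into the upper tiles of the first star. In the lower
  half \<open>0\<close> is not the altitude foot; the large piece through \<open>0\<close> is the lower tile of the first star.\<close>

lemma evolve_rectangle:
  "w \<in> {1, -1} \<Longrightarrow> evolve (rectangle_set l w) = legal_set 1 ((l + 1) mod 4) w"
  using evolve_Un[of "{(upper_half, only Hyp (l, w))}" "{(lower_half, only Hyp (l, w))}"]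
  by (simp add: rectangle_set_def legal_set_def evolve_upper_half evolve_lower_half lower_part_1
      insert_commute Un_commute del: One_nat_def)

lemma evolve_legal_Suc:
  assumes "n \<in> {1..6}" "w \<in> {1, -1}"
  shows "evolve (legal_set n l w) = legal_set (Suc n) ((l + 1) mod 4) w"
proof -
  consider "n = 1" | "n = 2" | "n \<in> {3..6}" using assms(1) by fastforce
  then have "evolve (lower_part n l w) = lower_part (Suc n) ((l + 1) mod 4) w"
  proof cases
    case 1
    have "Suc 1 = 2" by simp
    then show ?thesis unfolding 1 using evolve_leg_tile lower_part_1 lower_part_2 by (simp only:)
  next
    case 2
    have "Suc 2 = 3" by simp
    then show ?thesis unfolding 2 using evolve_hyp_tile[OF assms(2)] lower_part_2 by (simp only:)
  next
    case 3
    then show ?thesis by (rule evolve_lower_part[OF _ assms(2)])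
  qed
  then show ?thesis
    by (simp add: legal_set_def evolve_Un evolve_upper_part[OF assms(1)])
qed

lemma evolve_legal:
  assumes n: "n \<in> {1..7}" "w \<in> {1, -1}"
  obtains n' w' g where "n' \<in> {1..7}" "w' \<in> {1, -1}" "isometry g" "g 0 = 0" "[n' = n + 1] (mod 2)"
    "evolve (legal_set n l w) = map_ptile g ` legal_set n' ((l + 1) mod 4) w'"
proof (cases "n = 7")
  case True
  have "evolve (legal_set n l w) = map_ptile uminus ` legal_set 6 ((l + 1) mod 4) (- w)"
    using evolve_7[OF n(2)] True by (simp add: legal_set_def)
  moreover have "- w \<in> {1, -1}" using n(2) by auto
  ultimately show ?thesis
    using that[of 6 "- w" uminus] isometry_uminus True by (simp add: cong_def)
next
  case False
  then have "n \<in> {1..6}" using n(1) by auto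
  then have "evolve (legal_set n l w) = map_ptile (\<lambda>z. z) ` legal_set (Suc n) ((l + 1) mod 4) w"
    using evolve_legal_Suc n(2) by (simp add: map_ptile_id)
  then show ?thesis
    using that[of "Suc n" w "\<lambda>z. z"] isometry_id \<open>n \<in> {1..6}\<close> n(2) by auto
qed

section \<open>Tilings whose stars are legal\<close>

definition legal_tiles :: "nat \<Rightarrow> tile set" where
  "legal_tiles n = upper_tiles n \<union> lower_tiles n"

definition tiles_at :: "colored_tile set \<Rightarrow> complex \<Rightarrow> tile set" where
  "tiles_at T A = {t. \<exists>d. (t, d) \<in> T \<and> A \<in> region t}"

text \<open>The uncolored part of legality. Inclusion instead of equality allows incomplete stars at the
  boundary of a supertile.\<close>

definition vertex_figures_legal :: "colored_tile set \<Rightarrow> bool" where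
  "vertex_figures_legal T \<longleftrightarrow> (\<forall>A. star_vertex T A \<longrightarrow>
     (\<exists>n f. n \<in> {1..7} \<and> isometry f \<and> f 0 = A \<and> tiles_at T A \<subseteq> map_tile f ` legal_tiles n))"

text \<open>Legality apart from completeness.\<close>

definition copy_of_legal :: "star \<Rightarrow> bool" where
  "copy_of_legal S \<longleftrightarrow> (\<exists>n l w f. n \<in> {1..7} \<and> l < 4 \<and> [l = n] (mod 2) \<and> w \<in> {1, - 1} \<and>
     isometry f \<and> S = map_star f (legal_star n l w))"

definition complete_stars_legal :: "colored_tile set \<Rightarrow> bool" where
  "complete_stars_legal T \<longleftrightarrow>
     (\<forall>A. star_vertex T A \<and> complete_star (star_at T A) \<longrightarrow> copy_of_legal (star_at T A))"

lemma legal_iff: "legal S \<longleftrightarrow> complete_star S \<and> copy_of_legal S"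
  unfolding legal_def copy_of_legal_def congruent_stars_def by blast

lemma L_tiling_iff: "L_tiling T \<longleftrightarrow> colored_tiling T \<and> matching T \<and> complete_stars_legal T"
  unfolding L_tiling_def complete_stars_legal_def legal_iff by blast

lemma fst_map_ptile: "fst (map_ptile f x) = map_tile f (fst x)"
  by (simp add: map_ptile_def case_prod_beta)

lemma fst_legal_set: "fst ` legal_set n l w = legal_tiles n"
  by (simp add: legal_set_def upper_part_def lower_part_def legal_tiles_def image_Un image_image)

lemma tiles_at_star: "tiles_at T A = fst ` snd (star_at T A)"
  unfolding tiles_at_def star_at_def by force

lemma fst_evolve: "fst ` evolve X = (\<Union>t\<in>fst ` X. pieces_at_0 t)"
proof (intro equalityI subsetI)
  fix y assume "y \<in> fst ` evolve X"
  then show "y \<in> (\<Union>t\<in>fst ` X. pieces_at_0 t)"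
    unfolding evolve_def cut_star_def pieces_at_0_def by (force simp: scale_ptile_def)
next
  fix y assume "y \<in> (\<Union>t\<in>fst ` X. pieces_at_0 t)"
  then obtain t e z where "(t, e) \<in> X" "z \<in> pieces t" "0 \<in> region z" "y = map_tile enlarge z"
    unfolding pieces_at_0_def by auto
  then have "scale_ptile enlarge (z, restrict_decor 0 z (partial_piece_decor t e z)) \<in> evolve X"
    "y = fst (scale_ptile enlarge (z, restrict_decor 0 z (partial_piece_decor t e z)))"
    unfolding evolve_def cut_star_def by (blast, simp add: scale_ptile_def)
  then show "y \<in> fst ` evolve X" by blast
qed

text \<open>The uncolored counterpart of \<open>star_decomposition_evolve\<close>, for a part of a star.\<close>

lemma tiles_at_decomposition:
  assumes T: "colored_tiling T" and f: "isometry f" "f 0 = A" and Y: "tiles_at T A \<subseteq> map_tile f ` Y"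
  shows "tiles_at (decomposition c T) (homothety c A) \<subseteq>
    map_tile (\<lambda>z. homothety c A + (f z - f 0)) ` (\<Union>t\<in>Y. pieces_at_0 t)"
proof
  let ?H = "homothety c"
  note a = isometry_affine_inj[OF f(1)]
  fix x assume "x \<in> tiles_at (decomposition c T) (?H A)"
  then obtain t d y where t: "(t, d) \<in> T" "y \<in> pieces t" "x = map_tile ?H y" "?H A \<in> region (map_tile ?H y)"
    unfolding tiles_at_def mem_decomposition[OF T] by auto
  have A: "A \<in> region y"
    using t(4) affine_inj_inj[OF homothety_affine_inj, of c]
    by (simp add: region_map_tile[OF homothety_affine_inj] inj_image_mem_iff)
  have "A \<in> region t"
    using A piece_region_subset[OF is_tile_nondeg[OF colored_tiling_is_tile[OF T t(1)]] t(2)] by blast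
  then obtain u where u: "u \<in> Y" "t = map_tile f u" using Y t(1) unfolding tiles_at_def by blast
  then obtain v where v: "v \<in> pieces u" "y = map_tile f v"
    using t(2) pieces_map_tile[OF a] by auto
  have "0 \<in> region v"
    using A affine_inj_inj[OF a] f(2) inj_image_mem_iff[of f 0 "region v"]
    by (simp add: v region_map_tile[OF a])
  then have "map_tile enlarge v \<in> pieces_at_0 u" using v(1) by (simp add: pieces_at_0_def)
  moreover have "(\<lambda>z. ?H (f z)) = (\<lambda>z. ?H A + (f (enlarge z) - f 0))"
    using homothety_isometry[OF f(1)] f(2) by auto
  then have "x = map_tile (\<lambda>z. ?H A + (f z - f 0)) (map_tile enlarge v)"
    unfolding t(3) v(2) map_tile_comp by (simp only:)
  ultimately show "x \<in> map_tile (\<lambda>z. ?H A + (f z - f 0)) ` (\<Union>t\<in>Y. pieces_at_0 t)"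
    using u(1) by blast
qed

text \<open>The uncolored content of \<open>evolve_legal\<close>; the label \<open>0\<close> and the orientation \<open>1\<close> are arbitrary.\<close>

lemma pieces_of_legal_tiles:
  assumes "n \<in> {1..7}"
  shows "\<exists>n' g. n' \<in> {1..7} \<and> isometry g \<and> g 0 = 0 \<and> (\<Union>t\<in>legal_tiles n. pieces_at_0 t) = map_tile g ` legal_tiles n'"
proof -
  obtain n' w' g where g: "n' \<in> {1..7}" "isometry g" "g 0 = 0"
    "evolve (legal_set n 0 1) = map_ptile g ` legal_set n' ((0 + 1) mod 4) w'"
    by (rule evolve_legal[OF assms, of 1 0]) auto
  have "(\<Union>t\<in>legal_tiles n. pieces_at_0 t) = fst ` evolve (legal_set n 0 1)"
    by (simp only: fst_evolve fst_legal_set)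
  also have "\<dots> = map_tile g ` fst ` legal_set n' ((0 + 1) mod 4) w'"
    unfolding g(4) by (simp add: image_image fst_map_ptile)
  also have "\<dots> = map_tile g ` legal_tiles n'" by (simp only: fst_legal_set)
  finally show ?thesis using g by blast
qed

lemma zero_notin_hyp:
  assumes "is_tile x" "0 \<in> vertices x"
  shows "0 \<notin> open_segment (vS x) (vL x)"
proof -
  have "side_set x Hyp = closed_segment (vS x) (vL x)" by (cases x) (simp add: side_set_def)
  then have "vR x \<notin> closed_segment (vS x) (vL x)"
    using vertex_in_side(1)[OF is_tile_nondeg[OF assms(1)], of Hyp] by simp
  then show ?thesis using assms(2) by (auto simp: vertices_def open_segment_def)
qed

lemma legal_tile_vertex:
  assumes "x \<in> legal_tiles n" "x \<notin> lower_tiles n \<or> n \<noteq> 1 \<and> n \<noteq> 2"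
  shows "is_tile x \<and> 0 \<in> vertices x"
proof (cases "x \<in> upper_tiles n")
  case True
  then show ?thesis using is_tile_fan[of "- 1" x] vertex_fan[of x] unfolding upper_tiles_list by auto
next
  case False
  then obtain y where y: "y \<in> fan (- 1) (lower_list n)" "x = map_tile cnj y"
    using assms lower_tiles_list[of n] unfolding legal_tiles_def by auto
  then have "is_tile y" "0 \<in> vertices y" using is_tile_fan[of "- 1" y] vertex_fan[of y] by auto
  then show ?thesis unfolding y(2)
    using is_tile_map_tile[OF isometry_cnj] by (force simp: vertices_map_tile)
qed

lemma foot_hyp_tile: "foot hyp_tile = 0"
  by (simp add: foot_def hyp_tile_def complex_eq_iff power_numeral_reduce)

text \<open>Except for the lower tiles of the first two stars, the center of a legal star is a vertex of all its
  tiles; and in the first star the center lies inside a large leg.\<close>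

lemma center_in_hyp:
  assumes "x \<in> legal_tiles n" "0 \<in> open_segment (vS x) (vL x)"
  shows "x = hyp_tile"
proof -
  have "x \<in> lower_tiles n" "n = 1 \<or> n = 2"
    using legal_tile_vertex[OF assms(1)] zero_notin_hyp assms(2) by blast+
  then consider "x = leg_tile" | "x = hyp_tile"
    by (auto simp: lower_tiles_def leg_tile_def hyp_tile_def)
  then show ?thesis
  proof cases
    case 1
    have "0 \<notin> closed_segment (vS leg_tile) (vL leg_tile)"
      unfolding leg_tile_def
      by (simp del: of_real_power of_real_minus add: zero_notin_segment)
    then show ?thesis using assms(2) 1 by (simp add: open_segment_def)
  qed
qed

lemma kind_fan_tile: "kind (fan_tile u k x) = k"
  by (cases x) (simp_all add: fan_tile_def)

lemma vL_fan_tile_eq_0: "u \<noteq> 0 \<Longrightarrow> vL (fan_tile u k x) = 0 \<longleftrightarrow> x = HA \<or> x = AH"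
  by (cases x; cases k) (simp_all add: fan_tile_def)

text \<open>The upper half of a legal star contains at most one large tile with its larger acute angle at the
  center.\<close>

lemma hyp_ends_upper:
  assumes "n \<in> {1..7}" "x \<in> upper_tiles n" "kind x = Large \<and> vL x = 0"
  shows "n \<notin> {1} \<and> x = (if n = 2 then fan_tile (- 1) Large HA
     else if n = 3 then fan_tile \<i> Large HA
     else if n = 4 then fan_tile (- 1) Large AH
     else if n = 5 then fan_tile \<i> Large AH
     else if n = 6 then fan_tile (- 1) Large HA
     else fan_tile \<i> Large HA)"
proof -
  have "cis (- large_angle) * cis (- small_angle) = - \<i>"
    using cis_corner_mult by (simp add: cis_corner(3) mult.commute)
  moreover have "n = 1 \<or> n = 2 \<or> n = 3 \<or> n = 4 \<or> n = 5 \<or> n = 6 \<or> n = 7" using assms(1) by auto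
  ultimately show ?thesis
    using assms(2,3) unfolding upper_tiles_list
    by (elim disjE) (auto simp: upper_list_def kind_fan_tile vL_fan_tile_eq_0)
qed

lemma hyp_ends_lower:
  assumes "n \<in> {1..7}" "x \<in> lower_tiles n" "kind x = Large \<and> vL x = 0"
  shows "n \<notin> {1, 2, 3} \<and> x = map_tile cnj (if n = 4 then fan_tile (\<i> * cis (- small_angle)) Large AH
     else if n = 5 then fan_tile (- cis (- small_angle)) Large AH
     else if n = 6 then fan_tile (\<i> * cis (- small_angle)) Large HA
     else fan_tile (- cis (- small_angle)) Large HA)"
proof -
  have *: "cis (- small_angle) * cis (- large_angle) = - \<i>"
    using cis_corner_mult by (simp add: cis_corner(3))
  have n: "n = 1 \<or> n = 2 \<or> n = 3 \<or> n = 4 \<or> n = 5 \<or> n = 6 \<or> n = 7" using assms(1) by auto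
  show ?thesis
  proof (cases "n = 1 \<or> n = 2")
    case True
    then show ?thesis using assms(2,3) phi_pos by (auto simp: lower_tiles_def complex_eq_iff)
  next
    case False
    then obtain y where y: "y \<in> fan (- 1) (lower_list n)" "x = map_tile cnj y"
      using assms(2) lower_tiles_list[of n] by auto
    then have "kind y = Large \<and> vL y = 0" using assms(3) by simp
    then show ?thesis using y n False *
      by (elim disjE) (auto simp: lower_list_def kind_fan_tile vL_fan_tile_eq_0 cis_corner(3))
  qed
qed

text \<open>Different large tiles of a legal star with their larger acute angle at the center lie in different
  half-planes, and the directions of their hypotenuses differ.\<close>

lemma no_mirror_pair:
  assumes n: "n \<in> {1..7}" and "x \<in> legal_tiles n" "y \<in> legal_tiles n"
    "kind x = Large" "kind y = Large" "vL x = 0" "vL y = 0" "vS x = vS y"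
  shows "x = y"
proof -
  have cross: False if "x \<in> upper_tiles n" "y \<in> lower_tiles n" "kind x = Large \<and> vL x = 0"
      "kind y = Large \<and> vL y = 0" "vS x = vS y" for x y
  proof -
    have "n = 4 \<or> n = 5 \<or> n = 6 \<or> n = 7" using hyp_ends_lower[OF n that(2,4)] n by auto
    then show False
      using hyp_ends_upper[OF n that(1,3)] hyp_ends_lower[OF n that(2,4)] that(5) phi_pos phi_lt_one
      by (elim disjE) (auto simp: fan_tile_def cis_corner complex_eq_iff)
  qed
  show ?thesis
    using assms hyp_ends_upper[OF n, of x] hyp_ends_upper[OF n, of y] hyp_ends_lower[OF n, of x]
      hyp_ends_lower[OF n, of y] cross[of x y] cross[of y x]
    unfolding legal_tiles_def by auto
qed

section \<open>New vertices\<close>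

lemma flat_triangle_interior:
  assumes "\<forall>v\<in>vertices t. Re v + Im v = 1"
  shows "interior (region t) = {}"
proof -
  have "convex {z. Re z + Im z = (1::real)}"
  proof -
    have "{z. Re z + Im z = 1} = {z. (1 + \<i>) \<bullet> z = 1}" by (simp add: inner_complex_def)
    then show ?thesis by (simp only: convex_hyperplane)
  qed
  then have "region t \<subseteq> {z. Re z + Im z = 1}"
    unfolding region_def using assms by (intro hull_minimal) auto
  moreover have "{z. Re z + Im z = 1} = {z. (1 + \<i>) \<bullet> z = 1}" by (simp add: inner_complex_def)
  moreover have "interior {z. (1 + \<i>) \<bullet> z = 1} = {}"
    by (rule interior_hyperplane) (simp add: complex_eq_iff)
  ultimately show ?thesis using interior_mono by (metis subset_empty)
qed

text \<open>The point is a convex combination of the vertices. Those with positive weight lie on the line, which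
  are at least two because the point is not a vertex, and at most two because the triangle is not
  flat.\<close>

lemma side_on_line:
  assumes "interior (region t) \<noteq> {}" "z \<in> region t" "z \<notin> vertices t"
    and half: "\<forall>v\<in>vertices t. 1 \<le> Re v + Im v" and on: "Re z + Im z = 1"
  shows "\<exists>s. z \<in> open_segment (fst (ends t s)) (snd (ends t s)) \<and>
    Re (fst (ends t s)) + Im (fst (ends t s)) = 1 \<and> Re (snd (ends t s)) + Im (snd (ends t s)) = 1"
proof -
  obtain k r p q where t: "t = Tile k r p q" by (cases t)
  obtain a b c where abc: "0 \<le> a" "0 \<le> b" "0 \<le> c" "a + b + c = 1" "z = a *\<^sub>R r + b *\<^sub>R p + c *\<^sub>R q"
    using assms(2) unfolding region_def vertices_def t by (auto simp: convex_hull_3)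
  let ?g = "\<lambda>v. Re v + Im v"
  have g1: "1 \<le> ?g r" "1 \<le> ?g p" "1 \<le> ?g q" using half by (auto simp: vertices_def t)
  have "a * (?g r - 1) + b * (?g p - 1) + c * (?g q - 1) = ?g z - (a + b + c)"
    by (simp add: abc(5) algebra_simps)
  then have s0: "a * (?g r - 1) + b * (?g p - 1) + c * (?g q - 1) = 0" using on abc(4) by simp
  have nn: "0 \<le> a * (?g r - 1)" "0 \<le> b * (?g p - 1)" "0 \<le> c * (?g q - 1)"
    using abc g1 by simp_all
  have "a * (?g r - 1) = 0" "b * (?g p - 1) = 0" "c * (?g q - 1) = 0"
    using s0 nn by linarith+
  then have g: "a \<noteq> 0 \<Longrightarrow> ?g r = 1" "b \<noteq> 0 \<Longrightarrow> ?g p = 1" "c \<noteq> 0 \<Longrightarrow> ?g q = 1" by auto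
  have nv: "z \<noteq> r" "z \<noteq> p" "z \<noteq> q" using assms(3) by (auto simp: vertices_def t)
  have nall: "a = 0 \<or> b = 0 \<or> c = 0"
  proof (rule ccontr)
    assume "\<not> ?thesis"
    then have "\<forall>v\<in>vertices t. Re v + Im v = 1" using g by (auto simp: vertices_def t)
    then show False using flat_triangle_interior assms(1) by blast
  qed
  have seg: "w \<in> open_segment x y" if "w = u *\<^sub>R x + v *\<^sub>R y" "u + v = 1" "0 \<le> u" "0 \<le> v" "w \<noteq> x" "w \<noteq> y"
    for w x y :: complex and u v :: real
  proof -
    have "u = 1 - v" using that(2) by simp
    then show ?thesis using that by (auto simp: open_segment_def in_segment intro!: exI[of _ v])
  qed
  from nall show ?thesis
  proof (elim disjE)
    assume 0: "a = 0"
    then have "z = b *\<^sub>R p + c *\<^sub>R q" "b + c = 1" using abc by auto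
    moreover from this have "b \<noteq> 0" "c \<noteq> 0" using nv by auto
    ultimately show ?thesis using seg[of z b p c q] nv abc g by (intro exI[of _ Hyp]) (simp add: t)
  next
    assume 0: "b = 0"
    then have "z = a *\<^sub>R r + c *\<^sub>R q" "a + c = 1" using abc by auto
    moreover from this have "a \<noteq> 0" "c \<noteq> 0" using nv by auto
    ultimately show ?thesis using seg[of z a r c q] nv abc g by (intro exI[of _ SmallLeg]) (simp add: t)
  next
    assume 0: "c = 0"
    then have "z = a *\<^sub>R r + b *\<^sub>R p" "a + b = 1" using abc by auto
    moreover from this have "a \<noteq> 0" "b \<noteq> 0" using nv by auto
    ultimately show ?thesis using seg[of z a r b p] nv abc g by (intro exI[of _ BigLeg]) (simp add: t)
  qed
qed

text \<open>Moving from the foot a little towards a point on the inner side of the hypotenuse leads into the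
  interior of the tile, since the other two sides are at a positive distance from the foot.\<close>

lemma inner_side_meets_interior:
  assumes "nondeg t" "convex X" "foot t \<in> X" "frame t w \<in> X" "Re w + Im w < 1"
  shows "X \<inter> interior (region t) \<noteq> {}"
proof -
  let ?a = "phi ^ 4" and ?b = "phi\<^sup>2"
  have ab: "0 < ?a" "0 < ?b" "?a + ?b = 1" using phi_pos phi_weights by simp_all
  \<comment> \<open>\<open>e\<close> is small enough that the first two coordinates of the moved point stay positive.\<close>
  define M where "M = 1 + \<bar>Re w\<bar> + \<bar>Im w\<bar>"
  define e where "e = min ?a ?b / (1 + M)"
  have M: "1 \<le> M" by (simp add: M_def)
  have e: "0 < e" "e * (1 + M) = min ?a ?b" using ab M by (simp_all add: e_def)
  have e1: "e < 1"
  proof (rule ccontr)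
    assume "\<not> e < 1"
    then have "1 * (1 + M) \<le> e * (1 + M)" using M by (intro mult_right_mono) auto
    then show False using e(2) M ab by (simp add: min_def split: if_splits)
  qed
  define v where "v = (1 - e) *\<^sub>R std_foot + e *\<^sub>R w"
  have lo: "e * ?a - e * x < ?a" "e * ?b - e * x < ?b" if "- x < M" for x
  proof -
    have "e * (?a - x) < e * (1 + M)" "e * (?b - x) < e * (1 + M)"
      using e(1) that ab by (intro mult_strict_left_mono; linarith)+
    then show "e * ?a - e * x < ?a" "e * ?b - e * x < ?b" using e(2) by (simp_all add: right_diff_distrib)
  qed
  have "- Re w < M" "- Im w < M" by (auto simp: M_def)
  from lo(1)[OF this(1)] lo(2)[OF this(2)] have "0 < Re v" "0 < Im v"
    by (simp_all add: v_def std_foot_def algebra_simps)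
  moreover have "Re v + Im v < 1"
  proof -
    have "Re v + Im v = (1 - e) * (?a + ?b) + e * (Re w + Im w)"
      by (simp add: v_def std_foot_def algebra_simps)
    also have "\<dots> < (1 - e) * 1 + e * 1" using assms(5) e(1) ab(3) by simp
    finally show ?thesis by simp
  qed
  ultimately have "frame t v \<in> interior (region t)"
    by (simp add: interior_region_frame[OF assms(1)])
  moreover have "frame t v = (1 - e) *\<^sub>R foot t + e *\<^sub>R frame t w"
    unfolding v_def by (subst affine_inj_comb[OF frame_affine_inj[OF assms(1)]]) (simp_all add: frame_std_foot)
  then have "frame t v \<in> X"
    using assms(2-4) e(1) e1 by (simp add: convex_alt)
  ultimately show ?thesis by blast
qed

lemma frame_on_hyp: "Re w + Im w = 1 \<Longrightarrow> frame t w = Re w *\<^sub>R vS t + Im w *\<^sub>R vL t"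
proof -
  assume "Re w + Im w = 1"
  then have i: "Im w = 1 - Re w" by simp
  show ?thesis unfolding frame_def i by (simp add: algebra_simps)
qed

text \<open>The altitude is orthogonal to the hypotenuse, and its length is \<open>phi ^ 3\<close> times that of the
  hypotenuse.\<close>

lemma is_tile_apex:
  assumes "is_tile t"
  shows "\<exists>s\<in>{1, -1::real}. vR t = foot t + (s * phi ^ 3) *\<^sub>R (\<i> * (vL t - vS t))"
  using assms
proof (rule is_tile_frameE)
  fix s d assume s: "s = 1 \<or> s = (-1::real)" "d \<noteq> 0"
    "vS t = vR t + d" "vL t = vR t + of_real (s * phi) * \<i> * d"
  let ?P = "of_real phi :: complex"
  have P4: "?P ^ 4 = 1 - ?P\<^sup>2" using arg_cong[OF phi_four, of complex_of_real] by simp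
  have "foot t = (?P ^ 4 + ?P\<^sup>2) * vR t + (?P ^ 4 + of_real s * \<i> * ?P ^ 3) * d"
    unfolding foot_def s scaleR_conv_of_real by (simp add: algebra_simps power_numeral_reduce)
  then have f: "foot t = vR t + (?P ^ 4 + of_real s * \<i> * ?P ^ 3) * d" by (simp add: P4)
  have "(s * phi ^ 3) *\<^sub>R (\<i> * (vL t - vS t)) = - ((?P ^ 4 + of_real s * \<i> * ?P ^ 3) * d)"
    using s(1) by (auto simp: s(3,4) scaleR_conv_of_real algebra_simps power_numeral_reduce)
  then have "vR t = foot t + (s * phi ^ 3) *\<^sub>R (\<i> * (vL t - vS t))" unfolding f by simp
  then show ?thesis using s(1) by blast
qed

text \<open>The common hypotenuse leaves two positions for the right angle, the reflection in its midpoint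
  and one on the inner side of the hypotenuse of \<open>t\<close>, which is excluded by the hypothesis that the
  right angle lies on the outer side.\<close>

lemma reversed_tile_apex:
  assumes t: "is_tile t" "is_tile t'" "vS t' = vL t" "vL t' = vS t"
    and out: "\<And>w. frame t w = vR t' \<Longrightarrow> 1 \<le> Re w + Im w"
  shows "vR t' = vS t + vL t - vR t"
proof -
  obtain s s' where s: "s \<in> {1, -1::real}" "s' \<in> {1, -1::real}"
    "vR t = foot t + (s * phi ^ 3) *\<^sub>R (\<i> * (vL t - vS t))"
    "vR t' = foot t' + (s' * phi ^ 3) *\<^sub>R (\<i> * (vL t' - vS t'))"
    using is_tile_apex[OF t(1)] is_tile_apex[OF t(2)] by blast
  have f': "foot t' = vS t + vL t - foot t"
    by (simp add: foot_def t phi_four algebra_simps)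
  have "\<i> * (vL t' - vS t') = - (\<i> * (vL t - vS t))" by (simp add: t algebra_simps)
  then have r': "vR t' = foot t' - (s' * phi ^ 3) *\<^sub>R (\<i> * (vL t - vS t))" using s(4) by simp
  show ?thesis
  proof (cases "s' = s")
    case True
    have "vR t' + vR t = foot t' + foot t" unfolding r' s(3) True by simp
    then show ?thesis unfolding f' by (simp add: algebra_simps)
  next
    case False
    then have s': "s' = - s" using s by auto
    have "vR t' = vR t + (foot t' - foot t)" using s(3) r' unfolding s' by simp
    also have "foot t' - foot t = (phi ^ 4 - phi\<^sup>2) *\<^sub>R (vL t - vS t)"
      by (simp add: foot_def t algebra_simps)
    \<comment> \<open>The other position has coordinates with sum \<open>0\<close>, less than the value \<open>1\<close> on the hypotenuse.\<close>
    finally have "frame t (Complex (- (phi ^ 4 - phi\<^sup>2)) (phi ^ 4 - phi\<^sup>2)) = vR t'"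
      by (simp add: frame_def algebra_simps)
    from out[OF this] show ?thesis by simp
  qed
qed

lemma ends_Hyp: "ends t Hyp = (vS t, vL t)"
  by (cases t) simp

lemma open_hyp_subset_region: "open_segment (vS t) (vL t) \<subseteq> region t"
  using side_set_subset_region[of t Hyp] by (auto simp: side_set_def ends_Hyp open_segment_def)

text \<open>A vertex inside a hypotenuse is the center of a copy of the second legal star, whose only tile with
  the center inside its hypotenuse has its altitude foot there.\<close>

lemma vertex_inside_hyp:
  assumes "vertex_figures_legal T" "star_vertex T v"
  obtains u where "\<And>t d. (t, d) \<in> T \<Longrightarrow> v \<in> open_segment (vS t) (vL t) \<Longrightarrow> t = u \<and> foot t = v"
proof -
  obtain m f where f: "isometry f" "f 0 = v" "tiles_at T v \<subseteq> map_tile f ` legal_tiles m"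
    using assms unfolding vertex_figures_legal_def by blast
  note a = isometry_affine_inj[OF f(1)]
  have "t = map_tile f hyp_tile" if t: "(t, d) \<in> T" "v \<in> open_segment (vS t) (vL t)" for t d
  proof -
    have "t \<in> tiles_at T v" using t open_hyp_subset_region unfolding tiles_at_def by blast
    then obtain y where y: "y \<in> legal_tiles m" "t = map_tile f y" using f(3) by blast
    then have "f 0 \<in> open_segment (f (vS y)) (f (vL y))" using t(2) f(2) by simp
    then have "0 \<in> open_segment (vS y) (vL y)"
      by (simp add: affine_inj_open_segment[OF a] inj_image_mem_iff[OF affine_inj_inj[OF a]])
    then show ?thesis using center_in_hyp[OF y(1)] y(2) by simp
  qed
  moreover have "foot (map_tile f hyp_tile) = v" by (simp add: foot_map_tile[OF a] foot_hyp_tile f(2))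
  ultimately show ?thesis using that[of "map_tile f hyp_tile"] by blast
qed

lemma matching_reversed_hyps:
  assumes "matching T" "(t, d) \<in> T" "(t', d') \<in> T" "vS t' = vL t" "vL t' = vS t" "vS t \<noteq> vL t"
  shows "d Hyp = d' Hyp"
proof -
  have "closed_segment (vS t) (vL t) \<subseteq> side_set t Hyp \<inter> side_set t' Hyp"
    by (simp add: side_set_def ends_Hyp assms(4,5) closed_segment_commute)
  then show ?thesis using assms(1-3,6) unfolding matching_def by blast
qed

text \<open>Since \<open>t'\<close> avoids the interior of \<open>t\<close>, it has a side along the hypotenuse of \<open>t\<close> through its altitude
  foot. An end of this side inside the hypotenuse would be a vertex there, hence the foot itself. So the
  side covers the hypotenuse, whose length 1 is the largest length of a side, and equals it. The same direction
  of both hypotenuses would make \<open>t\<close> and \<open>t'\<close> a mirror pair at the common vertex \<open>vL t\<close>.\<close>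

lemma tile_across_foot:
  assumes T: "colored_tiling T" "vertex_figures_legal T"
    and t: "(t, d) \<in> T" "kind t = Large" and F: "\<not> star_vertex T (foot t)"
    and t': "(t', d') \<in> T" "foot t \<in> region t'" "(t', d') \<noteq> (t, d)"
  shows "kind t' = Large \<and> vS t' = vL t \<and> vL t' = vS t \<and> vR t' = vS t + vL t - vR t"
proof -
  have tl: "is_tile t" "is_tile t'" using colored_tiling_is_tile[OF T(1)] t t' by blast+
  have n: "nondeg t" "nondeg t'" using tl is_tile_nondeg by blast+
  note a = frame_affine_inj[OF n(1)]
  have out: "1 \<le> Re w + Im w" if w: "frame t w \<in> region t'" for w
  proof (rule ccontr)
    assume "\<not> ?thesis"
    then have "Re w + Im w < 1" by simp
    then obtain z where "z \<in> region t'" "z \<in> interior (region t)"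
      using inner_side_meets_interior[OF n(1) convex_region t'(2) w] by blast
    then show False using tile_unique_at_interior[OF T(1) t(1) t'(1)] t'(3) by auto
  qed
  obtain g where g: "\<And>z. frame t (g z) = z" using affine_inj_surj[OF a] by (metis surjD)
  \<comment> \<open>\<open>u\<close> is \<open>t'\<close> in the coordinates of \<open>t\<close>, where the hypotenuse is the segment from \<open>1\<close> to \<open>\<i>\<close>.\<close>
  define u where "u = map_tile g t'"
  have u: "t' = map_tile (frame t) u" by (cases t') (simp add: u_def g)
  have vert: "star_vertex T (frame t v)" if "v \<in> vertices u" for v
    using that t'(1) unfolding star_vertex_def u by (force simp: vertices_map_tile)
  have "interior (region u) \<noteq> {}"
    using interior_region_nonempty[OF n(2)] unfolding u interior_region_map_tile[OF a] by auto
  moreover have "std_foot \<in> region u"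
    using t'(2) unfolding u region_map_tile[OF a] frame_std_foot[symmetric]
    by (simp add: inj_image_mem_iff[OF affine_inj_inj[OF a]])
  moreover have "std_foot \<notin> vertices u" using vert[of std_foot] F by (auto simp: frame_std_foot)
  moreover have "\<forall>v\<in>vertices u. 1 \<le> Re v + Im v"
    using out vertices_subset_region[of u] unfolding u region_map_tile[OF a] by blast
  moreover have "Re std_foot + Im std_foot = 1" by (simp add: std_foot_def phi_weights)
  ultimately obtain s where s: "std_foot \<in> open_segment (fst (ends u s)) (snd (ends u s))"
    "Re (fst (ends u s)) + Im (fst (ends u s)) = 1" "Re (snd (ends u s)) + Im (snd (ends u s)) = 1"
    using side_on_line[of u std_foot] by blast
  let ?x = "Re (fst (ends u s))" and ?y = "Re (snd (ends u s))"
  \<comment> \<open>An end strictly between \<open>1\<close> and \<open>\<i>\<close> would be a vertex inside the hypotenuse of \<open>t\<close>.\<close>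
  have end_outside: "Re v \<le> 0 \<or> 1 \<le> Re v" if v: "v \<in> vertices u" "Re v + Im v = 1" for v
  proof (rule ccontr)
    assume "\<not> ?thesis"
    then have b: "0 < Re v" "Re v < 1" by auto
    have "1 - Im v = Re v" using v(2) by linarith
    then have "frame t v = (1 - Im v) *\<^sub>R vS t + Im v *\<^sub>R vL t"
      using frame_on_hyp[OF v(2), of t] by simp
    then have "frame t v \<in> open_segment (vS t) (vL t)"
      unfolding in_segment(2) using b v(2) distinct_vertices[OF n(1)]
      by (intro conjI exI[of _ "Im v"]) auto
    then have "foot t = frame t v" using vertex_inside_hyp[OF T(2) vert[OF v(1)]] t(1) by metis
    then show False using F vert[OF v(1)] by simp
  qed
  have xy: "?x \<le> 0 \<or> 1 \<le> ?x" "?y \<le> 0 \<or> 1 \<le> ?y"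
    using end_outside s ends_in_vertices by blast+
  obtain e where e: "0 < e" "e < 1" "std_foot = (1 - e) *\<^sub>R fst (ends u s) + e *\<^sub>R snd (ends u s)"
    using s(1) by (auto simp: in_segment)
  have conv: "(1 - e) * ?x + e * ?y = phi ^ 4"
    using arg_cong[OF e(3), of Re] by (simp add: std_foot_def)
  have b4: "0 < phi ^ 4" "phi ^ 4 < 1" 
    using zero_less_power[OF phi_pos, of 4] zero_less_power[OF phi_pos, of 2] phi_weights by linarith+
  have opp: "?x \<le> 0 \<and> 1 \<le> ?y \<or> 1 \<le> ?x \<and> ?y \<le> 0"
  proof -
    have "\<not> (?x \<le> 0 \<and> ?y \<le> 0)"
    proof
      assume "?x \<le> 0 \<and> ?y \<le> 0"
      then have "(1 - e) * ?x \<le> 0" "e * ?y \<le> 0" using e by (simp_all add: mult_nonneg_nonpos)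
      then show False using conv b4 by linarith
    qed
    moreover have "\<not> (1 \<le> ?x \<and> 1 \<le> ?y)"
    proof
      assume "1 \<le> ?x \<and> 1 \<le> ?y"
      then have "(1 - e) * 1 \<le> (1 - e) * ?x" "e * 1 \<le> e * ?y"
        using e by (intro mult_left_mono; simp)+
      then have "(1 - e) * 1 + e * 1 \<le> phi ^ 4" unfolding conv[symmetric] by (rule add_mono)
      then show False using b4 by simp
    qed
    ultimately show ?thesis using xy by blast
  qed
  have en: "ends t' s = (frame t (fst (ends u s)), frame t (snd (ends u s)))"
    unfolding u by (rule ends_map_tile)
  have "fst (ends t' s) - snd (ends t' s) = (?x - ?y) *\<^sub>R (vS t - vL t)"
  proof -
    have i: "Im (fst (ends u s)) = 1 - ?x" "Im (snd (ends u s)) = 1 - ?y" using s by linarith+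
    show ?thesis unfolding en fst_conv snd_conv frame_on_hyp[OF s(2)] frame_on_hyp[OF s(3)] i
      by (simp add: algebra_simps)
  qed
  moreover have "cmod (vS t - vL t) = 1"
    using side_length_dist[OF tl(1), of Hyp] t(2) by (cases t) (simp add: dist_norm)
  ultimately have len: "side_length (kind t') s = \<bar>?x - ?y\<bar>"
    using side_length_dist[OF tl(2), of s] by (simp add: dist_norm)
  have small: "side_length k s' < 1 \<or> k = Large \<and> s' = Hyp" for k s'
    using phi_pos phi_lt_one by (cases k; cases s') (simp_all add: power_less_one_iff)
  have ks: "kind t' = Large" "s = Hyp" using small[of "kind t'" s] len opp by auto
  then have "\<bar>?x - ?y\<bar> = 1" using len by simp
  then have "?x = 0 \<and> ?y = 1 \<or> ?x = 1 \<and> ?y = 0" using opp by auto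
  then have "fst (ends u s) = \<i> \<and> snd (ends u s) = 1 \<or> fst (ends u s) = 1 \<and> snd (ends u s) = \<i>"
    using s(2,3) by (auto simp: complex_eq_iff)
  then consider "vS t' = vL t" "vL t' = vS t" | "vS t' = vS t" "vL t' = vL t"
    using en ends_Hyp[of t'] unfolding ks(2) by (auto simp: frame_vertices)
  then show ?thesis
  proof cases
    case 1
    have "1 \<le> Re w + Im w" if "frame t w = vR t'" for w
      using out[of w] that by simp
    then show ?thesis using reversed_tile_apex[OF tl 1] ks 1 by blast
  next
    case 2
    have "star_vertex T (vL t)" using t(1) unfolding star_vertex_def by (force simp: vertices_def)
    then obtain m f where f: "m \<in> {1..7}" "isometry f" "f 0 = vL t"
      "tiles_at T (vL t) \<subseteq> map_tile f ` legal_tiles m"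
      using T(2) unfolding vertex_figures_legal_def by blast
    note fa = affine_inj_eq_iff[OF isometry_affine_inj[OF f(2)]]
    have "t \<in> tiles_at T (vL t)" "t' \<in> tiles_at T (vL t)"
      using t(1) t'(1) vertex_in_region(3)[of t'] unfolding tiles_at_def 2(2) by auto
    then obtain x y where xy: "x \<in> legal_tiles m" "y \<in> legal_tiles m" "t = map_tile f x" "t' = map_tile f y"
      using f(4) by blast
    have "f (vL x) = f 0" "f (vL y) = f 0" "f (vS x) = f (vS y)"
      using f(3) 2 by (simp_all add: xy)
    then have "x = y"
      using no_mirror_pair[OF f(1) xy(1,2)] t(2) ks(1) by (simp add: xy fa)
    then have "t = t'" by (simp add: xy)
    moreover obtain z where "z \<in> interior (region t)" using interior_region_nonempty[OF n(1)] by blast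
    moreover from this have "z \<in> region t" using interior_subset by blast
    ultimately have "(t, d) = (t', d')"
      using tile_unique_at_interior[OF T(1) t(1) t'(1), of z] by simp
    then show ?thesis using t'(3) by simp
  qed
qed

lemma is_tile_congruent:
  assumes "is_tile t" "is_tile u" "kind t = kind u"
  obtains h where "isometry h" "t = map_tile h u"
proof -
  obtain f g where f: "isometry f" "t = map_tile f proto_L \<or> t = map_tile f proto_S"
    and g: "isometry g" "u = map_tile g proto_L \<or> u = map_tile g proto_S"
    using assms unfolding is_tile_def by blast
  obtain g' where g': "isometry g'" "\<And>z. g' (g z) = z" using isometry_inverse[OF g(1)] by metis
  have "map_tile (\<lambda>z. f (g' z)) u = t"
    using f(2) g(2) assms(3) by (auto simp: map_tile_comp g'(2)) (auto simp: proto_L_def proto_S_def)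
  then show ?thesis using that isometry_comp[OF f(1) g'(1)] by blast
qed

lemma is_tile_upper_half: "is_tile upper_half"
proof -
  have "vS upper_half - vR upper_half = Complex (- (phi\<^sup>2)) (- (phi ^ 3))"
    by (simp add: upper_half_def complex_eq_iff)
  moreover have "(cmod (Complex (- (phi\<^sup>2)) (- (phi ^ 3))))\<^sup>2 = phi\<^sup>2"
    unfolding cmod_power2 by (simp add: power_numeral_reduce phi_reduce algebra_simps)
  then have "cmod (Complex (- (phi\<^sup>2)) (- (phi ^ 3))) = phi"
    by (rule power2_eq_imp_eq) (use phi_pos in simp_all)
  moreover have "vL upper_half - vR upper_half = of_real (1 * phi) * \<i> * Complex (- (phi\<^sup>2)) (- (phi ^ 3))"
    by (simp add: upper_half_def complex_eq_iff power_numeral_reduce)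
  moreover have "kind upper_half = Large" by (simp add: upper_half_def)
  ultimately show ?thesis unfolding is_tile_iff by (intro conjI bexI[of _ 1]) simp_all
qed

lemma foot_upper_half: "foot upper_half = 0"
  by (simp add: foot_def upper_half_def complex_eq_iff power_numeral_reduce)

lemma lower_half_vertices:
  "kind lower_half = Large" "vS lower_half = vL upper_half" "vL lower_half = vS upper_half"
  "vR lower_half = vS upper_half + vL upper_half - vR upper_half"
  by (simp_all add: lower_half_def upper_half_def complex_eq_iff phi_powers phi_four)

lemma affine_inj_parallelogram: "affine_inj h \<Longrightarrow> h (a + b - c) = h a + h b - h c"
  by (erule affine_injE) (simp add: linear_add linear_diff)

lemma map_lower_half:
  assumes "affine_inj h" "t = map_tile h upper_half"
    "kind t' = Large \<and> vS t' = vL t \<and> vL t' = vS t \<and> vR t' = vS t + vL t - vR t"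
  shows "t' = map_tile h lower_half"
  using assms(3) affine_inj_parallelogram[OF assms(1)]
  by (intro map_tile_eqI[symmetric]) (simp_all add: lower_half_vertices assms(2))

lemma upper_half_at_foot:
  assumes "is_tile t" "kind t = Large"
  obtains h where "isometry h" "h 0 = foot t" "t = map_tile h upper_half"
proof -
  have "kind t = kind upper_half" using assms(2) by (simp add: upper_half_def)
  from is_tile_congruent[OF assms(1) is_tile_upper_half this]
  obtain h where h: "isometry h" "t = map_tile h upper_half" .
  moreover have "h 0 = foot t"
    using foot_map_tile[OF isometry_affine_inj[OF h(1)], of upper_half] by (simp add: h(2) foot_upper_half)
  ultimately show ?thesis using that by blast
qed

text \<open>At a new vertex there are no tiles besides the two halves of a rectangle.\<close>

lemma new_vertex_figure:
  assumes T: "colored_tiling T" "vertex_figures_legal T"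
    and t: "(t, d) \<in> T" "kind t = Large" "\<not> star_vertex T (foot t)"
    and h: "isometry h" "t = map_tile h upper_half"
  shows "tiles_at T (foot t) \<subseteq> map_tile h ` {upper_half, lower_half}"
proof
  fix x assume "x \<in> tiles_at T (foot t)"
  then obtain d' where x: "(x, d') \<in> T" "foot t \<in> region x" unfolding tiles_at_def by blast
  show "x \<in> map_tile h ` {upper_half, lower_half}"
  proof (cases "(x, d') = (t, d)")
    case True
    then show ?thesis using h by simp
  next
    case False
    then show ?thesis
      using map_lower_half[OF isometry_affine_inj[OF h(1)] h(2)] tile_across_foot[OF T t x] by blast
  qed
qed

lemma foot_in_side_iff: "nondeg t \<Longrightarrow> foot t \<in> side_set t s \<longleftrightarrow> s = Hyp"
  unfolding side_set_frame frame_std_foot[symmetric] mem_frame_image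
  using phi_pos phi_weights by (cases s) (auto simp: side_std std_foot_def)

text \<open>The common hypotenuse of the two halves has one decoration by matching, and it is the only side of
  either half that contains the altitude foot.\<close>

lemma new_star:
  assumes T: "colored_tiling T" "vertex_figures_legal T" "matching T"
    and t: "(t, d) \<in> T" "kind t = Large" "\<not> star_vertex T (foot t)"
    and t': "(t', d') \<in> T" "foot t \<in> region t'" "(t', d') \<noteq> (t, d)"
    and w: "w \<in> {1, -1}" "snd (d Hyp) = w * (vL t - vS t)"
  obtains h where "isometry h" "star_at T (foot t) = map_star h (0, rectangle_set (fst (d Hyp)) w)"
proof -
  let ?F = "foot t"
  have tl: "is_tile t" "is_tile t'" using colored_tiling_is_tile[OF T(1)] t t' by blast+
  obtain h where h: "isometry h" "h 0 = ?F" "t = map_tile h upper_half"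
    using upper_half_at_foot[OF tl(1) t(2)] .
  note a = isometry_affine_inj[OF h(1)]
  have across: "kind t' = Large \<and> vS t' = vL t \<and> vL t' = vS t \<and> vR t' = vS t + vL t - vR t"
    by (rule tile_across_foot[OF T(1,2) t t'])
  have t'h: "t' = map_tile h lower_half" by (rule map_lower_half[OF a h(3) across])
  have only2: "x = (t, d) \<or> x = (t', d')" if x: "x \<in> T" "?F \<in> region (fst x)" for x
  proof (rule ccontr)
    assume ne: "\<not> ?thesis"
    then have "fst x = map_tile h lower_half"
      using map_lower_half[OF a h(3)] tile_across_foot[OF T(1,2) t, of "fst x" "snd x"] x by simp
    then have "fst x = t'" using t'h by simp
    moreover obtain z where "z \<in> interior (region t')" "z \<in> region t'"
      using interior_region_nonempty[OF is_tile_nondeg[OF tl(2)]] interior_subset by blast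
    ultimately show False using tile_unique_at_interior[OF T(1) x(1) t'(1), of z] ne by simp
  qed
  have eq: "d Hyp = d' Hyp"
    using matching_reversed_hyps[OF T(3) t(1) t'(1)] across distinct_vertices[OF is_tile_nondeg[OF tl(1)]]
    by blast
  have side': "?F \<in> side_set t' s \<longleftrightarrow> s = Hyp" for s
  proof -
    have n: "nondeg t'" by (rule is_tile_nondeg[OF tl(2)])
    have "?F = frame t' (Complex (phi\<^sup>2) (phi ^ 4))"
      using across by (simp add: frame_def foot_def phi_four algebra_simps)
    then show ?thesis unfolding side_set_frame[OF n] using phi_pos phi_weights
      by (cases s) (auto simp: mem_frame_image[OF n] side_std)
  qed
  have lin: "vL t - vS t = h 1 - h 0"
  proof -
    have "vL upper_half - vS upper_half = 1"
      by (simp add: upper_half_def complex_eq_iff phi_four)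
    then show ?thesis using isometry_linear_part[OF h(1), of "vL upper_half" "vS upper_half"]
      by (simp add: h(3))
  qed
  have "h (- 1) - h 0 = - (h 1 - h 0)"
    using isometry_scale[OF h(1), of "- 1" 1] by simp
  then have "snd (d Hyp) = h w - h 0" using w lin by auto
  then have dec: "map_decor h (fst (d Hyp), w) = d Hyp" by (simp add: map_decor_def prod_eq_iff)
  have m: "map_ptile h (u, only Hyp (fst (d Hyp), w)) = (map_tile h u, only Hyp (d Hyp))" for u
    using dec by (auto simp: map_ptile_def only_def)
  have "?F \<in> region t" using foot_in_side_iff[OF is_tile_nondeg[OF tl(1)], of Hyp] side_set_subset_region by blast
  then have "snd (star_at T ?F) = (\<lambda>(t, d). (t, \<lambda>s. if ?F \<in> side_set t s then Some (d s) else None)) ` {(t, d), (t', d')}"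
    using only2 t(1) t'(1,2) unfolding star_at_def by fastforce
  also have "\<dots> = {(t, only Hyp (d Hyp)), (t', only Hyp (d Hyp))}"
    using eq
    by (auto simp: only_def side' foot_in_side_iff[OF is_tile_nondeg[OF tl(1)]] fun_eq_iff)
  also have "\<dots> = map_ptile h ` rectangle_set (fst (d Hyp)) w"
    by (simp add: rectangle_set_def m h(3)[symmetric] t'h[symmetric])
  finally have "star_at T ?F = map_star h (0, rectangle_set (fst (d Hyp)) w)"
    by (simp add: map_star_eq h(2)) (simp add: star_at_def)
  then show ?thesis using that h(1) by blast
qed


section \<open>The decomposition preserves legality\<close>

lemma star_vertex_decomposition:
  assumes "colored_tiling T"
  shows "star_vertex (decomposition c T) (homothety c A) \<longleftrightarrow>
    star_vertex T A \<or> (\<exists>t d. (t, d) \<in> T \<and> kind t = Large \<and> A = foot t)"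
proof -
  have "star_vertex (decomposition c T) (homothety c A) \<longleftrightarrow>
      (\<exists>t d y. (t, d) \<in> T \<and> y \<in> pieces t \<and> homothety c A \<in> vertices (map_tile (homothety c) y))"
    unfolding star_vertex_def Bex_def mem_decomposition[OF assms] by (auto, blast)
  also have "\<dots> \<longleftrightarrow> (\<exists>t d y. (t, d) \<in> T \<and> y \<in> pieces t \<and> A \<in> vertices y)"
    by (simp add: vertices_map_tile inj_image_mem_iff[OF affine_inj_inj[OF homothety_affine_inj]])
  also have "\<dots> \<longleftrightarrow> (\<exists>t d. (t, d) \<in> T \<and> (A \<in> vertices t \<or> kind t = Large \<and> A = foot t))"
  proof -
    have "(\<exists>y\<in>pieces t. A \<in> vertices y) \<longleftrightarrow> A \<in> vertices t \<or> kind t = Large \<and> A = foot t" for t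
      by (cases "kind t") (auto simp: pieces_def vertices_def)
    then show ?thesis by blast
  qed
  finally show ?thesis unfolding star_vertex_def by auto
qed

lemma star_vertex_homothety: "star_vertex T B \<Longrightarrow> \<exists>A. B = homothety c A"
  using affine_inj_surj[OF homothety_affine_inj, of c] by (metis surjD)

lemma pieces_of_rectangle: "(\<Union>t\<in>{upper_half, lower_half}. pieces_at_0 t) = legal_tiles 1"
proof -
  have "(\<Union>t\<in>{upper_half, lower_half}. pieces_at_0 t) = fst ` evolve (rectangle_set 0 1)"
    by (simp add: fst_evolve rectangle_set_def)
  also have "\<dots> = legal_tiles 1" by (simp only: evolve_rectangle fst_legal_set insertI1)
  finally show ?thesis .
qed

text \<open>Old vertices are treated by decomposing the legal stars and new vertices by decomposing the
  rectangle.\<close>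

lemma vertex_figures_decomposition:
  assumes T: "colored_tiling T" "vertex_figures_legal T"
  shows "vertex_figures_legal (decomposition c T)"
  unfolding vertex_figures_legal_def
proof (intro allI impI)
  let ?H = "homothety c" and ?T = "decomposition c T"
  fix B assume B: "star_vertex ?T B"
  obtain A where A: "B = ?H A" using star_vertex_homothety[OF B] by blast
  have ex: "\<exists>n f. n \<in> {1..7} \<and> isometry f \<and> f 0 = B \<and> tiles_at ?T B \<subseteq> map_tile f ` legal_tiles n"
    if f: "isometry f" "f 0 = A" "tiles_at T A \<subseteq> map_tile f ` Y"
      and Y: "n' \<in> {1..7}" "isometry g" "g 0 = 0" "(\<Union>t\<in>Y. pieces_at_0 t) = map_tile g ` legal_tiles n'"
    for f Y n' g
  proof -
    let ?f = "\<lambda>z. ?H A + (f (g z) - f 0)"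
    have "tiles_at ?T B \<subseteq> map_tile ?f ` legal_tiles n'"
      using tiles_at_decomposition[OF T(1) f, of c] unfolding Y(4) A by (simp add: image_image map_tile_comp)
    moreover have "isometry ?f"
      using isometry_comp[OF isometry_translated_linear_part[OF f(1)] Y(2)] .
    moreover have "?f 0 = B" using Y(3) A by simp
    ultimately show ?thesis using Y(1) by blast
  qed
  show "\<exists>n f. n \<in> {1..7} \<and> isometry f \<and> f 0 = B \<and> tiles_at ?T B \<subseteq> map_tile f ` legal_tiles n"
  proof (cases "star_vertex T A")
    case True
    then obtain n f where n: "n \<in> {1..7}" and f: "isometry f" "f 0 = A" "tiles_at T A \<subseteq> map_tile f ` legal_tiles n"
      using T(2) unfolding vertex_figures_legal_def by blast
    obtain n' g where "n' \<in> {1..7}" "isometry g" "g 0 = 0"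
      "(\<Union>t\<in>legal_tiles n. pieces_at_0 t) = map_tile g ` legal_tiles n'"
      using pieces_of_legal_tiles[OF n] by blast
    then show ?thesis by (rule ex[OF f])
  next
    case False
    then obtain t d where t: "(t, d) \<in> T" "kind t = Large" "A = foot t"
      using B unfolding A star_vertex_decomposition[OF T(1)] by blast
    obtain h where h: "isometry h" "h 0 = foot t" "t = map_tile h upper_half"
      using upper_half_at_foot[OF colored_tiling_is_tile[OF T(1) t(1)] t(2)] .
    have "tiles_at T A \<subseteq> map_tile h ` {upper_half, lower_half}"
      using new_vertex_figure[OF T t(1,2) _ h(1,3)] False t(3) by blast
    moreover have "(\<Union>t\<in>{upper_half, lower_half}. pieces_at_0 t) = map_tile (\<lambda>z. z) ` legal_tiles 1"
      unfolding pieces_of_rectangle by simp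
    ultimately show ?thesis
      using ex[of h "{upper_half, lower_half}" 1 "\<lambda>z. z"] h isometry_id t(3) by simp
  qed
qed

lemma star_region_Union: "(\<Union>x\<in>snd (star_at T A). region (fst x)) = (\<Union>t\<in>tiles_at T A. region t)"
  by (simp add: tiles_at_star)

text \<open>The pieces through a point cover no more than the tiles through it.\<close>

lemma complete_star_descends:
  assumes T: "colored_tiling T" and "complete_star (star_at (decomposition c T) (homothety c A))"
  shows "complete_star (star_at T A)"
proof -
  let ?H = "homothety c"
  note a = homothety_affine_inj[of c]
  have "(\<Union>t\<in>tiles_at (decomposition c T) (?H A). region t) \<subseteq> ?H ` (\<Union>t\<in>tiles_at T A. region t)"
  proof (rule UN_least)
    fix x assume "x \<in> tiles_at (decomposition c T) (?H A)"
    then obtain t d y where t: "(t, d) \<in> T" "y \<in> pieces t" "x = map_tile ?H y" "?H A \<in> region (map_tile ?H y)"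
      unfolding tiles_at_def mem_decomposition[OF T] by auto
    then have "A \<in> region y"
      by (simp add: region_map_tile[OF a] inj_image_mem_iff[OF affine_inj_inj[OF a]])
    moreover have y: "region y \<subseteq> region t"
      using piece_region_subset[OF is_tile_nondeg[OF colored_tiling_is_tile[OF T t(1)]] t(2)] .
    ultimately have "t \<in> tiles_at T A" using t(1) unfolding tiles_at_def by blast
    then show "region x \<subseteq> ?H ` (\<Union>t\<in>tiles_at T A. region t)"
      using y unfolding t(3) region_map_tile[OF a] by blast
  qed
  then have "interior (\<Union>t\<in>tiles_at (decomposition c T) (?H A). region t)
      \<subseteq> ?H ` interior (\<Union>t\<in>tiles_at T A. region t)"
    unfolding affine_inj_interior[OF a, symmetric] by (rule interior_mono)
  moreover have c: "fst (star_at T' B) = B" for T' B by (simp add: star_at_def)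
  ultimately have "?H A \<in> ?H ` interior (\<Union>t\<in>tiles_at T A. region t)"
    using assms(2) unfolding complete_star_def star_region_Union c by blast
  then show ?thesis
    unfolding complete_star_def star_region_Union c inj_image_mem_iff[OF affine_inj_inj[OF a]] .
qed

text \<open>A single tile does not cover a neighborhood of a point on its boundary.\<close>

lemma boundary_star_incomplete:
  assumes "is_tile t" "A \<in> side_set t s" "tiles_at T A \<subseteq> {t}"
  shows "\<not> complete_star (star_at T A)"
proof
  assume "complete_star (star_at T A)"
  then have "A \<in> interior (\<Union>t\<in>tiles_at T A. region t)"
    unfolding complete_star_def star_region_Union by (simp add: star_at_def)
  moreover have "(\<Union>t\<in>tiles_at T A. region t) \<subseteq> region t" using assms(3) by blast
  ultimately have "A \<in> interior (region t)" using interior_mono by blast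
  then show False using side_disjoint_interior[OF is_tile_nondeg[OF assms(1)], of s] assms(2) by blast
qed

lemma cong_next_label:
  fixes l n n' :: nat
  assumes "[l = n] (mod 2)" "[n' = n + 1] (mod 2)"
  shows "[(l + 1) mod 4 = n'] (mod 2)"
proof -
  have "(l + 1) mod 4 mod 2 = (l + 1) mod 2" by (rule mod_mod_cancel) simp
  also have "\<dots> = (n + 1) mod 2" using cong_add[OF assms(1) cong_refl[of 1]] by (simp only: cong_def)
  finally show ?thesis using assms(2) by (simp only: cong_def)
qed

text \<open>The evolved star has a number of the other parity and its label is increased by 1.\<close>

lemma copy_of_legal_step:
  assumes T: "colored_tiling T" and S: "copy_of_legal (star_at T A)"
  shows "copy_of_legal (star_at (decomposition c T) (homothety c A))"
proof -
  obtain n l w f where n: "n \<in> {1..7}" "l < 4" "[l = n] (mod 2)" "w \<in> {1, - 1}"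
    and f: "isometry f" "star_at T A = map_star f (0, legal_set n l w)"
    using S unfolding copy_of_legal_def legal_star_set by blast
  obtain n' w' g where g: "n' \<in> {1..7}" "w' \<in> {1, -1}" "isometry g" "g 0 = 0" "[n' = n + 1] (mod 2)"
    "evolve (legal_set n l w) = map_ptile g ` legal_set n' ((l + 1) mod 4) w'"
    by (rule evolve_legal[OF n(1,4), of l]) auto
  let ?f = "\<lambda>z. homothety c A + (f z - f 0)"
  have i: "isometry ?f" using star_decomposition_evolve(2)[OF T f] .
  have "star_at (decomposition c T) (homothety c A) = map_star ?f (0, evolve (legal_set n l w))"
    by (rule star_decomposition_evolve(1)[OF T f])
  also have "\<dots> = map_star ?f (map_star g (legal_star n' ((l + 1) mod 4) w'))"
    unfolding g(6) legal_star_set map_star_eq g(4) ..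
  also have "\<dots> = map_star (\<lambda>z. ?f (g z)) (legal_star n' ((l + 1) mod 4) w')"
    by (rule map_star_comp[OF i])
  finally have "star_at (decomposition c T) (homothety c A) =
    map_star (\<lambda>z. ?f (g z)) (legal_star n' ((l + 1) mod 4) w')" .
  moreover have "[(l + 1) mod 4 = n'] (mod 2)"
    using cong_next_label[OF n(3) g(5)] .
  ultimately show ?thesis
    unfolding copy_of_legal_def using g(1,2) isometry_comp[OF i g(3)]
    by (intro exI[of _ n'] exI[of _ "(l + 1) mod 4"] exI[of _ w'] exI[of _ "\<lambda>z. ?f (g z)"]) simp
qed

lemma decor_Hyp:
  assumes "colored_tiling T" "(t, d) \<in> T" "kind t = Large"
  obtains w where "w \<in> {1, -1}" "snd (d Hyp) = w * (vL t - vS t)" "fst (d Hyp) < 4" "even (fst (d Hyp))"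
proof -
  have t: "is_tile t" by (rule colored_tiling_is_tile[OF assms(1,2)])
  have c: "is_colored_tile (t, d)" using assms unfolding colored_tiling_def by blast
  note e = ends_Hyp[of t]
  have "cmod (vS t - vL t) = 1"
    using side_length_dist[OF t, of Hyp] assms(3) by (simp add: e dist_norm)
  then have "sgn (vL t - vS t) = vL t - vS t" "sgn (vS t - vL t) = vS t - vL t"
    by (simp_all add: sgn_div_norm norm_minus_commute)
  then have "snd (d Hyp) \<in> {vL t - vS t, vS t - vL t}" "fst (d Hyp) < 4" "even (fst (d Hyp))"
    using c[unfolded is_colored_tile_def prod.case, THEN conjunct2, THEN spec, of Hyp] assms(3) e
    by simp_all
  then show ?thesis using that[of 1] that[of "- 1"] by auto
qed

text \<open>If the star at a new vertex is complete, there is a tile across the hypotenuse, and the rectangle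
  evolves to the first legal star. The label of a hypotenuse of a large tile is even, so the new label is odd.\<close>

lemma complete_stars_decomposition:
  assumes T: "colored_tiling T" "matching T" "vertex_figures_legal T" "complete_stars_legal T"
  shows "complete_stars_legal (decomposition c T)"
  unfolding complete_stars_legal_def
proof (intro allI impI)
  let ?H = "homothety c" and ?T = "decomposition c T"
  fix B assume B: "star_vertex ?T B \<and> complete_star (star_at ?T B)"
  obtain A where A: "B = ?H A" using star_vertex_homothety B by blast
  have comp: "complete_star (star_at T A)" using complete_star_descends[OF T(1)] B A by blast
  show "copy_of_legal (star_at ?T B)"
  proof (cases "star_vertex T A")
    case True
    then have "copy_of_legal (star_at T A)" using T(4) comp unfolding complete_stars_legal_def by blast
    then show ?thesis unfolding A by (rule copy_of_legal_step[OF T(1)])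
  next
    case False
    then obtain t d where t: "(t, d) \<in> T" "kind t = Large" "A = foot t"
      using B unfolding A star_vertex_decomposition[OF T(1)] by blast
    have tl: "is_tile t" by (rule colored_tiling_is_tile[OF T(1) t(1)])
    have "A \<in> side_set t Hyp" using foot_in_side_iff[OF is_tile_nondeg[OF tl]] t(3) by simp
    then have "\<not> tiles_at T A \<subseteq> {t}" using boundary_star_incomplete[OF tl] comp by blast
    then obtain t' d' where t': "(t', d') \<in> T" "foot t \<in> region t'" "(t', d') \<noteq> (t, d)"
      unfolding tiles_at_def t(3) by blast
    obtain w where w: "w \<in> {1, -1}" "snd (d Hyp) = w * (vL t - vS t)" "fst (d Hyp) < 4" "even (fst (d Hyp))"
      using decor_Hyp[OF T(1) t(1,2)] .
    obtain h where h: "isometry h" "star_at T (foot t) = map_star h (0, rectangle_set (fst (d Hyp)) w)"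
      using new_star[OF T(1,3,2) t(1,2) _ t' w(1,2)] False t(3) by blast
    have "star_at ?T B = map_star (\<lambda>z. ?H (foot t) + (h z - h 0)) (legal_star 1 ((fst (d Hyp) + 1) mod 4) w)"
      unfolding A t(3) legal_star_set evolve_rectangle[OF w(1), symmetric]
      by (rule star_decomposition_evolve(1)[OF T(1) h])
    moreover have "isometry (\<lambda>z. ?H (foot t) + (h z - h 0))"
      by (rule star_decomposition_evolve(2)[OF T(1) h])
    moreover have "[fst (d Hyp) = 0] (mod 2)" using w(4) by (simp add: cong_def even_iff_mod_2_eq_zero)
    then have "[(fst (d Hyp) + 1) mod 4 = 1] (mod 2)" by (rule cong_next_label) (simp add: cong_def)
    ultimately show ?thesis unfolding copy_of_legal_def using w(1)
      by (intro exI[of _ 1] exI[of _ "(fst (d Hyp) + 1) mod 4"] exI[of _ w]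
          exI[of _ "\<lambda>z. ?H (foot t) + (h z - h 0)"]) simp
  qed
qed

text \<open>The invariant of the decomposition that holds for tilings of the plane as well as for supertiles.\<close>

definition locally_legal :: "colored_tile set \<Rightarrow> bool" where
  "locally_legal T \<longleftrightarrow>
     colored_tiling T \<and> matching T \<and> vertex_figures_legal T \<and> complete_stars_legal T"

lemma locally_legal_L_tiling: "locally_legal T \<Longrightarrow> L_tiling T"
  by (simp add: locally_legal_def L_tiling_iff)

lemma locally_legal_decomposition: "locally_legal T \<Longrightarrow> locally_legal (decomposition c T)"
  unfolding locally_legal_def
  using colored_tiling_decomposition matching_decomposition vertex_figures_decomposition
    complete_stars_decomposition by blast

lemma locally_legal_plane:
  assumes "L_tiling T" "covers_plane T"
  shows "locally_legal T"
proof -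
  have T: "colored_tiling T" "matching T" "complete_stars_legal T"
    using assms(1) by (simp_all add: L_tiling_iff)
  have "vertex_figures_legal T"
    unfolding vertex_figures_legal_def
  proof (intro allI impI)
    fix A assume "star_vertex T A"
    then have "copy_of_legal (star_at T A)"
      using T(3) complete_star_plane[OF T(1) assms(2)] unfolding complete_stars_legal_def by blast
    then obtain n l w f where n: "n \<in> {1..7}" "isometry f" "star_at T A = map_star f (0, legal_set n l w)"
      unfolding copy_of_legal_def legal_star_set by blast
    have "fst (star_at T A) = f 0" "snd (star_at T A) = map_ptile f ` legal_set n l w"
      unfolding n(3) map_star_eq by simp_all
    then have "f 0 = A" "tiles_at T A = map_tile f ` legal_tiles n"
      unfolding tiles_at_star fst_legal_set[of n l w, symmetric]
      by (simp_all add: star_at_def image_image fst_map_ptile)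
    then show "\<exists>n f. n \<in> {1..7} \<and> isometry f \<and> f 0 = A \<and> tiles_at T A \<subseteq> map_tile f ` legal_tiles n"
      using n(1,2) by blast
  qed
  then show ?thesis using T by (simp add: locally_legal_def)
qed

text \<open>Each corner of a large tile occurs at the center of some legal star, and no vertex of a single tile
  has a complete star.\<close>

lemma locally_legal_single:
  assumes "is_colored_tile (t, d)" "kind t = Large"
  shows "locally_legal {(t, d)}"
proof -
  have t: "is_tile t" using assms(1) by (simp add: is_colored_tile_def)
  have n: "nondeg t" by (rule is_tile_nondeg[OF t])
  have "colored_tiling {(t, d)}" using assms(1) by (simp add: colored_tiling_def)
  moreover have "s = s'" if "x \<noteq> y" "closed_segment x y \<subseteq> side_set t s \<inter> side_set t s'" for x y s s'
    using same_side_of_interval[OF n that(1), of s s'] subsetD[OF that(2) ends_in_segment(1)]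
      subsetD[OF that(2) ends_in_segment(2)] by blast
  then have "matching {(t, d)}" unfolding matching_def by (simp, blast)
  moreover have tiles: "tiles_at {(t, d)} A \<subseteq> {t}" for A by (auto simp: tiles_at_def)
  have "vertex_figures_legal {(t, d)}"
    unfolding vertex_figures_legal_def
  proof (intro allI impI)
    fix A assume "star_vertex {(t, d)} A"
    then have "A = vR t \<or> A = vS t \<or> A = vL t" by (auto simp: star_vertex_def vertices_def)
    then obtain x n where x: "n \<in> {1..7}" "x \<in> legal_tiles n" "is_tile x" "kind x = Large"
      "A = vR t \<and> vR x = 0 \<or> A = vS t \<and> vS x = 0 \<or> A = vL t \<and> vL x = 0"
    proof (elim disjE)
      \<comment> \<open>The corners at the right, smaller and larger acute angle are taken from the first, third and second
         star.\<close>
      assume "A = vR t"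
      moreover have "fan_tile (- 1) Large BA \<in> legal_tiles 1"
        by (simp add: legal_tiles_def upper_tiles_list upper_list_def)
      ultimately show ?thesis
        using that[of 1 "fan_tile (- 1) Large BA"] is_tile_fan_tile[of "- 1" Large BA]
        by (simp add: fan_tile_def)
    next
      assume "A = vS t"
      moreover have "fan_tile (- cis (- large_angle)) Large BH \<in> legal_tiles 3"
        by (simp add: legal_tiles_def upper_tiles_list upper_list_def)
      ultimately show ?thesis
        using that[of 3 "fan_tile (- cis (- large_angle)) Large BH"] is_tile_fan_tile[of "- cis (- large_angle)" Large BH]
        by (simp add: fan_tile_def)
    next
      assume "A = vL t"
      moreover have "fan_tile (- 1) Large HA \<in> legal_tiles 2"
        by (simp add: legal_tiles_def upper_tiles_list upper_list_def)
      ultimately show ?thesis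
        using that[of 2 "fan_tile (- 1) Large HA"] is_tile_fan_tile[of "- 1" Large HA]
        by (simp add: fan_tile_def)
    qed
    have "kind t = kind x" using x(4) assms(2) by simp
    from is_tile_congruent[OF t x(3) this] obtain h where h: "isometry h" "t = map_tile h x" .
    have "h 0 = A" using x(5) by (auto simp: h(2))
    moreover have "tiles_at {(t, d)} A \<subseteq> map_tile h ` legal_tiles n" using tiles x(2) h(2) by blast
    ultimately show "\<exists>n f. n \<in> {1..7} \<and> isometry f \<and> f 0 = A \<and> tiles_at {(t, d)} A \<subseteq> map_tile f ` legal_tiles n"
      using x(1) h(1) by blast
  qed
  moreover have "complete_stars_legal {(t, d)}"
  proof -
    have "\<not> complete_star (star_at {(t, d)} A)" if "star_vertex {(t, d)} A" for A
    proof -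
      have "A = vR t \<or> A = vS t \<or> A = vL t" using that by (auto simp: star_vertex_def vertices_def)
      then have "\<exists>s. A \<in> side_set t s" using vertex_in_side[OF n] by blast
      then show ?thesis using boundary_star_incomplete[OF t _ tiles] by blast
    qed
    then show ?thesis unfolding complete_stars_legal_def by blast
  qed
  ultimately show ?thesis by (simp add: locally_legal_def)
qed

lemma supertile_locally_legal:
  assumes "supertile c T"
  shows "locally_legal T"
proof -
  obtain n t d where "is_colored_tile (t, d)" "kind t = Large" "T = (decomposition c ^^ n) {(t, d)}"
    using assms unfolding supertile_def by blast
  moreover from this(1,2) have "locally_legal ((decomposition c ^^ n) {(t, d)})" for n
    by (induction n) (simp_all add: locally_legal_single locally_legal_decomposition)
  ultimately show ?thesis by simp
qed

lemma supertile_decomposition: "supertile c T \<Longrightarrow> supertile c (decomposition c T)"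
proof -
  assume "supertile c T"
  then obtain n t d where "is_colored_tile (t, d)" "kind t = Large" "T = (decomposition c ^^ n) {(t, d)}"
    unfolding supertile_def by blast
  then show ?thesis unfolding supertile_def
    by (intro exI[of _ "Suc n"] exI[of _ t] exI[of _ d]) simp
qed


section \<open>All legal stars occur\<close>

definition occurs :: "complex \<Rightarrow> nat \<Rightarrow> nat \<Rightarrow> complex \<Rightarrow> bool" where
  "occurs c n l w \<longleftrightarrow> (\<exists>T A f. supertile c T \<and> star_vertex T A \<and> isometry f \<and>
     star_at T A = map_star f (legal_star n l w))"

lemma occurs_Suc:
  assumes "occurs c n l w" "n \<in> {1..6}" "w \<in> {1, -1}"
  shows "occurs c (Suc n) ((l + 1) mod 4) w"
proof -
  obtain T A f where T: "supertile c T" "star_vertex T A" "isometry f" "star_at T A = map_star f (0, legal_set n l w)"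
    using assms(1) unfolding occurs_def legal_star_set by blast
  have "colored_tiling T" using supertile_locally_legal[OF T(1)] by (simp add: locally_legal_def)
  from star_decomposition_evolve[OF this T(3,4), of c] star_vertex_decomposition[OF this, of c A]
  show ?thesis unfolding occurs_def legal_star_set evolve_legal_Suc[OF assms(2,3)]
    using supertile_decomposition[OF T(1)] T(2) by blast
qed

text \<open>Since \<open>C_1\<close> evolves through all other stars with the label of the axis increased by 1 in each step,
  the label \<open>l\<close> at \<open>C_n\<close> comes from the label \<open>l - n + 1\<close> at \<open>C_1\<close>.\<close>

lemma occurs_from_first:
  assumes "\<And>l w. l \<in> {1, 3} \<Longrightarrow> w \<in> {1, -1} \<Longrightarrow> occurs c 1 l w"
    and "n \<in> {1..7}" "l < 4" "[l = n] (mod 2)" "w \<in> {1, -1}"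
  shows "occurs c n l w"
proof -
  have "\<forall>l. l < 4 \<and> [l = Suc k] (mod 2) \<longrightarrow> occurs c (Suc k) l w" if "k \<le> 6" for k
    using that
  proof (induction k)
    case 0
    have "l \<in> {1, 3}" if "l < 4" "[l = Suc 0] (mod 2)" for l :: nat
    proof -
      have "l = 0 \<or> l = 1 \<or> l = 2 \<or> l = 3" using that(1) by linarith
      then show ?thesis using that(2) by (auto simp: cong_def)
    qed
    then show ?case using assms(1) assms(5) by simp
  next
    case (Suc k)
    show ?case
    proof (intro allI impI)
      fix l assume l: "l < 4 \<and> [l = Suc (Suc k)] (mod 2)"
      \<comment> \<open>\<open>l - 1\<close> modulo 4, the label one step earlier.\<close>
      define l' where "l' = (l + 3) mod 4"
      have "l = 0 \<or> l = 1 \<or> l = 2 \<or> l = 3" using l by linarith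
      then have l': "(l' + 1) mod 4 = l" "l' < 4" by (auto simp: l'_def)
      have "[l' = l + 3] (mod 2)" unfolding l'_def cong_def by (rule mod_mod_cancel) simp
      also have "[l + 3 = Suc (Suc k) + 3] (mod 2)" using l by (simp only: cong_add_rcancel_nat)
      also have "[Suc (Suc k) + 3 = Suc k] (mod 2)"
      proof -
        have "Suc (Suc k) + 3 = Suc k + 2 * 2" by simp
        then show ?thesis unfolding cong_def by (simp only: mod_mult_self2)
      qed
      finally have "occurs c (Suc k) l' w" using Suc l'(2) by simp
      then show "occurs c (Suc (Suc k)) l w"
        using occurs_Suc[of c "Suc k" l' w] Suc.prems assms(5) l'(1) by simp
    qed
  qed
  moreover have "n - 1 \<le> 6" "Suc (n - 1) = n" using assms(2) by auto
  ultimately show ?thesis using assms(3,4) by metis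
qed

abbreviation next_label :: "nat \<Rightarrow> nat" where
  "next_label l \<equiv> (l + 1) mod 4"

definition labelled :: "colored_tile set \<Rightarrow> tile \<Rightarrow> side \<Rightarrow> nat \<Rightarrow> bool" where
  "labelled T t s l \<longleftrightarrow> (\<exists>d. (t, d) \<in> T \<and> fst (d s) = l)"

text \<open>Two large tiles with coinciding, oppositely directed hypotenuses of label \<open>l\<close>.\<close>

definition rectangle_in :: "nat \<Rightarrow> colored_tile set \<Rightarrow> bool" where
  "rectangle_in l T \<longleftrightarrow> (\<exists>r r' p q.
     labelled T (Tile Large r p q) Hyp l \<and> labelled T (Tile Large r' q p) Hyp l)"

text \<open>The halves of a rectangle are exchanged by a half-turn, which reverses the orientation of the
  diagonal relative to the altitude foot; so one of the two feet has a star with the required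
  orientation.\<close>

lemma occurs_first:
  assumes S: "supertile c T" and R: "rectangle_in l T" and w: "w \<in> {1, -1}"
  shows "occurs c 1 ((l + 1) mod 4) w"
proof -
  have T: "colored_tiling T" "matching T" "vertex_figures_legal T"
    using supertile_locally_legal[OF S] by (simp_all add: locally_legal_def)
  obtain r r' p q d d' where "(Tile Large r p q, d) \<in> T" "fst (d Hyp) = l" "(Tile Large r' q p, d') \<in> T"
    using R unfolding rectangle_in_def labelled_def by blast
  then obtain t t' where t: "(t, d) \<in> T" "(t', d') \<in> T" "kind t = Large" "kind t' = Large"
     "vS t' = vL t" "vL t' = vS t" "fst (d Hyp) = l"
    by (metis tile.sel)
  have n: "nondeg t" using colored_tiling_is_tile[OF T(1)] is_tile_nondeg t(1) by blast
  have eq: "d Hyp = d' Hyp"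
    using matching_reversed_hyps[OF T(2) t(1,2,5,6)] distinct_vertices[OF n] by blast
  have gen: "occurs c 1 ((l + 1) mod 4) v"
    if x: "(x, e) \<in> T" "(x', e') \<in> T" "kind x = Large" "vS x' = vL x" "vL x' = vS x"
      "fst (e Hyp) = l" "v \<in> {1, -1}" "snd (e Hyp) = v * (vL x - vS x)" for x e x' e' v
  proof -
    have nx: "nondeg x" using colored_tiling_is_tile[OF T(1)] is_tile_nondeg x(1) by blast
    have ne: "x \<noteq> x'" using distinct_vertices[OF nx] x(4) by auto
    have hyp: "foot x \<in> open_segment (vS x) (vL x)" "foot x \<in> open_segment (vS x') (vL x')"
      using foot_in_hyp[OF nx] x(4,5) by (simp_all add: open_segment_commute)
    have nv: "\<not> star_vertex T (foot x)"
      using vertex_inside_hyp[OF T(3)] x(1,2) hyp ne by metis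
    have "(x', e') \<noteq> (x, e)" using ne by auto
    then obtain h where h: "isometry h" "star_at T (foot x) = map_star h (0, rectangle_set (fst (e Hyp)) v)"
      using new_star[OF T(1,3,2) x(1,3) nv x(2) _ _ x(7,8)] hyp(2) open_hyp_subset_region by blast
    have "star_vertex (decomposition c T) (homothety c (foot x))"
      using star_vertex_decomposition[OF T(1)] x(1,3) by blast
    then show ?thesis
      using star_decomposition_evolve[OF T(1) h, of c] supertile_decomposition[OF S] x(6)
      unfolding occurs_def legal_star_set evolve_rectangle[OF x(7)] by blast
  qed
  obtain v where v: "v \<in> {1, -1}" "snd (d Hyp) = v * (vL t - vS t)"
    using decor_Hyp[OF T(1) t(1,3)] by blast
  \<comment> \<open>The two altitude feet on a common hypotenuse see its orientation in opposite ways.\<close>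
  show ?thesis
  proof (cases "w = v")
    case True
    then show ?thesis using gen[OF t(1,2,3,5,6,7) v] by simp
  next
    case False
    then have "w = - v" using v w by auto
    then show ?thesis
      using gen[OF t(2,1,4), of w] t eq v w by (simp add: algebra_simps)
  qed
qed

text \<open>The altitude foot on a hypotenuse with ends \<open>p\<close> and \<open>q\<close> at the smaller and the larger acute angle.\<close>

definition wfoot :: "complex \<Rightarrow> complex \<Rightarrow> complex" where
  "wfoot p q = phi ^ 4 *\<^sub>R p + phi\<^sup>2 *\<^sub>R q"

lemma homothety_wfoot: "homothety c (wfoot p q) = wfoot (homothety c p) (homothety c q)"
  unfolding wfoot_def by (rule affine_inj_comb[OF homothety_affine_inj phi_weights])

text \<open>On the part of the hypotenuse between \<open>p\<close> and its altitude foot, the next altitude foot is that of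
  the hypotenuse with \<open>p\<close> and \<open>q\<close> exchanged.\<close>

lemma wfoot_wfoot: "wfoot p (wfoot p q) = wfoot q p"
proof -
  have "wfoot p (wfoot p q) = (phi ^ 4 + phi ^ 6) *\<^sub>R p + phi ^ 4 *\<^sub>R q"
    by (simp add: wfoot_def algebra_simps flip: power_add)
  also have "phi ^ 4 + phi ^ 6 = phi\<^sup>2" by (simp add: phi_four phi_powers)
  finally show ?thesis by (simp add: wfoot_def add.commute)
qed

lemma labelled_piece:
  assumes "colored_tiling T" "labelled T t s l" "y \<in> pieces t"
    "parent_side (kind t) (kind y) s' = Some s"
  shows "labelled (decomposition c T) (map_tile (homothety c) y) s' (next_label l)"
proof -
  obtain d where d: "(t, d) \<in> T" "fst (d s) = l" using assms(2) labelled_def by blast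
  then have "(map_tile (homothety c) y, piece_decor t d y) \<in> decomposition c T"
    using assms(3) unfolding mem_decomposition[OF assms(1)] by blast
  moreover have "fst (piece_decor t d y s') = next_label l"
    by (simp add: piece_decor_def assms(4) relabel_def case_prod_beta d)
  ultimately show ?thesis unfolding labelled_def by blast
qed

lemma labelled_altitude:
  assumes "colored_tiling T" "labelled T t s l" "y \<in> pieces t" "parent_side (kind t) (kind y) s' = None"
  shows "labelled (decomposition c T) (map_tile (homothety c) y) s' 0"
proof -
  obtain d where "(t, d) \<in> T" using assms(2) labelled_def by blast
  then have "(map_tile (homothety c) y, piece_decor t d y) \<in> decomposition c T"
    using assms(3) unfolding mem_decomposition[OF assms(1)] by blast
  moreover have "fst (piece_decor t d y s') = 0"
    by (simp add: piece_decor_def assms(4) altitude_decor_def)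
  ultimately show ?thesis unfolding labelled_def by blast
qed

text \<open>How a labelled side passes from a tile to a piece.\<close>

lemma labelled_pieces:
  fixes c :: complex
  assumes T: "colored_tiling T"
  defines "H \<equiv> homothety c"
  shows "labelled T (Tile Large r p q) BigLeg l \<Longrightarrow>
      labelled (decomposition c T) (Tile Large (wfoot (H p) (H q)) (H p) (H r)) Hyp (next_label l)"
    and "labelled T (Tile Large r p q) Hyp l \<Longrightarrow>
      labelled (decomposition c T) (Tile Large (wfoot (H p) (H q)) (H p) (H r)) BigLeg (next_label l)"
    and "labelled T (Tile Large r p q) SmallLeg l \<Longrightarrow>
      labelled (decomposition c T) (Tile Small (wfoot (H p) (H q)) (H r) (H q)) Hyp (next_label l)"
    and "labelled T (Tile Large r p q) Hyp l \<Longrightarrow>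
      labelled (decomposition c T) (Tile Small (wfoot (H p) (H q)) (H r) (H q)) SmallLeg (next_label l)"
    and "labelled T (Tile Small r p q) s l \<Longrightarrow>
      labelled (decomposition c T) (Tile Large (H r) (H p) (H q)) s (next_label l)"
  using labelled_piece[OF T, of "Tile Large r p q" _ l "Tile Large (wfoot p q) p r" _ c]
    labelled_piece[OF T, of "Tile Large r p q" _ l "Tile Small (wfoot p q) r q" _ c]
    labelled_piece[OF T, of "Tile Small r p q" s l "Tile Large r p q" s c]
  by (simp_all add: pieces_def foot_def wfoot_def[symmetric] homothety_wfoot H_def)

text \<open>The two sides of an altitude from \<open>f\<close> to \<open>r\<close> are the small leg of a large tile and the large leg of a
  small tile, with label 0. Two steps later both have become hypotenuses of large tiles, with label 2
  and opposite directions. Given a rectangle, consider in each half the part of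
  the diagonal from its smaller acute angle to its altitude foot: it becomes a large leg and then a
  hypotenuse, and cutting this hypotenuse leaves the segment between the two altitude feet of the
  diagonal as a small leg, which three more steps turn into the hypotenuse of a large tile; the two
  halves give opposite directions. These six steps increase the label from 2 to \<open>8\<close>, that is, to 0.\<close>

lemma rectangles_occur:
  "\<exists>T. supertile c T \<and> rectangle_in 2 T" "\<exists>T. supertile c T \<and> rectangle_in 0 T"
proof -
  define d where "d = (\<lambda>s. (if even_side Large s then 0 else 1 :: nat,
     sgn (snd (ends proto_L s) - fst (ends proto_L s))))"
  have "is_tile proto_L"
    unfolding is_tile_def using isometry_id by (intro exI[of _ "\<lambda>z. z"]) simp
  then have "is_colored_tile (proto_L, d)"
    by (auto simp: is_colored_tile_def d_def case_prod_beta proto_L_def)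
  then have "supertile c ((decomposition c ^^ 0) {(proto_L, d)})"
    unfolding supertile_def by (intro exI[of _ 0] exI[of _ proto_L] exI[of _ d]) (simp add: proto_L_def)
  then have S: "supertile c ((decomposition c ^^ n) {(proto_L, d)})" for n
    by (induction n) (auto intro: supertile_decomposition)
  define X where "X n = (decomposition c ^^ n) {(proto_L, d)}" for n
  have X: "supertile c (X n)" "X (Suc n) = decomposition c (X n)" "colored_tiling (X n)" for n
    using S[of n] supertile_locally_legal[OF S[of n]] by (simp_all add: X_def locally_legal_def)
  note step = labelled_pieces[OF X(3), where c = c, folded X(2)]
  let ?H = "homothety c"
  have "labelled (X 0) proto_L Hyp 0" by (simp add: labelled_def X_def d_def)
  then obtain f p r q where
    a: "labelled (X 1) (Tile Large f p r) SmallLeg 0" and b: "labelled (X 1) (Tile Small f r q) BigLeg 0"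
    using labelled_altitude[OF X(3), of 0 proto_L Hyp 0 "Tile Large (foot proto_L) (vS proto_L) (vR proto_L)" SmallLeg c, folded X(2)]
      labelled_altitude[OF X(3), of 0 proto_L Hyp 0 "Tile Small (foot proto_L) (vR proto_L) (vL proto_L)" BigLeg c, folded X(2)]
    by (simp add: pieces_def proto_L_def)
  have "\<exists>s. labelled (X 3) (Tile Large s (?H (?H f)) (?H (?H r))) Hyp 2"
    using step(5)[OF step(3)[OF a]] by (auto simp: numeral_2_eq_2 numeral_3_eq_3)
  moreover have "\<exists>s. labelled (X 3) (Tile Large s (?H (?H r)) (?H (?H f))) Hyp 2"
    using step(1)[OF step(5)[OF b]] by (auto simp: numeral_2_eq_2 numeral_3_eq_3)
  ultimately have R: "rectangle_in 2 (X 3)" unfolding rectangle_in_def by blast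
  then show "\<exists>T. supertile c T \<and> rectangle_in 2 T" using X(1) by blast
  have six: "\<exists>s. labelled (X 9) (Tile Large s (wfoot (h q) (h p)) (wfoot (h p) (h q))) Hyp 0"
    if "labelled (X 3) (Tile Large r p q) Hyp 2" and h: "h = (\<lambda>z. ?H (?H (?H (?H (?H (?H z))))))" for r p q h
    using step(5)[OF step(3)[OF step(5)[OF step(4)[OF step(1)[OF step(2)[OF that(1)]]]]]]
    by (auto simp: h homothety_wfoot wfoot_wfoot)
  from R have "rectangle_in 0 (X 9)"
    unfolding rectangle_in_def using six[OF _ refl] by meson
  then show "\<exists>T. supertile c T \<and> rectangle_in 0 T" using X(1) by blast
qed

lemma legal_stars_occur:
  assumes "n \<in> {1..7}" "l < 4" "[l = n] (mod 2)" "w \<in> {1, -1}"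
  shows "occurs c n l w"
proof (rule occurs_from_first[OF _ assms])
  fix l :: nat and w :: complex
  assume l: "l \<in> {1, 3}" and w: "w \<in> {1, -1}"
  obtain T T' where "supertile c T" "rectangle_in 2 T" "supertile c T'" "rectangle_in 0 T'"
    using rectangles_occur[of c] by blast
  then have "occurs c 1 ((2 + 1) mod 4) w" "occurs c 1 ((0 + 1) mod 4) w"
    using occurs_first w by blast+
  then show "occurs c 1 l w" using l by auto
qed

theorem theorem1:
  fixes c :: complex
  shows "(\<forall>T. L_tiling T \<and> covers_plane T \<longrightarrow>
            L_tiling (decomposition c T) \<and> covers_plane (decomposition c T)) \<and>
         (\<forall>T. supertile c T \<longrightarrow> L_tiling T) \<and>
         (\<forall>S. legal S \<longrightarrow>
            (\<exists>T A. supertile c T \<and> star_vertex T A \<and> congruent_stars (star_at T A) S))"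
proof (intro conjI allI impI)
  fix T assume T: "L_tiling T \<and> covers_plane T"
  then show "L_tiling (decomposition c T)"
    using locally_legal_plane locally_legal_decomposition locally_legal_L_tiling by blast
  show "covers_plane (decomposition c T)"
    using T covers_plane_decomposition by (simp add: L_tiling_def)
next
  fix T assume "supertile c T"
  then show "L_tiling T" using supertile_locally_legal locally_legal_L_tiling by blast
next
  fix S assume "legal S"
  then obtain n l w where n: "n \<in> {1..7}" "l < 4" "[l = n] (mod 2)" "w \<in> {1, - 1}"
    "congruent_stars (legal_star n l w) S" unfolding legal_def by blast
  obtain T A f where "supertile c T" "star_vertex T A" "isometry f" "star_at T A = map_star f (legal_star n l w)"
    using legal_stars_occur[OF n(1-4), of c] unfolding occurs_def by blast
  then show "\<exists>T A. supertile c T \<and> star_vertex T A \<and> congruent_stars (star_at T A) S"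
    using congruent_stars_via_copy[OF _ _ n(5)] by blast
qed

end
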